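(* Let $R$ be a discrete valuation ring with fixed uniformizer $t$. Suppose that $(X,c)$ is cyclically ordered and $\phi$ is an admissible automorphism of $X$. Then every object of $\mathcal{MF}_\phi(X)$ is isomorphic to a finite direct sum of objects of the form $E(x,y)$ where $(\phi x,y,\phi^{-1}x)$ is in cyclic order. Furthermore, each $E(x,y)$ is indecomposable, and the indecomposable direct summands of any object of $\mathcal{MF}_\phi(X)$ are uniquely determined up to isomorphism. Finally, $E(x,y)$ is projective-injective in $\mathcal{MF}_\phi(X)$ if and only if either $y\approx\phi x$ or $x\approx\phi y$.
   Context: $\mathbb N=\{0,1,2,\dots\}$. A poset is a set with a reflexive transitive relation $\le$ (not necessarily antisymmetric); $x\approx y$ means $x\le y$ and $y\le x$; $x<y$ means $x\le y$ and $x\not\approx y$. A covering poset of a set $X$ is a poset $\tilde X$ with a surjection $\pi:\tilde X\to X$ such that (1) each $\pi^{-1}(x)$ is isomorphic as a poset to $\mathbb Z$; (2) there is a poset automorphism $\sigma$ of $\tilde X$ such that $\sigma\tilde x$ is the smallest element of $\pi^{-1}(\pi(\tilde x))$ greater than $\tilde x$; (3) for all $\tilde x,\tilde y$ there is an integer $m\ge0$ with $\tilde x\le\sigma^m\tilde y\le\sigma^{2m}\tilde x$. For a section $\lambda$ of $\pi$, let $b_\lambda(xy)$ be the smallest integer $m$ with $\lambda(x)\le\sigma^m\lambda(y)$; the structure cocycle is $c(xyz)=b_\lambda(yz)-b_\lambda(xz)+b_\lambda(xy)$ (independent of $\lambda$). A cyclic poset is a pair $(X,c)$ with $c:X^3\to\mathbb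 N$ a reduced cocycle: $c(xyz)-c(wyz)+c(wxz)-c(wxy)=0$ and $c(xxy)=c(xyy)=0$. Every such $c$ is the structure cocycle of a covering poset $\tilde X\to X$, unique up to $\sigma$-equivariant poset isomorphism over $X$. In $X$, $x\approx y$ means $c(xyx)=c(yxy)=0$ (equivalently some liftings to $\tilde X$ are equivalent). $(X,c)$ is cyclically ordered if $\tilde X$ is totally ordered (any two elements are comparable). A triple $(x,y,z)$ in $X$ (not necessarily distinct) is in cyclic order if there are liftings $\tilde x,\tilde y,\tilde z\in\tilde X$ (possibly $\tilde x\ne\tilde z$ when $x=z$) with $\tilde x\le\tilde y\le\tilde z\le\sigma\tilde x$. $RX$ is the $R$-category with objects $P_x$, $x\in X$, with $RX(P_x,P_y)$ free over $R$ on one generator $f_{xy}$, and $(rf_{yz})\circ(sf_{xy})=rst^{c(xyz)}f_{xz}$. $\mathcal P(X)=\mathrm{add}\,RX$ (finite direct sums of the $P_x$). An automorphism $\phi$ of $(X,c)$ is admissible if it is covered by a $\sigma$-equivariant order preserving bijection $\tilde\phi$ of $\tilde X$ with $x\le\tilde\phi x\le\tilde\phi^2x<\sigma x$ for all $x\in\tilde X$. It induces an additive $R$-linear automorphism $\phi$ of $\mathcal P(X)$ with $\phi P_x=P_{\phi x}$, $\phi f_{xy}=f_{\phi x,\phi y}$, and a natural transformation $\eta_P:P\to\phi P$ with $\eta_{P_x}=f_{x,\phi x}$. $\mathcal{MF}(X)$ is the category of pairs $(P,d)$ with $P\in\mathcal P(X)$, $d:P\to P$, $d^2=t$; morphisms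 are morphisms in $\mathcal P(X)$ commuting with $d$. $\mathcal{MF}_\phi(X)$ is the full subcategory of $(P,d)$ such that $d$ factors through $\eta_P$. It is a Frobenius category, with exact sequences those whose underlying sequence in $\mathcal P(X)$ is split exact. For $x,y\in X$ with $c(xyx)=c(yxy)=1$, $E(x,y)=\left(P_x\oplus P_y,\begin{bmatrix}0&f_{yx}\\ f_{xy}&0\end{bmatrix}\right)$; for $x\approx y$, $E(x,y)=\left(P_x\oplus P_y,\begin{bmatrix}0&tf_{yx}\\ f_{xy}&0\end{bmatrix}\right)$. (If $X$ is cyclically ordered, one of these two cases always holds.) The object $E(x,y)$ of $\mathcal{MF}(X)$ lies in $\mathcal{MF}_\phi(X)$ if and only if $(\phi x,y,\phi^{-1}x)$ is in cyclic order. *)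

theory Defs
  imports
    "Jordan_Normal_Form.Matrix"
    "Jordan_Normal_Form.VS_Connect"
    "HOL-Algebra.Ring_Divisibility"
begin

section \<open>Discrete valuation rings\<close>

text \<open>
  The coefficient ring is a type of class \<open>idom\<close>; ideals are those of HOL-Algebra, taken in
  \<open>class_ring\<close>, the record of the ring operations of the type.
\<close>

definition discrete_valuation_ring :: "'r::idom itself \<Rightarrow> bool" where
  "discrete_valuation_ring _ \<longleftrightarrow>
     principal_domain (class_ring :: 'r ring) \<and>
     (\<exists>!M. maximalideal M (class_ring :: 'r ring) \<and> M \<noteq> {0})"

definition uniformizer :: "'r::idom \<Rightarrow> bool" where
  "uniformizer t \<longleftrightarrow> maximalideal (cgenideal class_ring t) class_ring"


section \<open>Covering posets and cyclic posets\<close>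

text \<open>
  Orders here are reflexive and transitive but need not be antisymmetric.  They are predicates
  that matter only on the given carrier sets.
\<close>

definition poset_on :: "'y set \<Rightarrow> ('y \<Rightarrow> 'y \<Rightarrow> bool) \<Rightarrow> bool" where
  "poset_on A leq \<longleftrightarrow>
     (\<forall>a\<in>A. leq a a) \<and> (\<forall>a\<in>A. \<forall>b\<in>A. \<forall>d\<in>A. leq a b \<longrightarrow> leq b d \<longrightarrow> leq a d)"

definition strictly_below :: "('y \<Rightarrow> 'y \<Rightarrow> bool) \<Rightarrow> 'y \<Rightarrow> 'y \<Rightarrow> bool" where
  "strictly_below leq a b \<longleftrightarrow> leq a b \<and> \<not> (leq a b \<and> leq b a)"

definition poset_iso ::
  "'y set \<Rightarrow> ('y \<Rightarrow> 'y \<Rightarrow> bool) \<Rightarrow> 'z set \<Rightarrow> ('z \<Rightarrow> 'z \<Rightarrow> bool) \<Rightarrow> ('y \<Rightarrow> 'z) \<Rightarrow> bool" where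
  "poset_iso A leq B leq' h \<longleftrightarrow>
     bij_betw h A B \<and> (\<forall>a\<in>A. \<forall>b\<in>A. leq a b \<longleftrightarrow> leq' (h a) (h b))"

definition fibre :: "'y set \<Rightarrow> ('y \<Rightarrow> 'x) \<Rightarrow> 'x \<Rightarrow> 'y set" where
  "fibre Xt \<pi> x = {a \<in> Xt. \<pi> a = x}"

definition covering_poset ::
  "'x set \<Rightarrow> 'y set \<Rightarrow> ('y \<Rightarrow> 'y \<Rightarrow> bool) \<Rightarrow> ('y \<Rightarrow> 'x) \<Rightarrow> ('y \<Rightarrow> 'y) \<Rightarrow> bool" where
  "covering_poset X Xt leq \<pi> \<sigma> \<longleftrightarrow>
     poset_on Xt leq \<and> \<pi> ` Xt = X \<and>
     (\<forall>x\<in>X. \<exists>h. poset_iso (fibre Xt \<pi> x) leq (UNIV :: int set) (\<le>) h) \<and>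
     poset_iso Xt leq Xt leq \<sigma> \<and>
     (\<forall>a\<in>Xt. \<sigma> a \<in> fibre Xt \<pi> (\<pi> a) \<and> strictly_below leq a (\<sigma> a) \<and>
             (\<forall>b\<in>fibre Xt \<pi> (\<pi> a). strictly_below leq a b \<longrightarrow> leq (\<sigma> a) b)) \<and>
     (\<forall>a\<in>Xt. \<forall>b\<in>Xt. \<exists>m::nat. leq a ((\<sigma> ^^ m) b) \<and> leq ((\<sigma> ^^ m) b) ((\<sigma> ^^ (2 * m)) a))"

definition int_funpow :: "'y set \<Rightarrow> ('y \<Rightarrow> 'y) \<Rightarrow> int \<Rightarrow> 'y \<Rightarrow> 'y" where
  "int_funpow A f m = (if 0 \<le> m then f ^^ nat m else inv_into A f ^^ nat (- m))"

definition b_of_section ::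
  "'y set \<Rightarrow> ('y \<Rightarrow> 'y \<Rightarrow> bool) \<Rightarrow> ('y \<Rightarrow> 'y) \<Rightarrow> ('x \<Rightarrow> 'y) \<Rightarrow> 'x \<Rightarrow> 'x \<Rightarrow> int" where
  "b_of_section Xt leq \<sigma> lam x y = (LEAST m. leq (lam x) (int_funpow Xt \<sigma> m (lam y)))"

text \<open>
  The structure cocycle does not depend on the section, so it is enough to read it off from one.
\<close>

definition structure_cocycle ::
  "'x set \<Rightarrow> 'y set \<Rightarrow> ('y \<Rightarrow> 'y \<Rightarrow> bool) \<Rightarrow> ('y \<Rightarrow> 'x) \<Rightarrow> ('y \<Rightarrow> 'y) \<Rightarrow> ('x \<Rightarrow> 'x \<Rightarrow> 'x \<Rightarrow> nat) \<Rightarrow> bool"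
where
  "structure_cocycle X Xt leq \<pi> \<sigma> c \<longleftrightarrow>
     (\<exists>lam. (\<forall>x\<in>X. lam x \<in> fibre Xt \<pi> x) \<and>
       (\<forall>x\<in>X. \<forall>y\<in>X. \<forall>z\<in>X.
          int (c x y z) = b_of_section Xt leq \<sigma> lam y z - b_of_section Xt leq \<sigma> lam x z
                          + b_of_section Xt leq \<sigma> lam x y))"

definition cyclic_poset :: "'x set \<Rightarrow> ('x \<Rightarrow> 'x \<Rightarrow> 'x \<Rightarrow> nat) \<Rightarrow> bool" where
  "cyclic_poset X c \<longleftrightarrow>
     (\<forall>w\<in>X. \<forall>x\<in>X. \<forall>y\<in>X. \<forall>z\<in>X.
        int (c x y z) - int (c w y z) + int (c w x z) - int (c w x y) = 0) \<and>
     (\<forall>x\<in>X. \<forall>y\<in>X. c x x y = 0 \<and> c x y y = 0)"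

definition approx :: "('x \<Rightarrow> 'x \<Rightarrow> 'x \<Rightarrow> nat) \<Rightarrow> 'x \<Rightarrow> 'x \<Rightarrow> bool" where
  "approx c x y \<longleftrightarrow> c x y x = 0 \<and> c y x y = 0"

text \<open>
  The notions that refer to the covering poset of a cyclic poset take the covering poset as a
  parameter; it is unique up to isomorphism over \<open>X\<close>, and the lemma
  \<open>covering_poset_exists\<close> below provides one.
\<close>

definition totally_ordered_on :: "'y set \<Rightarrow> ('y \<Rightarrow> 'y \<Rightarrow> bool) \<Rightarrow> bool" where
  "totally_ordered_on A leq \<longleftrightarrow> (\<forall>a\<in>A. \<forall>b\<in>A. leq a b \<or> leq b a)"

definition cyclically_ordered ::
  "'x set \<Rightarrow> ('x \<Rightarrow> 'x \<Rightarrow> 'x \<Rightarrow> nat) \<Rightarrow>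
   'y set \<Rightarrow> ('y \<Rightarrow> 'y \<Rightarrow> bool) \<Rightarrow> ('y \<Rightarrow> 'x) \<Rightarrow> ('y \<Rightarrow> 'y) \<Rightarrow> bool" where
  "cyclically_ordered X c Xt leq \<pi> \<sigma> \<longleftrightarrow>
     cyclic_poset X c \<and> covering_poset X Xt leq \<pi> \<sigma> \<and> structure_cocycle X Xt leq \<pi> \<sigma> c \<and>
     totally_ordered_on Xt leq"

definition in_cyclic_order ::
  "'y set \<Rightarrow> ('y \<Rightarrow> 'y \<Rightarrow> bool) \<Rightarrow> ('y \<Rightarrow> 'x) \<Rightarrow> ('y \<Rightarrow> 'y) \<Rightarrow> 'x \<Rightarrow> 'x \<Rightarrow> 'x \<Rightarrow> bool" where
  "in_cyclic_order Xt leq \<pi> \<sigma> x y z \<longleftrightarrow>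
     (\<exists>xt\<in>fibre Xt \<pi> x. \<exists>yt\<in>fibre Xt \<pi> y. \<exists>zt\<in>fibre Xt \<pi> z.
        leq xt yt \<and> leq yt zt \<and> leq zt (\<sigma> xt))"

definition cyclic_automorphism :: "'x set \<Rightarrow> ('x \<Rightarrow> 'x \<Rightarrow> 'x \<Rightarrow> nat) \<Rightarrow> ('x \<Rightarrow> 'x) \<Rightarrow> bool" where
  "cyclic_automorphism X c \<phi> \<longleftrightarrow>
     bij_betw \<phi> X X \<and> (\<forall>x\<in>X. \<forall>y\<in>X. \<forall>z\<in>X. c (\<phi> x) (\<phi> y) (\<phi> z) = c x y z)"

definition admissible ::
  "'x set \<Rightarrow> ('x \<Rightarrow> 'x \<Rightarrow> 'x \<Rightarrow> nat) \<Rightarrow>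
   'y set \<Rightarrow> ('y \<Rightarrow> 'y \<Rightarrow> bool) \<Rightarrow> ('y \<Rightarrow> 'x) \<Rightarrow> ('y \<Rightarrow> 'y) \<Rightarrow> ('x \<Rightarrow> 'x) \<Rightarrow> bool" where
  "admissible X c Xt leq \<pi> \<sigma> \<phi> \<longleftrightarrow>
     cyclic_automorphism X c \<phi> \<and>
     (\<exists>\<phi>t. bij_betw \<phi>t Xt Xt \<and>
           (\<forall>a\<in>Xt. \<forall>b\<in>Xt. leq a b \<longrightarrow> leq (\<phi>t a) (\<phi>t b)) \<and>
           (\<forall>a\<in>Xt. \<phi>t (\<sigma> a) = \<sigma> (\<phi>t a)) \<and>
           (\<forall>a\<in>Xt. \<pi> (\<phi>t a) = \<phi> (\<pi> a)) \<and>
           (\<forall>a\<in>Xt. leq a (\<phi>t a) \<and> leq (\<phi>t a) (\<phi>t (\<phi>t a)) \<and>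
                   strictly_below leq (\<phi>t (\<phi>t a)) (\<sigma> a)))"

lemma covering_poset_exists:
  fixes X :: "'x set"
  assumes "cyclic_poset X c"
  shows "\<exists>(Xt :: ('x \<times> int) set) leq \<pi> \<sigma>.
           covering_poset X Xt leq \<pi> \<sigma> \<and> structure_cocycle X Xt leq \<pi> \<sigma> c"
proof (cases "X = {}")
  case True
  then have "covering_poset X ({} :: ('x \<times> int) set) (\<lambda>_ _. True) fst id"
    and "structure_cocycle X ({} :: ('x \<times> int) set) (\<lambda>_ _. True) fst id c"
    by (simp_all add: covering_poset_def structure_cocycle_def poset_on_def poset_iso_def)
  then show ?thesis by blast
next
  case False
  then obtain w where w: "w \<in> X" by blast
  define b where "b = (\<lambda>x y. int (c w x y))"
  define Xt where "Xt = X \<times> (UNIV :: int set)"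
  define leq :: "'x \<times> int \<Rightarrow> 'x \<times> int \<Rightarrow> bool" where
    "leq = (\<lambda>(x, i) (y, j). b x y \<le> j - i)"
  define \<sigma> :: "'x \<times> int \<Rightarrow> 'x \<times> int" where "\<sigma> = (\<lambda>(x, i). (x, i + 1))"
  have leq [simp]: "leq (x, i) (y, j) \<longleftrightarrow> b x y \<le> j - i" for x y i j by (simp add: leq_def)
  have \<sigma> [simp]: "\<sigma> (x, i) = (x, i + 1)" for x i by (simp add: \<sigma>_def)
  have bxx [simp]: "b x x = 0" if "x \<in> X" for x
    using assms w that by (simp add: cyclic_poset_def b_def)
  have cb: "int (c x y z) = b y z - b x z + b x y" if "x \<in> X" "y \<in> X" "z \<in> X" for x y z
    using assms w that unfolding cyclic_poset_def b_def by (smt (verit))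
  have tri: "b x z \<le> b x y + b y z" if "x \<in> X" "y \<in> X" "z \<in> X" for x y z
    using cb[OF that] by linarith
  have pow [simp]: "(\<sigma> ^^ m) (x, i) = (x, i + int m)" for m x i
    by (induction m) auto
  have bij: "bij_betw \<sigma> Xt Xt"
    by (rule bij_betw_byWitness[where f' = "\<lambda>(x, i). (x, i - 1)"]) (auto simp: Xt_def)
  have fib: "fibre Xt fst x = {x} \<times> UNIV" if "x \<in> X" for x
    using that by (auto simp: fibre_def Xt_def)
  have inv: "inv_into Xt \<sigma> (x, i) = (x, i - 1)" if "x \<in> X" for x i
    using bij that by (intro inv_into_f_eq) (auto simp: bij_betw_def Xt_def)
  have invpow: "(inv_into Xt \<sigma> ^^ m) (x, i) = (x, i - int m)" if "x \<in> X" for m x i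
    using that by (induction m) (auto simp: inv)
  have shift: "int_funpow Xt \<sigma> m (x, i) = (x, i + m)" if "x \<in> X" for m x i
    using that by (simp add: int_funpow_def invpow)
  have iso: "\<exists>h. poset_iso (fibre Xt fst x) leq (UNIV :: int set) (\<le>) h" if "x \<in> X" for x
    using that by (intro exI[of _ snd]) (auto simp: poset_iso_def fib bij_betw_def inj_on_def image_iff)
  have arch: "\<exists>m::nat. leq p ((\<sigma> ^^ m) q) \<and> leq ((\<sigma> ^^ m) q) ((\<sigma> ^^ (2 * m)) p)" for p q
  proof -
    obtain x i y j where "p = (x, i)" "q = (y, j)" by (cases p, cases q) auto
    then show ?thesis
      by (intro exI[of _ "nat (max (b x y - j + i) (b y x + j - i))"]) auto
  qed
  have cov: "covering_poset X Xt leq fst \<sigma>"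
    unfolding covering_poset_def
  proof (intro conjI ballI)
    show "poset_on Xt leq"
      unfolding poset_on_def Xt_def by (auto; smt (verit) tri)
    show "fst ` Xt = X" by (auto simp: Xt_def image_iff)
    show "poset_iso Xt leq Xt leq \<sigma>"
      using bij by (auto simp: poset_iso_def)
  qed (use iso arch in \<open>auto simp: Xt_def fibre_def strictly_below_def\<close>)
  have "b_of_section Xt leq \<sigma> (\<lambda>x. (x, 0)) x y = b x y" if "x \<in> X" "y \<in> X" for x y
    unfolding b_of_section_def using that by (auto simp: shift intro!: Least_equality)
  then have "structure_cocycle X Xt leq fst \<sigma> c"
    unfolding structure_cocycle_def
    by (intro exI[of _ "\<lambda>x. (x, 0)"]) (auto simp: fibre_def Xt_def cb)
  with cov show ?thesis by blast
qed

section \<open>The category \<open>\<P>(X)\<close>\<close>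

text \<open>
  A morphism from \<open>P\<^sub>x\<close> to \<open>P\<^sub>y\<close> in the \<open>R\<close>-category \<open>RX\<close> is a multiple of the generator
  \<open>f\<^sub>x\<^sub>y\<close> and is represented by its coefficient.  An object of \<open>\<P>(X)\<close> is the list of the indices
  of its summands \<open>P\<^sub>x\<close>; a morphism \<open>xs \<rightarrow> ys\<close> is a matrix whose \<open>(i, j)\<close> entry is a morphism from
  the \<open>j\<close>-th summand of the source to the \<open>i\<close>-th summand of the target.  As \<open>c\<close> is reduced, the
  identity of \<open>P\<^sub>x\<close> is \<open>f\<^sub>x\<^sub>x\<close>, so identities are identity matrices; composition, however, is
  not the ordinary matrix product.
\<close>

definition RX_comp :: "('x \<Rightarrow> 'x \<Rightarrow> 'x \<Rightarrow> nat) \<Rightarrow> 'r::idom \<Rightarrow> 'x \<Rightarrow> 'x \<Rightarrow> 'x \<Rightarrow> 'r \<Rightarrow> 'r \<Rightarrow> 'r" where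
  "RX_comp c t x y z r s = r * s * t ^ c x y z"

definition PX_hom :: "'x list \<Rightarrow> 'x list \<Rightarrow> 'r::idom mat set" where
  "PX_hom xs ys = carrier_mat (length ys) (length xs)"

definition PX_comp ::
  "('x \<Rightarrow> 'x \<Rightarrow> 'x \<Rightarrow> nat) \<Rightarrow> 'r::idom \<Rightarrow> 'x list \<Rightarrow> 'x list \<Rightarrow> 'x list \<Rightarrow>
   'r mat \<Rightarrow> 'r mat \<Rightarrow> 'r mat" where
  "PX_comp c t xs ys zs g f =
     mat (length zs) (length xs)
       (\<lambda>(i, k). \<Sum>j<length ys. RX_comp c t (xs ! k) (ys ! j) (zs ! i) (g $$ (i, j)) (f $$ (j, k)))"

definition PX_id :: "'x list \<Rightarrow> 'r::idom mat" where
  "PX_id xs = 1\<^sub>m (length xs)"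

definition PX_zero :: "'x list \<Rightarrow> 'x list \<Rightarrow> 'r::idom mat" where
  "PX_zero xs ys = 0\<^sub>m (length ys) (length xs)"

text \<open>
  The natural transformation \<open>\<eta>\<close> at \<open>xs\<close>, a morphism \<open>xs \<rightarrow> map \<phi> xs\<close>: it is diagonal, and its
  \<open>i\<close>-th diagonal entry is the generator from \<open>xs ! i\<close> to \<open>\<phi> (xs ! i)\<close>, with coefficient \<open>1\<close>.
\<close>

definition PX_eta :: "'x list \<Rightarrow> 'r::idom mat" where
  "PX_eta xs = 1\<^sub>m (length xs)"


section \<open>Matrix factorizations\<close>

type_synonym ('x, 'r) mf = "'x list \<times> 'r mat"

definition MF :: "'x set \<Rightarrow> ('x \<Rightarrow> 'x \<Rightarrow> 'x \<Rightarrow> nat) \<Rightarrow> 'r::idom \<Rightarrow> ('x, 'r) mf set" where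
  "MF X c t = {(xs, d). set xs \<subseteq> X \<and> d \<in> PX_hom xs xs \<and>
                        PX_comp c t xs xs xs d d = t \<cdot>\<^sub>m PX_id xs}"

definition MF_phi ::
  "'x set \<Rightarrow> ('x \<Rightarrow> 'x \<Rightarrow> 'x \<Rightarrow> nat) \<Rightarrow> 'r::idom \<Rightarrow> ('x \<Rightarrow> 'x) \<Rightarrow> ('x, 'r) mf set" where
  "MF_phi X c t \<phi> =
     {(xs, d) \<in> MF X c t.
        \<exists>g\<in>PX_hom (map \<phi> xs) xs. d = PX_comp c t xs (map \<phi> xs) xs g (PX_eta xs)}"

definition MF_hom ::
  "('x \<Rightarrow> 'x \<Rightarrow> 'x \<Rightarrow> nat) \<Rightarrow> 'r::idom \<Rightarrow> ('x, 'r) mf \<Rightarrow> ('x, 'r) mf \<Rightarrow> 'r mat set" where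
  "MF_hom c t A B =
     {f \<in> PX_hom (fst A) (fst B).
        PX_comp c t (fst A) (fst B) (fst B) (snd B) f = PX_comp c t (fst A) (fst A) (fst B) f (snd A)}"

definition MF_iso ::
  "('x \<Rightarrow> 'x \<Rightarrow> 'x \<Rightarrow> nat) \<Rightarrow> 'r::idom \<Rightarrow> ('x, 'r) mf \<Rightarrow> ('x, 'r) mf \<Rightarrow> bool" where
  "MF_iso c t A B \<longleftrightarrow>
     (\<exists>f\<in>MF_hom c t A B. \<exists>g\<in>MF_hom c t B A.
        PX_comp c t (fst A) (fst B) (fst A) g f = PX_id (fst A) \<and>
        PX_comp c t (fst B) (fst A) (fst B) f g = PX_id (fst B))"

definition MF_zero :: "('x, 'r::idom) mf" where
  "MF_zero = ([], 0\<^sub>m 0 0)"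

definition MF_sum :: "('x, 'r::idom) mf list \<Rightarrow> ('x, 'r) mf" where
  "MF_sum As = (concat (map fst As), diag_block_mat (map snd As))"

text \<open>
  The notions below are relative to a set \<open>Obj\<close> of objects of \<open>MF X c t\<close>, standing for the full
  subcategory on \<open>Obj\<close>.
\<close>

definition MF_indecomposable ::
  "('x \<Rightarrow> 'x \<Rightarrow> 'x \<Rightarrow> nat) \<Rightarrow> 'r::idom \<Rightarrow> ('x, 'r) mf set \<Rightarrow> ('x, 'r) mf \<Rightarrow> bool" where
  "MF_indecomposable c t Obj A \<longleftrightarrow>
     A \<in> Obj \<and> \<not> MF_iso c t A MF_zero \<and>
     (\<forall>B\<in>Obj. \<forall>C\<in>Obj. MF_iso c t A (MF_sum [B, C]) \<longrightarrow>
        MF_iso c t B MF_zero \<or> MF_iso c t C MF_zero)"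

definition PX_split_exact ::
  "('x \<Rightarrow> 'x \<Rightarrow> 'x \<Rightarrow> nat) \<Rightarrow> 'r::idom \<Rightarrow> 'x list \<Rightarrow> 'x list \<Rightarrow> 'x list \<Rightarrow>
   'r mat \<Rightarrow> 'r mat \<Rightarrow> bool" where
  "PX_split_exact c t xs ys zs i p \<longleftrightarrow>
     i \<in> PX_hom xs ys \<and> p \<in> PX_hom ys zs \<and> PX_comp c t xs ys zs p i = PX_zero xs zs \<and>
     (\<exists>r\<in>PX_hom ys xs. \<exists>s\<in>PX_hom zs ys.
        PX_comp c t xs ys xs r i = PX_id xs \<and>
        PX_comp c t zs ys zs p s = PX_id zs \<and>
        PX_comp c t ys xs ys i r + PX_comp c t ys zs ys s p = PX_id ys)"

definition MF_exact ::
  "('x \<Rightarrow> 'x \<Rightarrow> 'x \<Rightarrow> nat) \<Rightarrow> 'r::idom \<Rightarrow> ('x, 'r) mf set \<Rightarrow>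
   ('x, 'r) mf \<Rightarrow> ('x, 'r) mf \<Rightarrow> ('x, 'r) mf \<Rightarrow> 'r mat \<Rightarrow> 'r mat \<Rightarrow> bool" where
  "MF_exact c t Obj A B C i p \<longleftrightarrow>
     A \<in> Obj \<and> B \<in> Obj \<and> C \<in> Obj \<and> i \<in> MF_hom c t A B \<and> p \<in> MF_hom c t B C \<and>
     PX_split_exact c t (fst A) (fst B) (fst C) i p"

definition MF_projective ::
  "('x \<Rightarrow> 'x \<Rightarrow> 'x \<Rightarrow> nat) \<Rightarrow> 'r::idom \<Rightarrow> ('x, 'r) mf set \<Rightarrow> ('x, 'r) mf \<Rightarrow> bool" where
  "MF_projective c t Obj Q \<longleftrightarrow>
     Q \<in> Obj \<and>
     (\<forall>A B C i p. MF_exact c t Obj A B C i p \<longrightarrow>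
        (\<forall>h\<in>MF_hom c t Q C. \<exists>k\<in>MF_hom c t Q B. PX_comp c t (fst Q) (fst B) (fst C) p k = h))"

definition MF_injective ::
  "('x \<Rightarrow> 'x \<Rightarrow> 'x \<Rightarrow> nat) \<Rightarrow> 'r::idom \<Rightarrow> ('x, 'r) mf set \<Rightarrow> ('x, 'r) mf \<Rightarrow> bool" where
  "MF_injective c t Obj Q \<longleftrightarrow>
     Q \<in> Obj \<and>
     (\<forall>A B C i p. MF_exact c t Obj A B C i p \<longrightarrow>
        (\<forall>h\<in>MF_hom c t A Q. \<exists>k\<in>MF_hom c t B Q. PX_comp c t (fst A) (fst B) (fst Q) k i = h))"

text \<open>
  The second branch is meant for \<open>c x y x = c y x y = 1\<close>, the only other case that occurs when
  \<open>X\<close> is cyclically ordered.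
\<close>

definition E :: "('x \<Rightarrow> 'x \<Rightarrow> 'x \<Rightarrow> nat) \<Rightarrow> 'r::idom \<Rightarrow> 'x \<Rightarrow> 'x \<Rightarrow> ('x, 'r) mf" where
  "E c t x y =
     ([x, y], if approx c x y then mat_of_rows_list 2 [[0, t], [1, 0]]
              else mat_of_rows_list 2 [[0, 1], [1, 0]])"

end

(*
  Composition in P(X) becomes multiplication of matrices over R as follows. Fix w in X and put
  b(xy) = c(wxy), which lies in {0, 1} because the covering poset is totally ordered. Multiplying
  the coefficient of P_x -> P_y by t^b(xy) identifies the morphisms xs -> ys with the matrices whose
  (i, j) entry is divisible by t^b(x_j y_i), and composition with the matrix product. Similarly d
  factors through eta iff its entries are divisible by t^e(x_j x_i), where
  e(xy) = b(x, phi x) + b(phi x, y), and (phi x, y, phi^-1 x) is in cyclic order iff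
  e(xy) + e(yx) <= 1.

  Decomposition: since d^2 = t, some coefficient of d is a unit. A shortest one, from P_x to P_y say,
  divides all entries in its row and column, and this splits off a summand E(x, y). Uniqueness: the
  endomorphism ring of E(x, y) is local with residue field R/(t), so the multiplicity of an
  isomorphism class is bounded by comparing ranks modulo t. Projectivity: a morphism from or to
  E(x, phi x) is determined by one component, which can be prescribed freely, whereas the canonical
  epimorphism P + phi P -> P splits for E(x, y) only if y ~ phi x or x ~ phi y.
*)

theory Submission
  imports Defs
begin

section \<open>Discrete valuation rings and coordinates on the covering poset\<close>

text \<open>Fixing \<open>w\<close> cuts the cyclic order open: each x gets a preferred lifting, the
  least one above a fixed lifting of \<open>w\<close>. Then b(xy) = 0 if the lifting of x lies below
  that of y, and b(xy) = 1 if it lies below only the next translate. The cocycle identity at (w, x,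
  y, z) is what makes multiplication by these powers of t compatible with composition. Equivalent
  points shape the splitting argument: a shortest unit coefficient may lie on the diagonal, where it
  is no pivot, and d^2 = t must then supply an equally short one off the diagonal. The complement of
  E(x, y) is not found by splitting an idempotent abstractly: the projection is arranged to vanish
  in one row and one column, so that its image is indexed by the remaining summands. The strict
  inequality between phi^2 x and sigma x ensures that t times the inverse of eta factors through
  eta, which puts the middle term of the canonical sequence into the category. A section of the
  canonical epimorphism onto E(x, y) has two coefficients with sum 1; one of them is a unit, and
  which one it is decides between the two equivalences.\<close>

lemma dvr_local:
  fixes t :: "'r::idom"
  assumes "discrete_valuation_ring TYPE('r)" and u: "uniformizer t"
  shows "t \<noteq> 0" and "\<not> t dvd 1" and "a dvd 1 \<or> t dvd a"
proof -
  interpret principal_domain "class_ring :: 'r ring"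
    using assms(1) by (simp add: discrete_valuation_ring_def)
  have cg: "cgenideal class_ring a = {x. a dvd x}" for a :: 'r
    by (auto simp: cgenideal_def dvd_def mult.commute)
  have maxt: "maximalideal (cgenideal class_ring t) class_ring"
    using u by (simp add: uniformizer_def)
  obtain M :: "'r set" where M: "maximalideal M class_ring" "M \<noteq> {0}"
    and uniq: "\<And>M'. maximalideal M' class_ring \<Longrightarrow> M' \<noteq> {0} \<Longrightarrow> M' = M"
    using assms(1) unfolding discrete_valuation_ring_def by (auto elim!: ex1E)
  have proper: "I \<noteq> UNIV" if "maximalideal I class_ring" for I :: "'r set"
    using maximalideal.I_notcarr[OF that] by auto
  have idM: "ideal M class_ring" using M(1) by (simp add: maximalideal_def)
  \<comment> \<open>If \<open>t\<close> were 0, the zero ideal would be maximal, yet the proper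
    nonzero ideal \<open>M\<close> lies strictly above it.\<close>
  show t0: "t \<noteq> 0"
  proof
    assume "t = 0"
    then have "cgenideal class_ring t = {0}" by (auto simp: cg)
    moreover have "{0} \<subseteq> M" using additive_subgroup.zero_closed[OF ideal.axioms(1)[OF idM]] by simp
    ultimately have "M = {0} \<or> M = UNIV"
      using maximalideal.I_maximal[OF maxt idM] by auto
    then show False using M proper by auto
  qed
  have nz: "cgenideal class_ring b \<noteq> {0}" if "b \<noteq> 0" for b :: 'r
  proof -
    have "b \<in> cgenideal class_ring b" by (simp add: cg)
    then show ?thesis using that by (metis singletonD)
  qed
  show "\<not> t dvd 1"
  proof
    assume "t dvd 1"
    then have "t dvd x" for x by (rule dvd_trans) simp
    then have "cgenideal class_ring t = UNIV" by (simp add: cg)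
    then show False using proper[OF maxt] by simp
  qed
  show "a dvd 1 \<or> t dvd a"
  proof (cases "a = 0 \<or> a dvd 1")
    case False
    then have "a \<in> carrier class_ring - {\<zero>\<^bsub>class_ring\<^esub>}" by simp
    moreover have "a \<notin> Units (class_ring :: 'r ring)"
      using False by (auto simp: Units_def) (metis dvd_triv_right)
    \<comment> \<open>In a principal ideal domain an irreducible divisor \<open>p\<close> of
      \<open>a\<close> generates a nonzero maximal ideal. There is only one such ideal, so
      \<open>p\<close> and \<open>t\<close> generate the same ideal and \<open>t\<close> divides
      \<open>p\<close>, which divides \<open>a\<close>.\<close>
    ultimately obtain p where p: "p \<in> carrier class_ring" "ring_irreducible\<^bsub>class_ring\<^esub> p"
        "p divides\<^bsub>class_ring\<^esub> a"
      using exists_irreducible_divisor by blast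
    have "maximalideal (cgenideal class_ring p) class_ring"
      using irreducible_imp_maximalideal[OF p(1,2)] .
    moreover have "p \<noteq> 0"
      using ring_irreducibleE(1)[OF p(1,2)] by simp
    ultimately have "cgenideal class_ring p = cgenideal class_ring t"
      using uniq maxt nz t0 by metis
    then have "t dvd p" unfolding cg by (metis dvd_refl mem_Collect_eq)
    moreover have "p dvd a" using p(3) by (auto simp: factor_def)
    ultimately show ?thesis using dvd_trans by blast
  qed auto
qed

section \<open>Integer iterates of the translation and coordinates on the covering poset\<close>

lemma int_funpow_add:
  assumes "bij_betw f A A" and "a \<in> A"
  shows "int_funpow A f m a \<in> A"
    and "int_funpow A f (m + 1) a = f (int_funpow A f m a)"
    and "int_funpow A f (k + m) a = int_funpow A f k (int_funpow A f m a)"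
proof -
  let ?g = "inv_into A f"
  have g: "x \<in> A \<Longrightarrow> ?g x \<in> A" "x \<in> A \<Longrightarrow> f (?g x) = x" "x \<in> A \<Longrightarrow> ?g (f x) = x" "x \<in> A \<Longrightarrow> f x \<in> A" for x
    using assms(1) by (auto simp: bij_betw_def inv_into_into f_inv_into_f inv_into_f_f)
  have pA: "x \<in> A \<Longrightarrow> (f ^^ n) x \<in> A" "x \<in> A \<Longrightarrow> (?g ^^ n) x \<in> A" for x n
    by (induction n) (auto simp: g)
  have cl: "x \<in> A \<Longrightarrow> int_funpow A f m x \<in> A" for m x by (auto simp: int_funpow_def pA)
  show "int_funpow A f m a \<in> A" using cl assms by auto
  have S: "x \<in> A \<Longrightarrow> int_funpow A f (m + 1) x = f (int_funpow A f m x)" for m x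
  proof (cases "0 \<le> m")
    case True
    then have "nat (m + 1) = Suc (nat m)" by simp
    then show ?thesis using True by (simp add: int_funpow_def)
  next
    case False
    assume x: "x \<in> A"
    have "nat (- m) = Suc (nat (- (m + 1)))" using False by simp
    then show ?thesis using False x by (auto simp: int_funpow_def g pA)
  qed
  then show "int_funpow A f (m + 1) a = f (int_funpow A f m a)" using assms by blast
  let ?b = "int_funpow A f m a"
  have b: "?b \<in> A" using cl assms by auto
  show "int_funpow A f (k + m) a = int_funpow A f k ?b"
  proof (induction k rule: int_induct[where k=0])
    case base
    then show ?case by (simp add: int_funpow_def)
  next
    case (step1 i)
    then show ?case using S[OF assms(2), of "i + m"] S[OF b, of i] by (simp add: algebra_simps)
  next
    case (step2 i)
    \<comment> \<open>Going down, both sides are compared after one application of \<open>f\<close>,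
      which is injective on \<open>A\<close>.\<close>
    have "f (int_funpow A f (i - 1 + m) a) = f (int_funpow A f (i - 1) ?b)"
      using S[OF assms(2), of "i - 1 + m"] S[OF b, of "i - 1"] step2 by (simp add: algebra_simps)
    then show ?case using g(3) cl b assms(2) by metis
  qed
qed

text \<open>A least integer in the definition of \<open>b_of_section\<close> has to be shown to
  exist; shifting by the lower bound \<open>l\<close> reduces this to the naturals.\<close>

lemma ex_least_int:
  fixes P :: "int \<Rightarrow> bool"
  assumes "P k" and "\<And>i. P i \<Longrightarrow> l \<le> i"
  obtains m where "P m" and "\<And>i. P i \<Longrightarrow> m \<le> i"
proof -
  define n where "n = (LEAST n::nat. P (int n + l))"
  have "P (int (nat (k - l)) + l)" using assms by simp
  then have n: "P (int n + l)" unfolding n_def by (rule LeastI)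
  have "int n + l \<le> i" if "P i" for i
  proof -
    have "P (int (nat (i - l)) + l)" using assms(2)[OF that] that by simp
    then have "n \<le> nat (i - l)" unfolding n_def by (rule Least_le)
    then show ?thesis using assms(2)[OF that] by simp
  qed
  then show thesis using n that by blast
qed

text \<open>\<open>\<Lambda> w x 0\<close> is the least lifting of \<open>x\<close> above the chosen
  lifting of \<open>w\<close>, and \<open>\<sigma>\<close> raises the index by one. Relative to
  these liftings the least shift from \<open>x\<close> to \<open>y\<close> is
  \<open>b x y - b w y + b w x\<close>, where \<open>b\<close> belongs to the section; this is
  \<open>c w x y\<close>, so the section disappears from the description of the order.\<close>

lemma covering_poset_coordinates:
  assumes cov: "covering_poset X Xt leq \<pi> \<sigma>" and "structure_cocycle X Xt leq \<pi> \<sigma> c"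
    and "cyclic_poset X c"
  obtains \<Lambda> where "\<And>w x y i j. w \<in> X \<Longrightarrow> x \<in> X \<Longrightarrow> y \<in> X \<Longrightarrow>
        leq (\<Lambda> w x i) (\<Lambda> w y j) \<longleftrightarrow> int (c w x y) \<le> j - i"
    and "\<And>w x. w \<in> X \<Longrightarrow> x \<in> X \<Longrightarrow> fibre Xt \<pi> x = range (\<Lambda> w x)"
    and "\<And>w x i. w \<in> X \<Longrightarrow> x \<in> X \<Longrightarrow> \<sigma> (\<Lambda> w x i) = \<Lambda> w x (i + 1)"
proof -
  note C = cov[unfolded covering_poset_def]
  have refl: "a \<in> Xt \<Longrightarrow> leq a a" and trans: "a \<in> Xt \<Longrightarrow> b \<in> Xt \<Longrightarrow> d \<in> Xt \<Longrightarrow> leq a b \<Longrightarrow> leq b d \<Longrightarrow> leq a d" for a b d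
    using C unfolding poset_on_def by blast+
  have bij: "bij_betw \<sigma> Xt Xt" and iso: "a \<in> Xt \<Longrightarrow> b \<in> Xt \<Longrightarrow> leq (\<sigma> a) (\<sigma> b) \<longleftrightarrow> leq a b" for a b
    using C unfolding poset_iso_def by blast+
  have sfib: "a \<in> Xt \<Longrightarrow> \<pi> (\<sigma> a) = \<pi> a" and sbel: "a \<in> Xt \<Longrightarrow> leq a (\<sigma> a)" "a \<in> Xt \<Longrightarrow> \<not> leq (\<sigma> a) a" for a
    using C[THEN conjunct2, THEN conjunct2, THEN conjunct2, THEN conjunct2, THEN conjunct1]
    unfolding fibre_def strictly_below_def by blast+
  have sleast: "a \<in> Xt \<Longrightarrow> b \<in> fibre Xt \<pi> (\<pi> a) \<Longrightarrow> strictly_below leq a b \<Longrightarrow> leq (\<sigma> a) b" for a b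
    using C[THEN conjunct2, THEN conjunct2, THEN conjunct2, THEN conjunct2, THEN conjunct1] by blast
  define S where "S = int_funpow Xt \<sigma>"
  have S0 [simp]: "S 0 a = a" for a by (simp add: S_def int_funpow_def)
  have Sin: "a \<in> Xt \<Longrightarrow> S m a \<in> Xt" and S1: "a \<in> Xt \<Longrightarrow> S (m + 1) a = \<sigma> (S m a)"
    and Sadd: "a \<in> Xt \<Longrightarrow> S k (S m a) = S (k + m) a" for a m k
    using int_funpow_add[OF bij] unfolding S_def by auto
  have Sm1: "a \<in> Xt \<Longrightarrow> \<sigma> (S (m - 1) a) = S m a" for a m using S1[of a "m - 1"] by simp
  have Spi: "a \<in> Xt \<Longrightarrow> \<pi> (S m a) = \<pi> a" for a m
  proof (induction m rule: int_induct[where k=0])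
    case (step1 i)
    then show ?case using S1 sfib Sin by auto
  next
    case (step2 i)
    then show ?case using Sm1[of a i] sfib[OF Sin[of a "i - 1"]] by auto
  qed simp
  have Snat: "(\<sigma> ^^ n) a = S (int n) a" for n a by (simp add: S_def int_funpow_def)
  have Siso: "a \<in> Xt \<Longrightarrow> b \<in> Xt \<Longrightarrow> leq (S m a) (S m b) \<longleftrightarrow> leq a b" for a b m
  proof (induction m rule: int_induct[where k=0])
    case (step1 i)
    then show ?case using S1 iso Sin by auto
  next
    case (step2 i)
    then show ?case using Sm1[of a i] Sm1[of b i] iso[OF Sin[of a "i - 1"] Sin[of b "i - 1"]] by auto
  qed simp
  have Sup: "leq a (S m a)" if "a \<in> Xt" "0 \<le> m" for a m
    using that(2)
  proof (induction m rule: int_ge_induct)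
    case (step i)
    then show ?case using S1 sbel(1)[OF Sin] trans[OF that(1) Sin Sin] that(1) by metis
  qed (use refl that in simp)
  have Smono: "leq (S i a) (S j a)" if "a \<in> Xt" "i \<le> j" for a i j
    using Sup[of "S i a" "j - i"] Sadd[of a "j - i" i] Sin that by auto
  have Sstrict: "i \<le> j" if "a \<in> Xt" "leq (S i a) (S j a)" for a i j
  proof (rule ccontr)
    assume "\<not> i \<le> j"
    then have "leq (S (j + 1) a) (S i a)" using Smono[OF that(1)] by simp
    then have "leq (S (j + 1) a) (S j a)" using trans Sin that by blast
    then show False using S1 sbel(2) Sin that by auto
  qed
  have arch: "\<exists>m::nat. leq a (S (int m) b) \<and> leq (S (int m) b) (S (2 * int m) a)" if "a \<in> Xt" "b \<in> Xt" for a b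
  proof -
    have "\<forall>a\<in>Xt. \<forall>b\<in>Xt. \<exists>m::nat. leq a ((\<sigma> ^^ m) b) \<and> leq ((\<sigma> ^^ m) b) ((\<sigma> ^^ (2 * m)) a)"
      by (intro C[THEN conjunct2, THEN conjunct2, THEN conjunct2, THEN conjunct2, THEN conjunct2])
    then show ?thesis using that by (fastforce simp: Snat)
  qed
  obtain lam where lam: "\<And>x. x \<in> X \<Longrightarrow> lam x \<in> fibre Xt \<pi> x"
    and lc: "\<And>x y z. x \<in> X \<Longrightarrow> y \<in> X \<Longrightarrow> z \<in> X \<Longrightarrow> int (c x y z) = b_of_section Xt leq \<sigma> lam y z - b_of_section Xt leq \<sigma> lam x z
                          + b_of_section Xt leq \<sigma> lam x y"
    using assms(2) unfolding structure_cocycle_def by blast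
  define b where "b = b_of_section Xt leq \<sigma> lam"
  have lamin: "x \<in> X \<Longrightarrow> lam x \<in> Xt" "x \<in> X \<Longrightarrow> \<pi> (lam x) = x" for x using lam by (auto simp: fibre_def)
  have bb: "leq (lam x) (S k (lam y)) \<longleftrightarrow> b x y \<le> k" if "x \<in> X" "y \<in> X" for x y k
  proof -
    let ?P = "\<lambda>m. leq (lam x) (S m (lam y))"
    have lx: "lam x \<in> Xt" and ly: "lam y \<in> Xt" using lamin that by auto
    obtain k where k: "?P k" using arch[OF lx ly] by blast
    obtain l :: nat where l: "leq (lam y) (S (int l) (lam x))" using arch[OF ly lx] by blast
    \<comment> \<open>Going from \<open>x\<close> up to \<open>y\<close> and on to \<open>x\<close>
      again, the total shift \<open>i + l\<close> cannot be negative. The last axiom of a covering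
      poset, read from \<open>y\<close> to \<open>x\<close>, supplies \<open>l\<close>.\<close>
    have low: "- int l \<le> i" if "?P i" for i
    proof -
      have "leq (S i (lam y)) (S i (S (int l) (lam x)))"
        using Siso[OF ly Sin[OF lx]] l by simp
      then have "leq (S i (lam y)) (S (i + int l) (lam x))" using Sadd[OF lx] by simp
      then have "leq (S 0 (lam x)) (S (i + int l) (lam x))"
        using trans[OF lx Sin[OF ly] Sin[OF lx] that] by simp
      then show ?thesis using Sstrict[OF lx, of 0 "i + int l"] by simp
    qed
    obtain m where m: "?P m" "\<And>i. ?P i \<Longrightarrow> m \<le> i" using ex_least_int[of ?P, OF k low] by blast
    have "b x y = m"
      unfolding b_def b_of_section_def using m by (intro Least_equality) (auto simp: S_def)
    moreover have "m \<le> k \<Longrightarrow> ?P k" for k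
      using trans[OF lx Sin[OF ly] Sin[OF ly] m(1) Smono[OF ly]] .
    ultimately show ?thesis using m(2) by auto
  qed
  define \<Lambda> where "\<Lambda> w x i = S (i + b w x) (lam x)" for w x i
  show thesis
  proof (rule that[of \<Lambda>])
    fix w x i assume wx: "w \<in> X" "x \<in> X"
    show "\<sigma> (\<Lambda> w x i) = \<Lambda> w x (i + 1)"
      using S1[of "lam x" "i + b w x"] lamin wx by (simp add: \<Lambda>_def algebra_simps)
    obtain h where h: "poset_iso (fibre Xt \<pi> x) leq (UNIV :: int set) (\<le>) h"
      using C[THEN conjunct2, THEN conjunct2, THEN conjunct1] wx by blast
    have hiff: "a \<in> fibre Xt \<pi> x \<Longrightarrow> d \<in> fibre Xt \<pi> x \<Longrightarrow> leq a d \<longleftrightarrow> h a \<le> h d" for a d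
      using h by (simp add: poset_iso_def)
    have hbij: "bij_betw h (fibre Xt \<pi> x) UNIV" using h by (simp add: poset_iso_def)
    \<comment> \<open>The fibre is a copy of the integers, and \<open>\<sigma>\<close> passes to the
      next larger element, so it becomes addition of 1. Hence the translates of one lifting exhaust
      the fibre.\<close>
    have hS1: "h (\<sigma> a) = h a + 1" if a: "a \<in> fibre Xt \<pi> x" for a
    proof -
      have aX: "a \<in> Xt" "\<pi> a = x" and s: "\<sigma> a \<in> fibre Xt \<pi> x"
        using a sfib bij_betwE[OF bij] by (auto simp: fibre_def)
      have "h a < h (\<sigma> a)" using hiff[OF a s] hiff[OF s a] sbel[OF aX(1)] by auto
      moreover obtain d where d: "d \<in> fibre Xt \<pi> x" "h d = h a + 1"
        using hbij unfolding bij_betw_def by (metis UNIV_I imageE)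
      have "strictly_below leq a d"
        using hiff[OF a d(1)] hiff[OF d(1) a] d(2) by (auto simp: strictly_below_def)
      then have "leq (\<sigma> a) d" using sleast[of a d] aX d by simp
      then have "h (\<sigma> a) \<le> h a + 1" using hiff[OF s d(1)] d(2) by simp
      ultimately show ?thesis by simp
    qed
    let ?l = "lam x"
    have fS: "S i ?l \<in> fibre Xt \<pi> x" for i using Sin Spi lamin wx by (auto simp: fibre_def)
    have hS: "h (S i ?l) = h ?l + i" for i
    proof (induction i rule: int_induct[where k=0])
      case (step1 i)
      then show ?case using S1[of ?l i] hS1[OF fS] lamin wx by auto
    next
      case (step2 i)
      then show ?case using Sm1[of ?l i] hS1[OF fS[of "i - 1"]] lamin wx by auto
    qed simp
    show "fibre Xt \<pi> x = range (\<Lambda> w x)"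
    proof
      show "range (\<Lambda> w x) \<subseteq> fibre Xt \<pi> x" using fS by (auto simp: \<Lambda>_def)
      show "fibre Xt \<pi> x \<subseteq> range (\<Lambda> w x)"
      proof
        fix a assume a: "a \<in> fibre Xt \<pi> x"
        have "h (\<Lambda> w x (h a - h ?l - b w x)) = h a" using hS by (simp add: \<Lambda>_def)
        then have "\<Lambda> w x (h a - h ?l - b w x) = a"
          using hbij a fS unfolding bij_betw_def inj_on_def by (simp add: \<Lambda>_def)
        then show "a \<in> range (\<Lambda> w x)" by (metis rangeI)
      qed
    qed
  next
    fix w x y i j assume wxy: "w \<in> X" "x \<in> X" "y \<in> X"
    let ?i = "i + b w x" and ?j = "j + b w y"
    have "leq (\<Lambda> w x i) (\<Lambda> w y j) \<longleftrightarrow> leq (S ?i (lam x)) (S ?i (S (?j - ?i) (lam y)))"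
      using Sadd[of "lam y" ?i "?j - ?i"] lamin wxy by (simp add: \<Lambda>_def)
    also have "\<dots> \<longleftrightarrow> leq (lam x) (S (?j - ?i) (lam y))" using Siso[OF lamin(1)[OF wxy(2)] Sin[OF lamin(1)[OF wxy(3)]]] .
    also have "\<dots> \<longleftrightarrow> b x y \<le> ?j - ?i" using bb[OF wxy(2,3)] .
    also have "\<dots> \<longleftrightarrow> int (c w x y) \<le> j - i" using lc[of w x y] wxy by (auto simp: b_def)
    finally show "leq (\<Lambda> w x i) (\<Lambda> w y j) \<longleftrightarrow> int (c w x y) \<le> j - i" .
  qed
qed

text \<open>In coordinates the lift of \<open>\<phi>\<close> sends index \<open>i\<close> over
  \<open>x\<close> to index \<open>i + k x\<close> over \<open>\<phi> x\<close>. Totality of the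
  covering poset, admissibility and cyclic order all turn into inequalities between
  integers.\<close>

lemma cyclic_order_weights:
  assumes co: "cyclically_ordered X c Xt leq \<pi> \<sigma>"
    and ad: "admissible X c Xt leq \<pi> \<sigma> \<phi>"
    and w: "w \<in> X" and b: "b = c w"
  shows "x \<in> X \<Longrightarrow> y \<in> X \<Longrightarrow> z \<in> X \<Longrightarrow> c x y z + b x z = b x y + b y z"
    and "x \<in> X \<Longrightarrow> b x x = 0"
    and "x \<in> X \<Longrightarrow> y \<in> X \<Longrightarrow> b x y = 0 \<or> b y x = 0"
    and "x \<in> X \<Longrightarrow> y \<in> X \<Longrightarrow> b x y \<le> 1"
    and "x \<in> X \<Longrightarrow> y \<in> X \<Longrightarrow> b (\<phi> x) (\<phi> y) + b x (\<phi> x) = b x y + b y (\<phi> y)"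
    and "x \<in> X \<Longrightarrow> b x (\<phi> (\<phi> x)) = b x (\<phi> x) + b (\<phi> x) (\<phi> (\<phi> x))"
    and "x \<in> X \<Longrightarrow> y \<in> X \<Longrightarrow>
          in_cyclic_order Xt leq \<pi> \<sigma> (\<phi> x) y (inv_into X \<phi> x) \<longleftrightarrow>
          b x (\<phi> x) + b (\<phi> x) y + (b y (\<phi> y) + b (\<phi> y) x) \<le> 1"
proof -
  have cp: "cyclic_poset X c" using co by (simp add: cyclically_ordered_def)
  obtain \<Lambda>' where \<Lambda>': "\<And>w x y i j. w \<in> X \<Longrightarrow> x \<in> X \<Longrightarrow> y \<in> X \<Longrightarrow>
        leq (\<Lambda>' w x i) (\<Lambda>' w y j) \<longleftrightarrow> int (c w x y) \<le> j - i"
    "\<And>w x. w \<in> X \<Longrightarrow> x \<in> X \<Longrightarrow> fibre Xt \<pi> x = range (\<Lambda>' w x)"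
    "\<And>w x i. w \<in> X \<Longrightarrow> x \<in> X \<Longrightarrow> \<sigma> (\<Lambda>' w x i) = \<Lambda>' w x (i + 1)"
    using covering_poset_coordinates[of X Xt leq \<pi> \<sigma> c] co by (auto simp: cyclically_ordered_def)
  define \<Lambda> where "\<Lambda> = \<Lambda>' w"
  have le: "leq (\<Lambda> x i) (\<Lambda> y j) \<longleftrightarrow> int (b x y) \<le> j - i"
    and fib: "fibre Xt \<pi> x = range (\<Lambda> x)"
    and sig: "\<sigma> (\<Lambda> x i) = \<Lambda> x (i + 1)" if "x \<in> X" "y \<in> X" for x y i j
    using \<Lambda>' w that by (auto simp: \<Lambda>_def b)
  have in_Xt: "\<Lambda> x i \<in> Xt" "\<pi> (\<Lambda> x i) = x" if "x \<in> X" for x i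
    using fib[OF that that] by (auto simp: fibre_def)
  show c: "c x y z + b x z = b x y + b y z" if "x \<in> X" "y \<in> X" "z \<in> X" for x y z
  proof -
    have "int (c x y z) - int (c w y z) + int (c w x z) - int (c w x y) = 0"
      using cp that w by (simp add: cyclic_poset_def)
    then show ?thesis unfolding b by linarith
  qed
  show bxx: "b x x = 0" if "x \<in> X" for x
    using cp that w by (simp add: cyclic_poset_def b)
  have tot: "int (b x y) \<le> i \<or> int (b y x) \<le> - i" if "x \<in> X" "y \<in> X" for x y i
  proof -
    have "leq (\<Lambda> x 0) (\<Lambda> y i) \<or> leq (\<Lambda> y i) (\<Lambda> x 0)"
      using co in_Xt that by (simp add: cyclically_ordered_def totally_ordered_on_def)
    then show ?thesis using le that by auto
  qed
  show b0: "b x y = 0 \<or> b y x = 0" if "x \<in> X" "y \<in> X" for x y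
    using tot[OF that, of 0] by auto
  \<comment> \<open>At index 1 the second alternative of \<open>tot\<close> would make
    \<open>b y x\<close> negative.\<close>
  show b1: "b x y \<le> 1" if "x \<in> X" "y \<in> X" for x y
    using tot[OF that, of 1] by auto
  have aut: "bij_betw \<phi> X X" and c\<phi>: "\<And>x y z. x \<in> X \<Longrightarrow> y \<in> X \<Longrightarrow> z \<in> X \<Longrightarrow> c (\<phi> x) (\<phi> y) (\<phi> z) = c x y z"
    using ad by (simp_all add: admissible_def cyclic_automorphism_def)
  have \<phi>X: "\<phi> x \<in> X" if "x \<in> X" for x using bij_betwE[OF aut] that by auto
  obtain \<phi>t where \<phi>t: "bij_betw \<phi>t Xt Xt"
    and mono: "\<forall>a\<in>Xt. \<forall>d\<in>Xt. leq a d \<longrightarrow> leq (\<phi>t a) (\<phi>t d)"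
    and \<phi>\<sigma>: "\<forall>a\<in>Xt. \<phi>t (\<sigma> a) = \<sigma> (\<phi>t a)"
    and \<phi>\<pi>: "\<forall>a\<in>Xt. \<pi> (\<phi>t a) = \<phi> (\<pi> a)"
    and adm: "\<forall>a\<in>Xt. leq a (\<phi>t a) \<and> leq (\<phi>t a) (\<phi>t (\<phi>t a)) \<and>
                   strictly_below leq (\<phi>t (\<phi>t a)) (\<sigma> a)"
    using ad unfolding admissible_def by (elim conjE exE)
  have \<phi>tX: "\<phi>t a \<in> Xt" if "a \<in> Xt" for a using bij_betwE[OF \<phi>t] that by auto
  have \<phi>\<sigma>: "\<phi>t (\<sigma> a) = \<sigma> (\<phi>t a)" if "a \<in> Xt" for a using \<phi>\<sigma> that by auto
  have "\<exists>k. \<phi>t (\<Lambda> x 0) = \<Lambda> (\<phi> x) k" if "x \<in> X" for x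
  proof -
    have "\<phi>t (\<Lambda> x 0) \<in> fibre Xt \<pi> (\<phi> x)" using \<phi>tX \<phi>\<pi> in_Xt that by (simp add: fibre_def)
    then show ?thesis using fib[OF \<phi>X[OF that] \<phi>X[OF that]] by auto
  qed
  then obtain k where k0: "\<And>x. x \<in> X \<Longrightarrow> \<phi>t (\<Lambda> x 0) = \<Lambda> (\<phi> x) (k x)" by metis
  have k: "\<phi>t (\<Lambda> x i) = \<Lambda> (\<phi> x) (i + k x)" if x: "x \<in> X" for x i
  proof -
    have up: "\<phi>t (\<Lambda> x (i + 1)) = \<sigma> (\<phi>t (\<Lambda> x i))" for i
      using sig[OF x x, of i] \<phi>\<sigma>[OF in_Xt(1)[OF x], of i] by simp
    have sig\<phi>: "\<sigma> (\<Lambda> (\<phi> x) i) = \<Lambda> (\<phi> x) (i + 1)" for i using sig \<phi>X x by blast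
    show ?thesis
    proof (induction i rule: int_induct[where k=0])
      case (step1 i)
      then show ?case using up[of i] sig\<phi> by (simp add: algebra_simps)
    next
      case (step2 i)
      define j where "j = i - 1 + k x"
      have "\<phi>t (\<Lambda> x (i - 1)) \<in> fibre Xt \<pi> (\<phi> x)" using \<phi>tX \<phi>\<pi> in_Xt x by (simp add: fibre_def)
      then obtain l where l: "\<phi>t (\<Lambda> x (i - 1)) = \<Lambda> (\<phi> x) l"
        using fib[OF \<phi>X[OF x] \<phi>X[OF x]] by auto
      have e: "\<Lambda> (\<phi> x) (l + 1) = \<Lambda> (\<phi> x) (j + 1)"
        using up[of "i - 1"] l sig\<phi>[of l] step2 by (simp add: j_def)
      have "leq (\<Lambda> (\<phi> x) (l + 1)) (\<Lambda> (\<phi> x) (j + 1))" "leq (\<Lambda> (\<phi> x) (j + 1)) (\<Lambda> (\<phi> x) (l + 1))"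
        unfolding e using le[OF \<phi>X[OF x] \<phi>X[OF x]] bxx[OF \<phi>X[OF x]] by auto
      then have "l = j" using le[OF \<phi>X[OF x] \<phi>X[OF x]] bxx[OF \<phi>X[OF x]] by auto
      then show ?case using l by (simp add: j_def)
    qed (use k0 x in simp)
  qed
  \<comment> \<open>Admissibility bounds \<open>b x (\<phi> x)\<close> by \<open>k x\<close> and
    \<open>b (\<phi> x) (\<phi> (\<phi> x))\<close> by \<open>k (\<phi> x)\<close> from above;
    strictness against \<open>\<sigma> x\<close> bounds \<open>b x (\<phi> (\<phi> x))\<close> by
    \<open>k x + k (\<phi> x)\<close> from below. The triangle inequality for \<open>b\<close> then
    forces equality everywhere.\<close>
  have adm_k: "int (b x (\<phi> x)) = k x \<and> int (b x (\<phi> (\<phi> x))) = k x + k (\<phi> x)" if x: "x \<in> X" for x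
  proof -
    note X = x \<phi>X[OF x] \<phi>X[OF \<phi>X[OF x]]
    let ?a = "\<Lambda> x 0"
    have e: "\<phi>t ?a = \<Lambda> (\<phi> x) (k x)" "\<phi>t (\<phi>t ?a) = \<Lambda> (\<phi> (\<phi> x)) (k x + k (\<phi> x))" "\<sigma> ?a = \<Lambda> x 1"
      using k X sig by (auto simp: algebra_simps)
    have 1: "leq ?a (\<phi>t ?a)" "leq (\<phi>t ?a) (\<phi>t (\<phi>t ?a))" "\<not> leq (\<sigma> ?a) (\<phi>t (\<phi>t ?a))"
      using bspec[OF adm in_Xt(1)[OF x], of 0] by (auto simp: strictly_below_def)
    have 2: "int (b x (\<phi> x)) \<le> k x" "int (b (\<phi> x) (\<phi> (\<phi> x))) \<le> k (\<phi> x)"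
      "int (b x (\<phi> (\<phi> x))) > k x + k (\<phi> x) - 1"
      using 1 unfolding e(2) unfolding e(1,3) by (simp_all add: le X)
    show ?thesis using 2 c[OF X] by linarith
  qed
  have kb: "int (b x (\<phi> x)) = k x" if "x \<in> X" for x using adm_k that by blast
  show "b x (\<phi> (\<phi> x)) = b x (\<phi> x) + b (\<phi> x) (\<phi> (\<phi> x))" if "x \<in> X" for x
    using adm_k[OF that] kb[OF that] kb[OF \<phi>X[OF that]] by linarith
  show nat: "b (\<phi> x) (\<phi> y) + b x (\<phi> x) = b x y + b y (\<phi> y)" if x: "x \<in> X" and y: "y \<in> X" for x y
  proof -
    \<comment> \<open>Monotonicity of the lift gives one inequality for each order of
      \<open>x\<close> and \<open>y\<close>. Invariance of \<open>c x y x\<close> under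
      \<open>\<phi>\<close> says that the two inequalities add up to an equality, so each of them is
      one.\<close>
    have half: "int (b (\<phi> x) (\<phi> y)) \<le> int (b x y) + k y - k x" if x: "x \<in> X" and y: "y \<in> X" for x y
    proof -
      have "leq (\<Lambda> x 0) (\<Lambda> y (int (b x y)))" using le x y by simp
      then have "leq (\<phi>t (\<Lambda> x 0)) (\<phi>t (\<Lambda> y (int (b x y))))" using mono in_Xt x y by blast
      then show ?thesis unfolding k[OF x] k[OF y] by (simp add: le \<phi>X x y)
    qed
    have "b x y + b y x = b (\<phi> x) (\<phi> y) + b (\<phi> y) (\<phi> x)"
      using c[OF x y x] c[OF \<phi>X[OF x] \<phi>X[OF y] \<phi>X[OF x]] c\<phi>[OF x y x] bxx x \<phi>X by simp
    then show ?thesis using half[OF x y] half[OF y x] kb[OF x] kb[OF y] by linarith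
  qed
  show "in_cyclic_order Xt leq \<pi> \<sigma> (\<phi> x) y (inv_into X \<phi> x) \<longleftrightarrow>
          b x (\<phi> x) + b (\<phi> x) y + (b y (\<phi> y) + b (\<phi> y) x) \<le> 1" if x: "x \<in> X" and y: "y \<in> X" for x y
  proof -
    define z where "z = inv_into X \<phi> x"
    have z: "z \<in> X" "\<phi> z = x"
      using aut x by (auto simp: z_def bij_betw_def inv_into_into f_inv_into_f)
    have \<phi>x: "\<phi> x \<in> X" using \<phi>X x .
    have "in_cyclic_order Xt leq \<pi> \<sigma> (\<phi> x) y z \<longleftrightarrow>
      (\<exists>i j l. leq (\<Lambda> (\<phi> x) i) (\<Lambda> y j) \<and> leq (\<Lambda> y j) (\<Lambda> z l) \<and> leq (\<Lambda> z l) (\<sigma> (\<Lambda> (\<phi> x) i)))"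
      unfolding in_cyclic_order_def fib[OF \<phi>x \<phi>x] fib[OF y y] fib[OF z(1) z(1)] by blast
    also have "\<dots> \<longleftrightarrow> (\<exists>i j l. int (b (\<phi> x) y) \<le> j - i \<and> int (b y z) \<le> l - j \<and> int (b z (\<phi> x)) \<le> i + 1 - l)"
      unfolding sig[OF \<phi>x \<phi>x] le[OF \<phi>x y] le[OF y z(1)] le[OF z(1) \<phi>x] ..
    also have "\<dots> \<longleftrightarrow> b (\<phi> x) y + b y z + b z (\<phi> x) \<le> 1" (is "?l \<longleftrightarrow> ?r")
    proof
      assume ?r
      \<comment> \<open>Starting at index 0, each lifting is taken as low as possible.\<close>
      then show ?l
        by (intro exI[of _ 0] exI[of _ "int (b (\<phi> x) y)"] exI[of _ "int (b (\<phi> x) y) + int (b y z)"]) auto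
    qed auto
    \<comment> \<open>As \<open>\<phi> z = x\<close>, the weight \<open>b z (\<phi> x)\<close> is
      \<open>b z x + b x (\<phi> x)\<close>, and naturality at \<open>y\<close> and \<open>z\<close>
      turns \<open>b y z + b z x\<close> into
      \<open>b y (\<phi> y) + b (\<phi> y) x\<close>.\<close>
    also have "b (\<phi> x) y + b y z + b z (\<phi> x) = b x (\<phi> x) + b (\<phi> x) y + (b y (\<phi> y) + b (\<phi> y) x)"
      using nat[OF y z(1)] adm_k[OF z(1)] kb[OF x] kb[OF z(1)] z(2) by simp
    finally show ?thesis unfolding z_def .
  qed
qed

section \<open>Matrices with divisibility conditions\<close>

lemma mat_mult_entry:
  assumes "A \<in> carrier_mat n m" "B \<in> carrier_mat m l" "i < n" "k < l"
  shows "(A * B) $$ (i, k) = (\<Sum>j<m. A $$ (i, j) * B $$ (j, k))"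
  using assms by (simp add: scalar_prod_def lessThan_atLeast0)

text \<open>The exponent is a parameter because two are in use: \<open>b\<close> for all morphisms,
  and \<open>e\<close> for those that factor through \<open>\<eta>\<close>.\<close>

definition dhom :: "'r::idom \<Rightarrow> ('x \<Rightarrow> 'x \<Rightarrow> nat) \<Rightarrow> 'x list \<Rightarrow> 'x list \<Rightarrow> 'r mat set" where
  "dhom t f xs ys = {M \<in> carrier_mat (length ys) (length xs).
     \<forall>i<length ys. \<forall>j<length xs. t ^ f (xs ! j) (ys ! i) dvd M $$ (i, j)}"

lemma dhomI:
  assumes "M \<in> carrier_mat (length ys) (length xs)"
    and "\<And>i j. i < length ys \<Longrightarrow> j < length xs \<Longrightarrow> t ^ f (xs ! j) (ys ! i) dvd M $$ (i, j)"
  shows "M \<in> dhom t f xs ys"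
  using assms by (simp add: dhom_def)

lemma dhomD:
  assumes "M \<in> dhom t f xs ys"
  shows "M \<in> carrier_mat (length ys) (length xs)"
    and "i < length ys \<Longrightarrow> j < length xs \<Longrightarrow> t ^ f (xs ! j) (ys ! i) dvd M $$ (i, j)"
  using assms by (simp_all add: dhom_def)

text \<open>A triangle inequality between exponents is all that closure under products takes. Three
  different exponents are allowed so that products of a morphism with one that factors through
  \<open>\<eta>\<close> are covered.\<close>

lemma dhom_mult:
  assumes A: "A \<in> dhom t f ys zs" and B: "B \<in> dhom t g xs ys"
    and h: "\<And>x y z. x \<in> set xs \<Longrightarrow> y \<in> set ys \<Longrightarrow> z \<in> set zs \<Longrightarrow> h x z \<le> g x y + f y z"
  shows "A * B \<in> dhom t h xs zs"
proof (rule dhomI)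
  fix i k assume i: "i < length zs" and k: "k < length xs"
  have "t ^ h (xs ! k) (zs ! i) dvd A $$ (i, j) * B $$ (j, k)" if j: "j < length ys" for j
  proof -
    have "t ^ h (xs ! k) (zs ! i) dvd t ^ (f (ys ! j) (zs ! i) + g (xs ! k) (ys ! j))"
      using h[of "xs ! k" "ys ! j" "zs ! i"] i j k by (intro le_imp_power_dvd) simp
    also have "\<dots> dvd A $$ (i, j) * B $$ (j, k)"
      unfolding power_add using dhomD(2)[OF A i j] dhomD(2)[OF B j k] by (rule mult_dvd_mono)
    finally show ?thesis .
  qed
  then show "t ^ h (xs ! k) (zs ! i) dvd (A * B) $$ (i, k)"
    unfolding mat_mult_entry[OF dhomD(1)[OF A] dhomD(1)[OF B] i k] by (intro dvd_sum) auto
qed (use dhomD(1)[OF A] dhomD(1)[OF B] in simp)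

lemma dhom_one:
  assumes "\<And>x. x \<in> set xs \<Longrightarrow> f x x = 0"
  shows "1\<^sub>m (length xs) \<in> dhom t f xs xs"
  using assms by (auto intro!: dhomI)

lemma dhom_zero: "0\<^sub>m (length ys) (length xs) \<in> dhom t f xs ys"
  by (auto intro!: dhomI)

lemma dhom_uminus:
  assumes "A \<in> dhom t f xs ys" shows "- A \<in> dhom t f xs ys"
  using dhomD[OF assms] by (intro dhomI) auto

lemma dhom_four_block:
  assumes A: "A \<in> dhom t f xs ys" and B: "B \<in> dhom t f xs' ys"
    and C: "C \<in> dhom t f xs ys'" and D: "D \<in> dhom t f xs' ys'"
  shows "four_block_mat A B C D \<in> dhom t f (xs @ xs') (ys @ ys')"
proof (rule dhomI)
  note car = dhomD(1)[OF A] dhomD(1)[OF B] dhomD(1)[OF C] dhomD(1)[OF D]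
  show "four_block_mat A B C D \<in> carrier_mat (length (ys @ ys')) (length (xs @ xs'))"
    using four_block_carrier_mat[OF car(1,4)] by simp
  fix i j assume ij: "i < length (ys @ ys')" "j < length (xs @ xs')"
  show "t ^ f ((xs @ xs') ! j) ((ys @ ys') ! i) dvd four_block_mat A B C D $$ (i, j)"
    using ij car dhomD(2)[OF A, of i j] dhomD(2)[OF B, of i "j - length xs"]
      dhomD(2)[OF C, of "i - length ys" j] dhomD(2)[OF D, of "i - length ys" "j - length xs"]
    by (auto simp: nth_append)
qed

lemma left_inverse_commutes:
  assumes N: "N \<in> carrier_mat n n" and M: "M \<in> carrier_mat m m"
    and F: "F \<in> carrier_mat m n" and G: "G \<in> carrier_mat n m"
    and "M * F = F * N" and "G * F = 1\<^sub>m n" and "F * G = 1\<^sub>m m"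
  shows "N * G = G * (M :: 'r::comm_ring_1 mat)"
proof -
  have "N * G = (G * F) * N * G" using assms by simp
  also have "\<dots> = G * (F * N) * G"
    using N M F G by (simp add: assoc_mult_mat[of _ n m _ n _ n] )
  also have "\<dots> = G * (M * F) * G" using assms by simp
  also have "\<dots> = G * M * (F * G)"
    using N M F G
    by (simp add: assoc_mult_mat[of _ n m _ m _ n] assoc_mult_mat[of _ n m _ n _ m]
        assoc_mult_mat[of G n m M m "F * G" m])
  finally show ?thesis using assms by (simp add: right_mult_one_mat[of _ n m])
qed

section \<open>From coefficients to matrices over the ring\<close>

definition twist :: "('x \<Rightarrow> 'x \<Rightarrow> nat) \<Rightarrow> 'r::idom \<Rightarrow> 'x list \<Rightarrow> 'x list \<Rightarrow> 'r mat \<Rightarrow> 'r mat" where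
  "twist b t xs ys M = mat (length ys) (length xs) (\<lambda>(i, j). M $$ (i, j) * t ^ b (xs ! j) (ys ! i))"

lemma twist_dhom: "twist b t xs ys M \<in> dhom t b xs ys"
  by (rule dhomI) (simp_all add: twist_def)

lemma twist_carrier [simp]: "twist b t xs ys M \<in> carrier_mat (length ys) (length xs)"
  by (simp add: twist_def)

lemma twist_dims [simp]: "dim_row (twist b t xs ys M) = length ys" "dim_col (twist b t xs ys M) = length xs"
  by (simp_all add: twist_def)

lemma twist_entry [simp]:
  "i < length ys \<Longrightarrow> j < length xs \<Longrightarrow> twist b t xs ys M $$ (i, j) = M $$ (i, j) * t ^ b (xs ! j) (ys ! i)"
  by (simp add: twist_def)

lemma twist_inject:
  assumes "t \<noteq> 0" "M \<in> PX_hom xs ys" "N \<in> PX_hom xs ys"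
  shows "twist b t xs ys M = twist b t xs ys N \<longleftrightarrow> M = N"
proof
  assume eq: "twist b t xs ys M = twist b t xs ys N"
  show "M = N"
  proof (rule eq_matI)
    fix i j assume "i < dim_row N" "j < dim_col N"
    then have "i < length ys" "j < length xs" using assms(3) by (auto simp: PX_hom_def)
    then show "M $$ (i, j) = N $$ (i, j)"
      using arg_cong[OF eq, of "\<lambda>A. A $$ (i, j)"] assms(1) by simp
  qed (use assms in \<open>auto simp: PX_hom_def\<close>)
qed simp

lemma twist_surj:
  assumes "N \<in> dhom t b xs ys"
  obtains M where "M \<in> PX_hom xs ys" and "twist b t xs ys M = N"
proof -
  define M where "M = mat (length ys) (length xs)
    (\<lambda>(i, j). SOME r. N $$ (i, j) = t ^ b (xs ! j) (ys ! i) * r)"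
  have "twist b t xs ys M = N"
  proof (rule eq_matI)
    fix i j assume "i < dim_row N" "j < dim_col N"
    then have ij: "i < length ys" "j < length xs" using dhomD(1)[OF assms] by auto
    have "\<exists>r. N $$ (i, j) = t ^ b (xs ! j) (ys ! i) * r" using dhomD(2)[OF assms ij] by (elim dvdE) blast
    from someI_ex[OF this] ij show "twist b t xs ys M $$ (i, j) = N $$ (i, j)"
      by (simp add: M_def mult.commute)
  qed (use dhomD(1)[OF assms] in auto)
  then show thesis using that[of M] by (auto simp: M_def PX_hom_def)
qed

lemma twist_zero: "twist b t xs ys (PX_zero xs ys) = 0\<^sub>m (length ys) (length xs)"
  by (rule eq_matI) (auto simp: PX_zero_def)

lemma twist_add:
  assumes "M \<in> PX_hom xs ys" "N \<in> PX_hom xs ys"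
  shows "twist b t xs ys (M + N) = twist b t xs ys M + twist b t xs ys N"
  using assms by (intro eq_matI) (auto simp: PX_hom_def algebra_simps)

lemma twist_smult:
  assumes "M \<in> PX_hom xs ys"
  shows "twist b t xs ys (a \<cdot>\<^sub>m M) = a \<cdot>\<^sub>m twist b t xs ys M"
  using assms by (intro eq_matI) (auto simp: PX_hom_def)

lemma twist_id:
  assumes "\<And>x. x \<in> set xs \<Longrightarrow> b x x = 0"
  shows "twist b t xs xs (PX_id xs) = 1\<^sub>m (length xs)"
  using assms by (intro eq_matI) (auto simp: PX_id_def)

lemma PX_comp_hom: "PX_comp c t xs ys zs g f \<in> PX_hom xs zs"
  by (simp add: PX_comp_def PX_hom_def)

lemma PX_id_hom: "PX_id xs \<in> PX_hom xs xs" and PX_zero_hom: "PX_zero xs ys \<in> PX_hom xs ys"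
  by (simp_all add: PX_id_def PX_hom_def PX_zero_def)

lemma twist_comp:
  assumes c: "\<And>x y z. x \<in> set xs \<Longrightarrow> y \<in> set ys \<Longrightarrow> z \<in> set zs \<Longrightarrow> c x y z + b x z = b x y + b y z"
  shows "twist b t xs zs (PX_comp c t xs ys zs g f) = twist b t ys zs g * twist b t xs ys f"
proof (rule eq_matI)
  fix i k assume "i < dim_row (twist b t ys zs g * twist b t xs ys f)"
    "k < dim_col (twist b t ys zs g * twist b t xs ys f)"
  then have ik: "i < length zs" "k < length xs" by auto
  have "twist b t xs zs (PX_comp c t xs ys zs g f) $$ (i, k)
      = (\<Sum>j<length ys. g $$ (i, j) * f $$ (j, k) * t ^ (c (xs ! k) (ys ! j) (zs ! i) + b (xs ! k) (zs ! i)))"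
    using ik by (simp add: PX_comp_def RX_comp_def sum_distrib_right power_add mult.assoc)
  also have "\<dots> = (\<Sum>j<length ys. twist b t ys zs g $$ (i, j) * twist b t xs ys f $$ (j, k))"
  proof (intro sum.cong refl)
    fix j assume "j \<in> {..<length ys}"
    then have j: "j < length ys" by simp
    have "t ^ (c (xs ! k) (ys ! j) (zs ! i) + b (xs ! k) (zs ! i))
        = t ^ b (xs ! k) (ys ! j) * t ^ b (ys ! j) (zs ! i)"
      using c[of "xs ! k" "ys ! j" "zs ! i"] ik j by (simp add: power_add[symmetric])
    then show "g $$ (i, j) * f $$ (j, k) * t ^ (c (xs ! k) (ys ! j) (zs ! i) + b (xs ! k) (zs ! i))
        = twist b t ys zs g $$ (i, j) * twist b t xs ys f $$ (j, k)"
      using ik j by (simp add: mult_ac)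
  qed
  finally show "twist b t xs zs (PX_comp c t xs ys zs g f) $$ (i, k)
      = (twist b t ys zs g * twist b t xs ys f) $$ (i, k)"
    by (simp only: mat_mult_entry[OF twist_carrier twist_carrier ik])
qed auto

lemma mult_entry2:
  assumes "A \<in> carrier_mat n 2" "B \<in> carrier_mat 2 l" "i < n" "k < l"
  shows "(A * B) $$ (i, k) = A $$ (i, 0) * B $$ (0, k) + A $$ (i, 1) * B $$ (1, k)"
  using mat_mult_entry[OF assms] by (simp add: numeral_2_eq_2)

lemma less_2_iff: "s < (2::nat) \<longleftrightarrow> s = 0 \<or> s = 1"
  by linarith

section \<open>Determinants and inverses of square matrices, and invertibility modulo a
  nonunit\<close>

lemma dvd_prod_diff:
  fixes d :: "'r::comm_ring_1"
  assumes "finite I" "\<And>i. i \<in> I \<Longrightarrow> d dvd f i - g i"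
  shows "d dvd prod f I - prod g I"
  using assms
proof (induction I rule: finite_induct)
  case (insert i I)
  have "d dvd (f i - g i) * prod f I + g i * (prod f I - prod g I)"
    using insert by (intro dvd_add dvd_mult dvd_mult2) auto
  also have "\<dots> = prod f (insert i I) - prod g (insert i I)"
    using insert by (simp add: algebra_simps)
  finally show ?case .
qed simp

lemma dvd_det_diff:
  fixes d :: "'r::comm_ring_1"
  assumes A: "A \<in> carrier_mat n n" and B: "B \<in> carrier_mat n n"
    and AB: "\<And>i j. i < n \<Longrightarrow> j < n \<Longrightarrow> d dvd A $$ (i, j) - B $$ (i, j)"
  shows "d dvd det A - det B"
proof -
  have "det A - det B = (\<Sum>p\<in>{p. p permutes {0..<n}}.
    signof p * ((\<Prod>i = 0..<n. A $$ (i, p i)) - (\<Prod>i = 0..<n. B $$ (i, p i))))"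
    unfolding det_def'[OF A] det_def'[OF B] by (simp add: sum_subtractf right_diff_distrib)
  moreover have "d dvd (\<Prod>i = 0..<n. A $$ (i, p i)) - (\<Prod>i = 0..<n. B $$ (i, p i))"
    if "p permutes {0..<n}" for p
  proof (rule dvd_prod_diff)
    fix i assume "i \<in> {0..<n}"
    then show "d dvd A $$ (i, p i) - B $$ (i, p i)"
      using AB[of i "p i"] permutes_in_image[OF that, of i] by simp
  qed simp
  ultimately show ?thesis by (auto intro!: dvd_sum dvd_mult)
qed

text \<open>
  A matrix with fewer columns than rows has no left inverse modulo a nonunit \<open>d\<close>: padding with
  zeros makes the two factors square, and then the determinant of the product vanishes.
\<close>

lemma left_invertible_mod_imp_le:
  fixes d :: "'r::comm_ring_1"
  assumes G: "G \<in> carrier_mat n m" and F: "F \<in> carrier_mat m n" and d: "\<not> d dvd 1"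
    and GF: "\<And>i j. i < n \<Longrightarrow> j < n \<Longrightarrow> d dvd (G * F) $$ (i, j) - 1\<^sub>m n $$ (i, j)"
  shows "n \<le> m"
proof (rule ccontr)
  assume "\<not> n \<le> m"
  then have mn: "m < n" by simp
  define G' where "G' = mat n n (\<lambda>(i, j). if j < m then G $$ (i, j) else 0)"
  define F' where "F' = mat n n (\<lambda>(i, j). if i < m then F $$ (i, j) else 0)"
  have c: "G' \<in> carrier_mat n n" "F' \<in> carrier_mat n n" by (simp_all add: G'_def F'_def)
  have e: "(G' * F') $$ (i, j) = (G * F) $$ (i, j)" if "i < n" "j < n" for i j
  proof -
    have "(G' * F') $$ (i, j) = (\<Sum>k<n. G' $$ (i, k) * F' $$ (k, j))"
      using that by (simp only: mat_mult_entry[OF c])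
    also have "\<dots> = (\<Sum>k<m. G' $$ (i, k) * F' $$ (k, j))"
      using mn that by (intro sum.mono_neutral_right) (auto simp: G'_def F'_def)
    also have "\<dots> = (\<Sum>k<m. G $$ (i, k) * F $$ (k, j))"
      using mn that by (intro sum.cong) (auto simp: G'_def F'_def)
    also have "\<dots> = (G * F) $$ (i, j)" using that by (simp only: mat_mult_entry[OF G F])
    finally show ?thesis .
  qed
  have "(\<Prod>i = 0..<n. F' $$ (i, p i)) = 0" if "p permutes {0..<n}" for p
    using mn permutes_in_image[OF that, of m] by (intro prod_zero bexI[of _ m]) (auto simp: F'_def)
  then have "det F' = 0" unfolding det_def'[OF c(2)] by (intro sum.neutral) auto
  then have "det (G' * F') = 0" using det_mult[OF c] by simp
  moreover have "d dvd det (G' * F') - det (1\<^sub>m n)"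
    using c by (intro dvd_det_diff[of _ n]) (auto simp: e GF simp del: index_mult_mat(1) index_one_mat)
  ultimately show False using d by simp
qed

text \<open>The left inverse makes \<open>det F\<close> a unit with inverse \<open>det H\<close>, so
  the adjugate scaled by \<open>det H\<close> is a right inverse, and it must coincide with
  \<open>H\<close>.\<close>

lemma square_left_inverse_imp_right_inverse:
  fixes F :: "'r::comm_ring_1 mat"
  assumes F: "F \<in> carrier_mat n n" and H: "H \<in> carrier_mat n n" and HF: "H * F = 1\<^sub>m n"
  shows "F * H = 1\<^sub>m n"
proof -
  define K where "K = det H \<cdot>\<^sub>m adj_mat F"
  have K: "K \<in> carrier_mat n n" using adj_mat(1)[OF F] by (simp add: K_def)
  have "det H * det F = 1" using det_mult[OF H F] HF by simp
  then have FK: "F * K = 1\<^sub>m n"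
    using mult_smult_distrib[OF F adj_mat(1)[OF F], of "det H"] adj_mat(2)[OF F]
    by (auto simp: K_def intro!: eq_matI)
  have "H = H * (F * K)" using FK H by simp
  also have "\<dots> = K" using assoc_mult_mat[OF H F K] HF K by simp
  finally show ?thesis using FK by simp
qed

text \<open>Indices \<open>2 * j\<close> and \<open>2 * j + 1\<close> are the two summands of the
  \<open>j\<close>-th copy of some \<open>E(x, y)\<close>; the identity regroups a matrix product
  into blocks.\<close>

lemma sum_double: "(\<Sum>k<2 * m. f k) = (\<Sum>j<m. f (2 * j) + f (2 * j + 1 :: nat) :: 'a::comm_monoid_add)"
  by (induction m) (simp_all add: ac_simps)

text \<open>Empty blocks let a single matrix be multiplied with a row or a column of blocks inside
  the calculus of four-block matrices.\<close>

lemma four_block_pad: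
  assumes "A \<in> carrier_mat n m"
  shows "four_block_mat A (0\<^sub>m n 0) (0\<^sub>m 0 m) (0\<^sub>m 0 0) = A"
  using assms by (intro eq_matI) auto

lemma commute_mult:
  assumes "M1 \<in> carrier_mat n n" "M2 \<in> carrier_mat m m" "M3 \<in> carrier_mat l l"
    and F: "F \<in> carrier_mat m n" "M2 * F = F * M1" and G: "G \<in> carrier_mat l m" "M3 * G = G * M2"
  shows "M3 * (G * F) = G * F * (M1 :: 'r::comm_ring_1 mat)"
proof -
  have "M3 * (G * F) = G * M2 * F" using assms by (simp add: assoc_mult_mat[of M3 l l G m F n, symmetric])
  also have "\<dots> = G * F * M1"
    using assms by (simp add: assoc_mult_mat[of G l m M2 m F n] assoc_mult_mat[of G l m F n M1 n])
  finally show ?thesis .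
qed

section \<open>Matrix factorizations as matrices over the coefficient ring\<close>

text \<open>All that the rest of the proof retains of the orders. \<open>b_total\<close> and
  \<open>b_le_1\<close> express totality of the covering poset, \<open>b_\<phi>\<close> is
  naturality of \<open>\<eta>\<close> in terms of exponents, and \<open>b_\<phi>_\<phi>\<close> is
  what remains of admissibility. The last three assumptions are the properties of the
  uniformizer.\<close>

locale cyclic_weights =
  fixes X :: "'x set" and c :: "'x \<Rightarrow> 'x \<Rightarrow> 'x \<Rightarrow> nat" and b :: "'x \<Rightarrow> 'x \<Rightarrow> nat"
    and \<phi> :: "'x \<Rightarrow> 'x" and t :: "'r::idom"
  assumes c_b: "x \<in> X \<Longrightarrow> y \<in> X \<Longrightarrow> z \<in> X \<Longrightarrow> c x y z + b x z = b x y + b y z"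
    and b_refl: "x \<in> X \<Longrightarrow> b x x = 0"
    and b_total: "x \<in> X \<Longrightarrow> y \<in> X \<Longrightarrow> b x y = 0 \<or> b y x = 0"
    and b_le_1: "x \<in> X \<Longrightarrow> y \<in> X \<Longrightarrow> b x y \<le> 1"
    and \<phi>_closed: "x \<in> X \<Longrightarrow> \<phi> x \<in> X"
    and b_\<phi>: "x \<in> X \<Longrightarrow> y \<in> X \<Longrightarrow> b (\<phi> x) (\<phi> y) + b x (\<phi> x) = b x y + b y (\<phi> y)"
    and b_\<phi>_\<phi>: "x \<in> X \<Longrightarrow> b x (\<phi> (\<phi> x)) = b x (\<phi> x) + b (\<phi> x) (\<phi> (\<phi> x))"
    and t_nonzero: "t \<noteq> 0" and t_nonunit: "\<not> t dvd 1" and t_local: "a dvd 1 \<or> t dvd a"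
begin

abbreviation hom :: "'x list \<Rightarrow> 'x list \<Rightarrow> 'r mat set" where
  "hom \<equiv> dhom t b"

definition e :: "'x \<Rightarrow> 'x \<Rightarrow> nat" where
  "e x y = b x (\<phi> x) + b (\<phi> x) y"

lemma b_triangle: "x \<in> X \<Longrightarrow> y \<in> X \<Longrightarrow> z \<in> X \<Longrightarrow> b x z \<le> b x y + b y z"
  using c_b by (metis le_add2)

text \<open>Naturality of \<open>\<eta>\<close>, in the form \<open>b_\<phi>\<close>, moves the
  detour over \<open>\<phi>\<close> from the source of the first factor to the source of the second.
  Together with \<open>e_right\<close> this makes the morphisms that factor through
  \<open>\<eta>\<close> a two-sided ideal.\<close>

lemma e_left: "x \<in> X \<Longrightarrow> y \<in> X \<Longrightarrow> z \<in> X \<Longrightarrow> e x z \<le> b x y + e y z"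
  using b_\<phi>[of x y] b_triangle[of "\<phi> x" "\<phi> y" z] \<phi>_closed by (simp add: e_def)

lemma e_right: "x \<in> X \<Longrightarrow> y \<in> X \<Longrightarrow> z \<in> X \<Longrightarrow> e x z \<le> e x y + b y z"
  using b_triangle[of "\<phi> x" y z] \<phi>_closed by (simp add: e_def)

lemma e_eq: "x \<in> X \<Longrightarrow> y \<in> X \<Longrightarrow> e x y = c x (\<phi> x) y + b x y"
  using c_b[of x "\<phi> x" y] \<phi>_closed by (simp add: e_def)

lemma hom_mult:
  assumes "set xs \<subseteq> X" "set ys \<subseteq> X" "set zs \<subseteq> X" "A \<in> hom ys zs" "B \<in> hom xs ys"
  shows "A * B \<in> hom xs zs"
  using assms(4,5) by (rule dhom_mult) (use assms b_triangle in blast)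

lemma hom_e_mult:
  assumes "set xs \<subseteq> X" "set ys \<subseteq> X" "set zs \<subseteq> X" "A \<in> hom ys zs" "B \<in> dhom t e xs ys"
  shows "A * B \<in> dhom t e xs zs"
  using assms(4,5) by (rule dhom_mult) (use assms e_right in blast)

lemma e_hom_mult:
  assumes "set xs \<subseteq> X" "set ys \<subseteq> X" "set zs \<subseteq> X" "A \<in> dhom t e ys zs" "B \<in> hom xs ys"
  shows "A * B \<in> dhom t e xs zs"
  using assms(4,5) by (rule dhom_mult) (use assms e_left in blast)

lemma hom_one: "set xs \<subseteq> X \<Longrightarrow> 1\<^sub>m (length xs) \<in> hom xs xs"
  by (rule dhom_one) (use b_refl in auto)

lemma dhom_e_hom:
  assumes "set xs \<subseteq> X" "set ys \<subseteq> X" "A \<in> dhom t e xs ys" shows "A \<in> hom xs ys"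
proof (rule dhomI[OF dhomD(1)[OF assms(3)]])
  fix i j assume ij: "i < length ys" "j < length xs"
  have "t ^ b (xs ! j) (ys ! i) dvd t ^ e (xs ! j) (ys ! i)"
    using e_eq[of "xs ! j" "ys ! i"] subsetD[OF assms(1) nth_mem[OF ij(2)]] subsetD[OF assms(2) nth_mem[OF ij(1)]]
    by (intro le_imp_power_dvd) simp
  then show "t ^ b (xs ! j) (ys ! i) dvd A $$ (i, j)" using dhomD(2)[OF assms(3) ij] dvd_trans by blast
qed

abbreviation MFphi :: "('x, 'r) mf set" where
  "MFphi \<equiv> MF_phi X c t \<phi>"

abbreviation MFphi_indecomposable :: "('x, 'r) mf \<Rightarrow> bool" where
  "MFphi_indecomposable \<equiv> MF_indecomposable c t MFphi"

text \<open>Only indices and sizes are recorded, so that the predicate applies to an object and to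
  its twist alike.\<close>

definition mobj :: "('x, 'r) mf \<Rightarrow> bool" where
  "mobj A \<longleftrightarrow> set (fst A) \<subseteq> X \<and> snd A \<in> carrier_mat (length (fst A)) (length (fst A))"

text \<open>The matrix model of \<open>MF_phi\<close>: its elements are the twists of the objects.
  The exponent \<open>e\<close> dominates \<open>b\<close> on \<open>X\<close>, so membership also
  says that \<open>N\<close> is the twist of an endomorphism.\<close>

definition MFt :: "('x, 'r) mf set" where
  "MFt = {(xs, N). set xs \<subseteq> X \<and> N \<in> dhom t e xs xs \<and> N * N = t \<cdot>\<^sub>m 1\<^sub>m (length xs)}"

definition tw :: "('x, 'r) mf \<Rightarrow> ('x, 'r) mf" where
  "tw A = (fst A, twist b t (fst A) (fst A) (snd A))"

text \<open>One commutation relation is recorded; the one for \<open>G\<close> follows by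
  \<open>left_inverse_commutes\<close>.\<close>

definition tiso :: "('x, 'r) mf \<Rightarrow> ('x, 'r) mf \<Rightarrow> bool" where
  "tiso A B \<longleftrightarrow> (\<exists>F\<in>hom (fst A) (fst B). \<exists>G\<in>hom (fst B) (fst A).
     snd B * F = F * snd A \<and> G * F = 1\<^sub>m (length (fst A)) \<and> F * G = 1\<^sub>m (length (fst B)))"

definition msum :: "('x, 'r) mf \<Rightarrow> ('x, 'r) mf \<Rightarrow> ('x, 'r) mf" where
  "msum A B = (fst A @ fst B,
     four_block_mat (snd A) (0\<^sub>m (length (fst A)) (length (fst B)))
       (0\<^sub>m (length (fst B)) (length (fst A))) (snd B))"

lemma fst_tw [simp]: "fst (tw A) = fst A" by (simp add: tw_def)

lemma mobj_tw: "mobj A \<Longrightarrow> mobj (tw A)" by (simp add: mobj_def tw_def)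

lemma mobj_MFt: "A \<in> MFt \<Longrightarrow> mobj A"
  by (auto simp: MFt_def mobj_def dhom_def)

lemma mobj_msum: "mobj A \<Longrightarrow> mobj B \<Longrightarrow> mobj (msum A B)"
  by (auto simp: mobj_def msum_def)

lemma twist_PX_comp:
  assumes "set xs \<subseteq> X" "set ys \<subseteq> X" "set zs \<subseteq> X"
  shows "twist b t xs zs (PX_comp c t xs ys zs g f) = twist b t ys zs g * twist b t xs ys f"
  by (rule twist_comp) (use assms c_b in blast)

lemma twist_PX_id: "set xs \<subseteq> X \<Longrightarrow> twist b t xs xs (PX_id xs) = 1\<^sub>m (length xs)"
  by (rule twist_id) (use b_refl in auto)

text \<open>The matrix of \<open>\<eta>\<close> is diagonal with coefficients 1, so one term of the
  sum survives; its power of \<open>t\<close> comes from the composition law of the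
  category.\<close>

lemma PX_comp_eta:
  assumes "i < length xs" "k < length xs"
  shows "PX_comp c t xs (map \<phi> xs) xs g (PX_eta xs) $$ (i, k)
    = g $$ (i, k) * t ^ c (xs ! k) (\<phi> (xs ! k)) (xs ! i)"
proof -
  have "PX_comp c t xs (map \<phi> xs) xs g (PX_eta xs) $$ (i, k) =
    (\<Sum>j<length xs. RX_comp c t (xs ! k) (map \<phi> xs ! j) (xs ! i) (g $$ (i, j)) (PX_eta xs $$ (j, k)))"
    using assms by (simp add: PX_comp_def)
  also have "\<dots> = (\<Sum>j<length xs. if j = k then g $$ (i, k) * t ^ c (xs ! k) (\<phi> (xs ! k)) (xs ! i) else 0)"
    using assms by (intro sum.cong refl) (auto simp: RX_comp_def PX_eta_def)
  finally show ?thesis using assms by simp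
qed

text \<open>A factor \<open>g\<close> exists exactly if the coefficient from \<open>x\<close> to
  \<open>y\<close> is divisible by \<open>t ^ c x (\<phi> x) y\<close>, for every entry. Twisting
  multiplies it by \<open>t ^ b x y\<close>, and by \<open>e_eq\<close> the two exponents add up to
  \<open>e x y\<close>.\<close>

lemma MF_phi_iff:
  "A \<in> MFphi \<longleftrightarrow> mobj A \<and> tw A \<in> MFt"
proof (cases A)
  case (Pair xs d)
  have "A \<in> MFphi \<longleftrightarrow> mobj A \<and> PX_comp c t xs xs xs d d = t \<cdot>\<^sub>m PX_id xs \<and>
      (\<exists>g\<in>PX_hom (map \<phi> xs) xs. d = PX_comp c t xs (map \<phi> xs) xs g (PX_eta xs))"
    unfolding Pair by (auto simp: MF_phi_def MF_def mobj_def PX_hom_def)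
  also have "\<dots> \<longleftrightarrow> mobj A \<and> tw A \<in> MFt"
  proof (cases "mobj A")
    case True
    then have X: "set xs \<subseteq> X" and d: "d \<in> PX_hom xs xs"
      and dc: "d \<in> carrier_mat (length xs) (length xs)"
      unfolding Pair by (auto simp: mobj_def PX_hom_def)
    let ?N = "twist b t xs xs d"
    have "PX_comp c t xs xs xs d d = t \<cdot>\<^sub>m PX_id xs \<longleftrightarrow>
        twist b t xs xs (PX_comp c t xs xs xs d d) = twist b t xs xs (t \<cdot>\<^sub>m PX_id xs)"
      by (rule twist_inject[OF t_nonzero PX_comp_hom, symmetric]) (simp add: PX_hom_def PX_id_def)
    also have "\<dots> \<longleftrightarrow> ?N * ?N = t \<cdot>\<^sub>m 1\<^sub>m (length xs)"
      using X by (simp add: twist_PX_comp twist_smult[OF PX_id_hom] twist_PX_id)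
    finally have 1: "PX_comp c t xs xs xs d d = t \<cdot>\<^sub>m PX_id xs \<longleftrightarrow> ?N * ?N = t \<cdot>\<^sub>m 1\<^sub>m (length xs)" .
    have Xn: "xs ! i \<in> X" if "i < length xs" for i using X that by auto
    have 2: "(\<exists>g\<in>PX_hom (map \<phi> xs) xs. d = PX_comp c t xs (map \<phi> xs) xs g (PX_eta xs)) \<longleftrightarrow>
      ?N \<in> dhom t e xs xs" (is "?l \<longleftrightarrow> ?r")
    proof
      assume ?l
      then obtain g where g: "d = PX_comp c t xs (map \<phi> xs) xs g (PX_eta xs)" by blast
      show ?r
      proof (rule dhomI)
        fix i k assume ik: "i < length xs" "k < length xs"
        have "?N $$ (i, k) = g $$ (i, k) * t ^ e (xs ! k) (xs ! i)"
          using ik PX_comp_eta[OF ik] by (simp add: g e_eq Xn power_add mult_ac)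
        then show "t ^ e (xs ! k) (xs ! i) dvd ?N $$ (i, k)" by simp
      qed simp
    next
      assume r: ?r
      have "\<exists>h. d $$ (i, k) = h * t ^ c (xs ! k) (\<phi> (xs ! k)) (xs ! i)" if ik: "i < length xs" "k < length xs" for i k
      proof -
        have "t ^ e (xs ! k) (xs ! i) dvd ?N $$ (i, k)" using dhomD(2)[OF r ik] .
        then have "t ^ c (xs ! k) (\<phi> (xs ! k)) (xs ! i) * t ^ b (xs ! k) (xs ! i) dvd
            d $$ (i, k) * t ^ b (xs ! k) (xs ! i)"
          using ik by (simp add: e_eq Xn power_add)
        then have "t ^ c (xs ! k) (\<phi> (xs ! k)) (xs ! i) dvd d $$ (i, k)"
          using t_nonzero by simp
        then show ?thesis by (metis dvdE mult.commute)
      qed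
      then obtain h where h: "\<And>i k. i < length xs \<Longrightarrow> k < length xs \<Longrightarrow>
        d $$ (i, k) = h i k * t ^ c (xs ! k) (\<phi> (xs ! k)) (xs ! i)" by metis
      let ?g = "mat (length xs) (length xs) (\<lambda>(i, k). h i k)"
      have "d = PX_comp c t xs (map \<phi> xs) xs ?g (PX_eta xs)"
      proof (rule eq_matI)
        fix i k assume "i < dim_row (PX_comp c t xs (map \<phi> xs) xs ?g (PX_eta xs))"
          "k < dim_col (PX_comp c t xs (map \<phi> xs) xs ?g (PX_eta xs))"
        then have ik: "i < length xs" "k < length xs" by (auto simp: PX_comp_def)
        then show "d $$ (i, k) = PX_comp c t xs (map \<phi> xs) xs ?g (PX_eta xs) $$ (i, k)"
          by (simp add: PX_comp_eta h)
      qed (use dc in \<open>auto simp: PX_comp_def\<close>)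
      moreover have "?g \<in> PX_hom (map \<phi> xs) xs" by (simp add: PX_hom_def)
      ultimately show ?l by blast
    qed
    show ?thesis using True X unfolding 1 2 unfolding Pair by (auto simp: MFt_def tw_def)
  qed simp
  finally show ?thesis .
qed

text \<open>Every entry is divisible by the power of \<open>t\<close> that twisting would introduce,
  because \<open>e\<close> dominates \<open>b\<close>; dividing by it recovers the
  coefficients.\<close>

lemma MFt_untwist:
  assumes "A \<in> MFt"
  obtains B where "B \<in> MFphi" and "tw B = A"
proof -
  obtain xs N where A: "A = (xs, N)" "set xs \<subseteq> X" "N \<in> dhom t e xs xs"
    using assms by (auto simp: MFt_def)
  have "N \<in> hom xs xs" by (rule dhom_e_hom[OF A(2,2,3)])
  then obtain d where "d \<in> PX_hom xs xs" "twist b t xs xs d = N" by (rule twist_surj)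
  then show thesis using that[of "(xs, d)"] assms A by (simp add: MF_phi_iff mobj_def tw_def PX_hom_def)
qed

lemma MF_hom_iff:
  assumes "mobj A" "mobj B" "f \<in> PX_hom (fst A) (fst B)"
  shows "f \<in> MF_hom c t A B \<longleftrightarrow>
    snd (tw B) * twist b t (fst A) (fst B) f = twist b t (fst A) (fst B) f * snd (tw A)"
proof -
  have "f \<in> MF_hom c t A B \<longleftrightarrow>
    PX_comp c t (fst A) (fst B) (fst B) (snd B) f = PX_comp c t (fst A) (fst A) (fst B) f (snd A)"
    using assms(3) by (simp add: MF_hom_def)
  also have "\<dots> \<longleftrightarrow> twist b t (fst A) (fst B) (PX_comp c t (fst A) (fst B) (fst B) (snd B) f) =
     twist b t (fst A) (fst B) (PX_comp c t (fst A) (fst A) (fst B) f (snd A))"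
    by (rule twist_inject[OF t_nonzero PX_comp_hom PX_comp_hom, symmetric])
  finally show ?thesis using assms by (simp add: mobj_def twist_PX_comp tw_def)
qed

lemma PX_comp_id_iff:
  assumes "set xs \<subseteq> X" "set ys \<subseteq> X"
  shows "PX_comp c t xs ys xs g f = PX_id xs \<longleftrightarrow>
    twist b t ys xs g * twist b t xs ys f = 1\<^sub>m (length xs)"
  using assms twist_inject[OF t_nonzero PX_comp_hom[of c t xs ys xs g f] PX_id_hom, of b]
  by (simp add: twist_PX_comp twist_PX_id)

lemma MF_iso_iff:
  assumes A: "mobj A" and B: "mobj B"
  shows "MF_iso c t A B \<longleftrightarrow> tiso (tw A) (tw B)"
proof
  have X: "set (fst A) \<subseteq> X" "set (fst B) \<subseteq> X" using A B by (auto simp: mobj_def)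
  assume "MF_iso c t A B"
  then obtain f g where f: "f \<in> MF_hom c t A B" "g \<in> MF_hom c t B A"
    "PX_comp c t (fst A) (fst B) (fst A) g f = PX_id (fst A)"
    "PX_comp c t (fst B) (fst A) (fst B) f g = PX_id (fst B)" by (auto simp: MF_iso_def)
  have f': "f \<in> PX_hom (fst A) (fst B)" using f(1) by (simp add: MF_hom_def)
  let ?F = "twist b t (fst A) (fst B) f" and ?G = "twist b t (fst B) (fst A) g"
  have "snd (tw B) * ?F = ?F * snd (tw A)" "?G * ?F = 1\<^sub>m (length (fst A))" "?F * ?G = 1\<^sub>m (length (fst B))"
    using MF_hom_iff[OF A B f'] f X by (simp_all add: PX_comp_id_iff)
  then show "tiso (tw A) (tw B)"
    unfolding tiso_def fst_tw using twist_dhom by blast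
next
  have X: "set (fst A) \<subseteq> X" "set (fst B) \<subseteq> X" using A B by (auto simp: mobj_def)
  assume "tiso (tw A) (tw B)"
  then obtain F G where FG: "F \<in> hom (fst A) (fst B)" "G \<in> hom (fst B) (fst A)"
    "snd (tw B) * F = F * snd (tw A)" "G * F = 1\<^sub>m (length (fst A))" "F * G = 1\<^sub>m (length (fst B))"
    by (auto simp: tiso_def)
  obtain f where f: "f \<in> PX_hom (fst A) (fst B)" "twist b t (fst A) (fst B) f = F"
    using twist_surj[OF FG(1)] by blast
  obtain g where g: "g \<in> PX_hom (fst B) (fst A)" "twist b t (fst B) (fst A) g = G"
    using twist_surj[OF FG(2)] by blast
  have N: "snd (tw A) \<in> carrier_mat (length (fst A)) (length (fst A))"
    "snd (tw B) \<in> carrier_mat (length (fst B)) (length (fst B))"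
    by (simp_all add: tw_def)
  have "snd (tw A) * G = G * snd (tw B)"
    by (rule left_inverse_commutes[OF N dhomD(1)[OF FG(1)] dhomD(1)[OF FG(2)] FG(3-5)])
  then have "f \<in> MF_hom c t A B" "g \<in> MF_hom c t B A"
    using MF_hom_iff[OF A B f(1)] MF_hom_iff[OF B A g(1)] f g FG by simp_all
  moreover have "PX_comp c t (fst A) (fst B) (fst A) g f = PX_id (fst A)"
    "PX_comp c t (fst B) (fst A) (fst B) f g = PX_id (fst B)"
    using f g FG X by (simp_all add: PX_comp_id_iff)
  ultimately show "MF_iso c t A B"
    unfolding MF_iso_def by blast
qed

lemma tw_msum: "mobj A \<Longrightarrow> mobj B \<Longrightarrow> tw (msum A B) = msum (tw A) (tw B)"
  unfolding tw_def msum_def mobj_def fst_conv snd_conv prod.inject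
  by (intro conjI refl eq_matI) (auto simp: nth_append)

lemma MF_sum_Nil [simp]: "MF_sum [] = ([], 0\<^sub>m 0 0)"
  by (simp add: MF_sum_def)

lemma MF_sum_Cons:
  assumes "mobj A" "\<And>B. B \<in> set As \<Longrightarrow> mobj B"
  shows "MF_sum (A # As) = msum A (MF_sum As)" and "mobj (MF_sum As)"
proof -
  have dims: "snd (MF_sum As) \<in> carrier_mat (length (fst (MF_sum As))) (length (fst (MF_sum As)))"
    using assms(2) by (induction As) (auto simp: MF_sum_def mobj_def Let_def)
  then show "MF_sum (A # As) = msum A (MF_sum As)"
    using assms(1) by (auto simp: MF_sum_def msum_def mobj_def Let_def)
  show "mobj (MF_sum As)" using dims assms(2) by (auto simp: mobj_def MF_sum_def)
qed

lemma tw_MF_sum: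
  assumes "\<And>B. B \<in> set As \<Longrightarrow> mobj B"
  shows "tw (MF_sum As) = MF_sum (map tw As)"
  using assms
proof (induction As)
  case Nil
  then show ?case by (auto simp: tw_def)
next
  case (Cons A As)
  then have "mobj B" if "B \<in> set (map tw As)" for B using that mobj_tw by auto
  then show ?case using Cons mobj_tw[of A] MF_sum_Cons[of "tw A" "map tw As"] MF_sum_Cons[of A As]
    by (simp add: tw_msum)
qed

section \<open>Isomorphisms and direct sums in the matrix model\<close>

lemma tiso_refl: "mobj A \<Longrightarrow> tiso A A"
  unfolding tiso_def mobj_def
  by (intro bexI[of _ "1\<^sub>m (length (fst A))"]) (auto intro: hom_one)

lemma tiso_sym:
  assumes "mobj A" "mobj B" "tiso A B" shows "tiso B A"
proof -
  obtain F G where FG: "F \<in> hom (fst A) (fst B)" "G \<in> hom (fst B) (fst A)"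
    "snd B * F = F * snd A" "G * F = 1\<^sub>m (length (fst A))" "F * G = 1\<^sub>m (length (fst B))"
    using assms by (auto simp: tiso_def)
  have N: "snd A \<in> carrier_mat (length (fst A)) (length (fst A))"
    "snd B \<in> carrier_mat (length (fst B)) (length (fst B))"
    using assms by (simp_all add: mobj_def)
  have "snd A * G = G * snd B"
    by (rule left_inverse_commutes[OF N dhomD(1)[OF FG(1)] dhomD(1)[OF FG(2)] FG(3-5)])
  then show ?thesis using FG unfolding tiso_def by blast
qed

lemma tiso_trans:
  assumes A: "mobj A" and B: "mobj B" and C: "mobj C" and "tiso A B" "tiso B C" shows "tiso A C"
proof -
  obtain F G where FG: "F \<in> hom (fst A) (fst B)" "G \<in> hom (fst B) (fst A)"
    "snd B * F = F * snd A" "G * F = 1\<^sub>m (length (fst A))" "F * G = 1\<^sub>m (length (fst B))"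
    using assms by (auto simp: tiso_def)
  obtain F' G' where FG': "F' \<in> hom (fst B) (fst C)" "G' \<in> hom (fst C) (fst B)"
    "snd C * F' = F' * snd B" "G' * F' = 1\<^sub>m (length (fst B))" "F' * G' = 1\<^sub>m (length (fst C))"
    using assms by (auto simp: tiso_def)
  let ?a = "length (fst A)" and ?b = "length (fst B)" and ?c = "length (fst C)"
  have N: "snd A \<in> carrier_mat ?a ?a" "snd B \<in> carrier_mat ?b ?b" "snd C \<in> carrier_mat ?c ?c"
    and X: "set (fst A) \<subseteq> X" "set (fst B) \<subseteq> X" "set (fst C) \<subseteq> X"
    using A B C by (auto simp: mobj_def)
  note car = dhomD(1)[OF FG(1)] dhomD(1)[OF FG(2)] dhomD(1)[OF FG'(1)] dhomD(1)[OF FG'(2)]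
  have "snd C * (F' * F) = (snd C * F') * F" using car N by (simp add: assoc_mult_mat[of _ ?c ?c _ ?b _ ?a])
  also have "\<dots> = F' * (snd B * F)" unfolding FG'(3) using car N by (simp add: assoc_mult_mat[of _ ?c ?b _ ?b _ ?a])
  also have "\<dots> = F' * F * snd A" unfolding FG(3) using car N by (simp add: assoc_mult_mat[of _ ?c ?b _ ?a _ ?a])
  finally have 1: "snd C * (F' * F) = F' * F * snd A" .
  have "G * G' * (F' * F) = G * (G' * F' * F)"
    using car by (simp add: assoc_mult_mat[of _ ?a ?b _ ?c _ ?a] assoc_mult_mat[of _ ?b ?c _ ?b _ ?a])
  then have 2: "G * G' * (F' * F) = 1\<^sub>m ?a" unfolding FG'(4) using car FG(4) by simp
  have "F' * F * (G * G') = F' * (F * G * G')"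
    using car by (simp add: assoc_mult_mat[of _ ?c ?b _ ?a _ ?c] assoc_mult_mat[of _ ?b ?a _ ?b _ ?c])
  then have 3: "F' * F * (G * G') = 1\<^sub>m ?c" unfolding FG(5) using car FG'(5) by simp
  show ?thesis unfolding tiso_def
    using 1 2 3 hom_mult[OF X FG'(1) FG(1)] hom_mult[OF X(3,2,1) FG(2) FG'(2)] by blast
qed

lemma tiso_msum:
  assumes A: "mobj A" and B: "mobj B" and A': "mobj A'" and B': "mobj B'" and "tiso A A'" "tiso B B'"
  shows "tiso (msum A B) (msum A' B')"
proof -
  obtain F G where FG: "F \<in> hom (fst A) (fst A')" "G \<in> hom (fst A') (fst A)"
    "snd A' * F = F * snd A" "G * F = 1\<^sub>m (length (fst A))" "F * G = 1\<^sub>m (length (fst A'))"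
    using assms by (auto simp: tiso_def)
  obtain F' G' where FG': "F' \<in> hom (fst B) (fst B')" "G' \<in> hom (fst B') (fst B)"
    "snd B' * F' = F' * snd B" "G' * F' = 1\<^sub>m (length (fst B))" "F' * G' = 1\<^sub>m (length (fst B'))"
    using assms by (auto simp: tiso_def)
  let ?a = "length (fst A)" and ?b = "length (fst B)" and ?a' = "length (fst A')" and ?b' = "length (fst B')"
  have N: "snd A \<in> carrier_mat ?a ?a" "snd B \<in> carrier_mat ?b ?b" "snd A' \<in> carrier_mat ?a' ?a'" "snd B' \<in> carrier_mat ?b' ?b'"
    using A B A' B' by (auto simp: mobj_def)
  note car = dhomD(1)[OF FG(1)] dhomD(1)[OF FG(2)] dhomD(1)[OF FG'(1)] dhomD(1)[OF FG'(2)]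
  note mult = mult_four_block_mat[of _ ?a' ?a _ ?b _ ?b' _ _ ?a _ ?b]
    mult_four_block_mat[of _ ?a' ?a' _ ?b' _ ?b' _ _ ?a _ ?b]
    mult_four_block_mat[of _ ?a ?a' _ ?b' _ ?b _ _ ?a _ ?b]
    mult_four_block_mat[of _ ?a' ?a _ ?b _ ?b' _ _ ?a' _ ?b']
  let ?F = "four_block_mat F (0\<^sub>m ?a' ?b) (0\<^sub>m ?b' ?a) F'"
  let ?G = "four_block_mat G (0\<^sub>m ?a ?b') (0\<^sub>m ?b ?a') G'"
  show ?thesis
    unfolding tiso_def msum_def fst_conv snd_conv
  proof (intro bexI conjI)
    show "?F \<in> hom (fst A @ fst B) (fst A' @ fst B')" "?G \<in> hom (fst A' @ fst B') (fst A @ fst B)"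
      using FG FG' by (auto intro!: dhom_four_block dhom_zero)
    show "four_block_mat (snd A') (0\<^sub>m ?a' ?b') (0\<^sub>m ?b' ?a') (snd B') * ?F =
      ?F * four_block_mat (snd A) (0\<^sub>m ?a ?b) (0\<^sub>m ?b ?a) (snd B)"
      using car N FG(3) FG'(3) by (simp add: mult)
    show "?G * ?F = 1\<^sub>m (length (fst A @ fst B))" "?F * ?G = 1\<^sub>m (length (fst A' @ fst B'))"
      using car FG(4,5) FG'(4,5) by (simp_all add: mult)
  qed
qed

text \<open>The row of \<open>i\<close> and \<open>j\<close> and the column of \<open>p\<close> and
  \<open>q\<close> are mutually inverse. They are completed by empty blocks to take part in products
  of four-block matrices.\<close>

lemma tiso_biproduct:
  assumes A: "mobj A" and B: "mobj B" and C: "mobj C"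
    and i: "i \<in> hom (fst B) (fst A)" and j: "j \<in> hom (fst C) (fst A)"
    and p: "p \<in> hom (fst A) (fst B)" and q: "q \<in> hom (fst A) (fst C)"
    and Ni: "snd A * i = i * snd B" and Nj: "snd A * j = j * snd C"
    and pi: "p * i = 1\<^sub>m (length (fst B))" and pj: "p * j = 0\<^sub>m (length (fst B)) (length (fst C))"
    and qi: "q * i = 0\<^sub>m (length (fst C)) (length (fst B))" and qj: "q * j = 1\<^sub>m (length (fst C))"
    and sum: "i * p + j * q = 1\<^sub>m (length (fst A))"
  shows "tiso (msum B C) A"
proof -
  let ?a = "length (fst A)" and ?b = "length (fst B)" and ?c = "length (fst C)"
  have N: "snd A \<in> carrier_mat ?a ?a" "snd B \<in> carrier_mat ?b ?b" "snd C \<in> carrier_mat ?c ?c"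
    using A B C by (auto simp: mobj_def)
  note car = dhomD(1)[OF i] dhomD(1)[OF j] dhomD(1)[OF p] dhomD(1)[OF q]
  let ?F = "four_block_mat i j (0\<^sub>m 0 ?b) (0\<^sub>m 0 ?c)"
  let ?G = "four_block_mat p (0\<^sub>m ?b 0) q (0\<^sub>m ?c 0)"
  have F: "?F \<in> hom (fst B @ fst C) (fst A @ [])" and G: "?G \<in> hom (fst A @ []) (fst B @ fst C)"
    using dhom_four_block[OF i j, of "0\<^sub>m 0 ?b" "[]" "0\<^sub>m 0 ?c"]
      dhom_four_block[OF p _ q, of "0\<^sub>m ?b 0" "[]" "0\<^sub>m ?c 0"]
      dhom_zero[of "[]" "fst B" t b] dhom_zero[of "[]" "fst C" t b]
      dhom_zero[of "fst B" "[]" t b] dhom_zero[of "fst C" "[]" t b] by simp_all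
  have NA: "snd A = four_block_mat (snd A) (0\<^sub>m ?a 0) (0\<^sub>m 0 ?a) (0\<^sub>m 0 0)"
    using N by (intro eq_matI) auto
  show ?thesis
    unfolding tiso_def msum_def fst_conv snd_conv
  proof (intro bexI conjI)
    show "?F \<in> hom (fst B @ fst C) (fst A)" "?G \<in> hom (fst A) (fst B @ fst C)" using F G by simp_all
    have "snd A * ?F = four_block_mat (snd A * i) (snd A * j) (0\<^sub>m 0 ?b) (0\<^sub>m 0 ?c)"
      by (subst NA, subst mult_four_block_mat[of _ ?a ?a _ 0 _ 0 _ _ ?b _ ?c]) (use car N in auto)
    also have "\<dots> = ?F * four_block_mat (snd B) (0\<^sub>m ?b ?c) (0\<^sub>m ?c ?b) (snd C)"
      unfolding Ni Nj by (subst mult_four_block_mat[of _ ?a ?b _ ?c _ 0 _ _ ?b _ ?c]) (use car N in auto)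
    finally show "snd A * ?F = ?F * four_block_mat (snd B) (0\<^sub>m ?b ?c) (0\<^sub>m ?c ?b) (snd C)" .
    show "?G * ?F = 1\<^sub>m (length (fst B @ fst C))"
      by (subst mult_four_block_mat[of _ ?b ?a _ 0 _ ?c _ _ ?b _ ?c]) (use car pi pj qi qj in auto)
    have "?F * ?G = four_block_mat (i * p + j * q) (0\<^sub>m ?a 0) (0\<^sub>m 0 ?a) (0\<^sub>m 0 0)"
      by (subst mult_four_block_mat[of _ ?a ?b _ ?c _ 0 _ _ ?a _ 0]) (use car in auto)
    then show "?F * ?G = 1\<^sub>m (length (fst A))" unfolding sum by auto
  qed
qed

section \<open>Decomposition\<close>

text \<open>The twist of \<open>E(x, y)\<close>, with both cases in one formula. If \<open>x\<close>
  and \<open>y\<close> are not equivalent, then \<open>b y x = 1 - b x y\<close>; if they are, both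
  weights vanish and the factor \<open>t\<close> in front of the generator from \<open>y\<close> to
  \<open>x\<close> gives the exponent 1.\<close>

definition tE :: "'x \<Rightarrow> 'x \<Rightarrow> ('x, 'r) mf" where
  "tE x y = ([x, y], mat 2 2 (\<lambda>(i, j).
     if i = 0 \<and> j = 1 then t ^ (1 - b x y) else if i = 1 \<and> j = 0 then t ^ b x y else 0))"

lemma fst_tE [simp]: "fst (tE x y) = [x, y]" by (simp add: tE_def)

lemma snd_tE_carrier [simp]: "snd (tE x y) \<in> carrier_mat 2 2" by (simp add: tE_def)

lemma snd_tE_entries [simp]:
  "snd (tE x y) $$ (0, 0) = 0" "snd (tE x y) $$ (Suc 0, Suc 0) = 0"
  "snd (tE x y) $$ (0, Suc 0) = t ^ (1 - b x y)" "snd (tE x y) $$ (Suc 0, 0) = t ^ b x y"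
  by (simp_all add: tE_def)

lemma approx_iff: "x \<in> X \<Longrightarrow> y \<in> X \<Longrightarrow> approx c x y \<longleftrightarrow> b x y = 0 \<and> b y x = 0"
  using c_b[of x y x] c_b[of y x y] b_refl by (auto simp: approx_def)

lemma mobj_E: "x \<in> X \<Longrightarrow> y \<in> X \<Longrightarrow> mobj (E c t x y)"
  by (auto simp: mobj_def E_def mat_of_rows_list_def)

lemma mobj_tE: "x \<in> X \<Longrightarrow> y \<in> X \<Longrightarrow> mobj (tE x y)"
  using snd_tE_carrier by (simp add: mobj_def numeral_2_eq_2)

lemma tw_E:
  assumes "x \<in> X" "y \<in> X"
  shows "tw (E c t x y) = tE x y"
proof -
  have "twist b t [x, y] [x, y] (snd (E c t x y)) = snd (tE x y)"
  proof (rule eq_matI)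
    fix i j assume "i < dim_row (snd (tE x y))" "j < dim_col (snd (tE x y))"
    then have ij: "i < 2" "j < 2" by (auto simp: tE_def)
    show "twist b t [x, y] [x, y] (snd (E c t x y)) $$ (i, j) = snd (tE x y) $$ (i, j)"
    proof -
      have 0: "b x x = 0" "b y y = 0" using b_refl assms by auto
      have *: "approx c x y \<longleftrightarrow> b x y = 0 \<and> b y x = 0" using approx_iff assms by blast
      have "b x y = 0 \<and> b y x = 0 \<or> b x y = 0 \<and> b y x = 1 \<or> b x y = 1 \<and> b y x = 0"
        using b_total[OF assms] b_le_1[OF assms] b_le_1[OF assms(2,1)] by linarith
      moreover have "i = 0 \<and> j = 0 \<or> i = 0 \<and> j = 1 \<or> i = 1 \<and> j = 0 \<or> i = 1 \<and> j = 1"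
        using ij by linarith
      ultimately show ?thesis
        by (elim disjE conjE) (simp_all add: 0 * E_def tE_def twist_def mat_of_rows_list_def)
    qed
  qed (auto simp: tE_def)
  then show ?thesis by (simp add: tw_def tE_def E_def)
qed

lemma tE_square:
  assumes "x \<in> X" "y \<in> X"
  shows "snd (tE x y) * snd (tE x y) = t \<cdot>\<^sub>m 1\<^sub>m 2"
proof (rule eq_matI)
  have t: "t ^ (1 - b x y) * t ^ b x y = t" "t ^ b x y * t ^ (1 - b x y) = t"
    using b_le_1[OF assms] by (simp_all add: power_add[symmetric])
  fix i j assume "i < dim_row (t \<cdot>\<^sub>m 1\<^sub>m 2)" "j < dim_col (t \<cdot>\<^sub>m 1\<^sub>m 2)"
  then have ij: "i < 2" "j < 2" by simp_all
  show "(snd (tE x y) * snd (tE x y)) $$ (i, j) = (t \<cdot>\<^sub>m 1\<^sub>m 2) $$ (i, j)"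
    unfolding mult_entry2[OF snd_tE_carrier snd_tE_carrier ij]
    using ij[unfolded less_2_iff] using t by auto
qed (use carrier_matD[OF snd_tE_carrier] in auto)

text \<open>
  The pivot is a unit coefficient \<open>r\<^sub>i\<^sub>j\<close> of \<open>d\<close> for which the step from a lifting of \<open>x\<^sub>j\<close> to the
  corresponding lifting of \<open>x\<^sub>i\<close> in the covering poset is shortest; \<open>h\<close> records the position of
  the liftings between two consecutive translates.
\<close>

lemma pivot:
  assumes X: "set xs \<subseteq> X" and N: "N \<in> hom xs xs" and NN: "N * N = t \<cdot>\<^sub>m 1\<^sub>m (length xs)"
    and ne: "xs \<noteq> []"
  obtains i j u where "i < length xs" "j < length xs" "i \<noteq> j" "u dvd 1"
    "N $$ (i, j) = t ^ b (xs ! j) (xs ! i) * u"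
    "\<And>k. k < length xs \<Longrightarrow> t ^ (b (xs ! j) (xs ! i) + b (xs ! i) (xs ! k)) dvd N $$ (k, j)"
    "\<And>k. k < length xs \<Longrightarrow> t ^ (b (xs ! k) (xs ! j) + b (xs ! j) (xs ! i)) dvd N $$ (i, k)"
proof -
  define n where "n = length xs"
  have car: "N \<in> carrier_mat n n" using dhomD(1)[OF N] by (simp add: n_def)
  have xX: "xs ! k \<in> X" if "k < n" for k using X that by (auto simp: n_def)
  have "\<exists>r. N $$ (i, j) = t ^ b (xs ! j) (xs ! i) * r" if "i < n" "j < n" for i j
    using dhomD(2)[OF N, of i j] that by (auto simp: n_def)
  then obtain r where r: "\<And>i j. i < n \<Longrightarrow> j < n \<Longrightarrow> N $$ (i, j) = t ^ b (xs ! j) (xs ! i) * r i j"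
    by metis
  have sq: "(\<Sum>k<n. N $$ (i, k) * N $$ (k, i)) = t" if "i < n" for i
    using mat_mult_entry[OF car car that that] NN that by (simp add: n_def)
  define U where "U p \<longleftrightarrow> fst p < n \<and> snd p < n \<and> r (fst p) (snd p) dvd 1" for p
  \<comment> \<open>If \<open>t\<close> divided all coefficients, \<open>t * t\<close> would divide
    every product that contributes to the entry \<open>t\<close> of \<open>N * N\<close> at position
    \<open>(0, 0)\<close>.\<close>
  have "\<exists>p. U p"
  proof (rule ccontr)
    assume no: "\<nexists>p. U p"
    have n0: "0 < n" using ne by (simp add: n_def)
    have "t * t dvd N $$ (0, k) * N $$ (k, 0)" if "k < n" for k
    proof -
      have "t dvd r 0 k" "t dvd r k 0"
        using no n0 that t_local[of "r 0 k"] t_local[of "r k 0"] by (auto simp: U_def)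
      then show ?thesis using r n0 that by (intro mult_dvd_mono) auto
    qed
    then have "t * t dvd t" using sq[OF n0] dvd_sum[of "{..<n}" "t * t" "\<lambda>k. N $$ (0, k) * N $$ (k, 0)"] by auto
    then show False using t_nonzero t_nonunit by (metis dvd_mult_cancel_left mult.right_neutral)
  qed
  then obtain p0 where "U p0" by blast
  define h where "h i = card {k. k < n \<and> b (xs ! i) (xs ! k) = 1}" for i
  have h_le: "h i \<le> n" for i
    using card_mono[of "{..<n}" "{k. k < n \<and> b (xs ! i) (xs ! k) = 1}"] by (auto simp: h_def)
  \<comment> \<open>The listed points \<open>k\<close> with \<open>b (xs ! i) (xs ! k) = 1\<close>
    are those strictly below \<open>xs ! i\<close> after cutting at \<open>w\<close>. Counting them
    turns the preorder into a comparison of numbers, with equal ranks for equivalent points.\<close>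
  have h_iff: "b (xs ! i) (xs ! j) = 0 \<longleftrightarrow> h i \<le> h j" if i: "i < n" and j: "j < n" for i j
  proof
    assume 0: "b (xs ! i) (xs ! j) = 0"
    have "b (xs ! j) (xs ! k) = 1" if "k < n" "b (xs ! i) (xs ! k) = 1" for k
      using b_triangle[OF xX[OF i] xX[OF j] xX[OF that(1)]] b_le_1[OF xX[OF j] xX[OF that(1)]] that(2) 0
      by linarith
    then show "h i \<le> h j" unfolding h_def by (intro card_mono) auto
  next
    assume le: "h i \<le> h j"
    show "b (xs ! i) (xs ! j) = 0"
    proof (rule ccontr)
      assume "b (xs ! i) (xs ! j) \<noteq> 0"
      then have 1: "b (xs ! i) (xs ! j) = 1" "b (xs ! j) (xs ! i) = 0"
        using b_total[of "xs ! i" "xs ! j"] b_le_1[of "xs ! i" "xs ! j"] xX i j by auto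
      have "b (xs ! i) (xs ! k) = 1" if "k < n" "b (xs ! j) (xs ! k) = 1" for k
        using b_triangle[OF xX[OF j] xX[OF i] xX[OF that(1)]] b_le_1[OF xX[OF i] xX[OF that(1)]] that(2) 1
        by linarith
      then have "{k. k < n \<and> b (xs ! j) (xs ! k) = 1} \<subseteq> {k. k < n \<and> b (xs ! i) (xs ! k) = 1}"
        by blast
      moreover have "j \<in> {k. k < n \<and> b (xs ! i) (xs ! k) = 1}" using j 1(1) by blast
      moreover have "j \<notin> {k. k < n \<and> b (xs ! j) (xs ! k) = 1}" using b_refl[OF xX[OF j]] by simp
      ultimately have "{k. k < n \<and> b (xs ! j) (xs ! k) = 1} \<subset> {k. k < n \<and> b (xs ! i) (xs ! k) = 1}"
        by blast
      then have "h j < h i" unfolding h_def by (intro psubset_card_mono) auto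
      then show False using le by simp
    qed
  qed
  \<comment> \<open>The length of the step from source \<open>snd p\<close> to target
    \<open>fst p\<close>: the difference of ranks, plus \<open>n + 1\<close> if the step passes
    \<open>w\<close>, all shifted by \<open>n\<close> to remain in the naturals. Ranks are at most
    \<open>n\<close>, so \<open>n + 1\<close> exceeds any difference of two ranks.\<close>
  define L where "L p = (n + 1) * b (xs ! snd p) (xs ! fst p) + h (fst p) + (n - h (snd p))" for p
  obtain p where p: "U p" "\<And>q. U q \<Longrightarrow> L p \<le> L q"
    using ex_has_least_nat[of U p0 L] \<open>U p0\<close> by blast
  have "\<exists>i j. U (i, j) \<and> i \<noteq> j \<and> (\<forall>q. U q \<longrightarrow> L (i, j) \<le> L q)"
  proof (cases "fst p = snd p")
    case False
    then show ?thesis using p by (metis prod.collapse)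
  next
    case True
    define i where "i = fst p"
    have i: "p = (i, i)" "i < n" "r i i dvd 1" using p(1) True by (auto simp: i_def U_def prod_eq_iff)
    \<comment> \<open>A unit on the diagonal is no pivot. Its square is a unit whereas the diagonal
      entry of \<open>N * N\<close> is \<open>t\<close>, so some other product
      \<open>N $$ (i, k) * N $$ (k, i)\<close> is not divisible by \<open>t\<close>. Then both
      weights vanish, the points at \<open>i\<close> and \<open>k\<close> are equivalent, and
      \<open>(i, k)\<close> is an equally short unit position.\<close>
    have "\<exists>k<n. k \<noteq> i \<and> \<not> t dvd N $$ (i, k) * N $$ (k, i)"
    proof (rule ccontr)
      assume "\<not> ?thesis"
      then have "t dvd (\<Sum>k\<in>{..<n} - {i}. N $$ (i, k) * N $$ (k, i))"
        by (intro dvd_sum) auto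
      moreover have "t = N $$ (i, i) * N $$ (i, i) + (\<Sum>k\<in>{..<n} - {i}. N $$ (i, k) * N $$ (k, i))"
        unfolding sq[OF i(2), symmetric] using i(2) by (simp add: sum.remove)
      ultimately have "t dvd N $$ (i, i) * N $$ (i, i)" by (metis dvd_add_left_iff dvd_refl)
      moreover have "N $$ (i, i) = r i i" using r[OF i(2,2)] b_refl[OF xX[OF i(2)]] by simp
      moreover have "r i i * r i i dvd 1" using mult_dvd_mono[OF i(3) i(3)] by simp
      ultimately show False using t_nonunit dvd_trans by metis
    qed
    then obtain k where k: "k < n" "k \<noteq> i" "\<not> t dvd N $$ (i, k) * N $$ (k, i)" by blast
    have "\<not> t dvd N $$ (i, k)" "\<not> t dvd N $$ (k, i)" using k(3) by auto
    then have *: "\<not> t dvd t ^ b (xs ! k) (xs ! i) * r i k" "\<not> t dvd t ^ b (xs ! i) (xs ! k) * r k i"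
      unfolding r[OF i(2) k(1)] r[OF k(1) i(2)] .
    have "b (xs ! k) (xs ! i) = 0"
      using *(1) dvd_mult2[OF dvd_power[of "b (xs ! k) (xs ! i)" t], of "r i k"] by (metis neq0_conv)
    moreover have "b (xs ! i) (xs ! k) = 0"
      using *(2) dvd_mult2[OF dvd_power[of "b (xs ! i) (xs ! k)" t], of "r k i"] by (metis neq0_conv)
    moreover have "\<not> t dvd r i k" using *(1) by (meson dvd_mult)
    ultimately have "U (i, k)" "L (i, k) = L p"
      using t_local[of "r i k"] i k h_iff[OF i(2) k(1)] h_iff[OF k(1) i(2)] b_refl[OF xX[OF i(2)]] h_le[of k]
      by (auto simp: U_def L_def)
    then show ?thesis using k p by metis
  qed
  then obtain i j where ij: "U (i, j)" "i \<noteq> j" "\<And>q. U q \<Longrightarrow> L (i, j) \<le> L q" by blast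
  have i: "i < n" and j: "j < n" and u: "r i j dvd 1" using ij(1) by (auto simp: U_def)
  \<comment> \<open>In terms of the cocycle this is \<open>c x z y \<le> 1\<close>: a detour costs
    at most one additional turn.\<close>
  have short: "b x z + b z y \<le> b x y + 1" if "x \<in> X" "y \<in> X" "z \<in> X" for x y z
    using b_le_1[of x z] b_le_1[of z y] b_total[of z y] b_triangle[of x y z] that by auto
  \<comment> \<open>A nonunit coefficient contributes an additional factor \<open>t\<close>, which
    pays for the detour over \<open>xs ! i\<close> by \<open>short\<close>. A unit coefficient
    belongs to a step no shorter than the pivot, and then the detour is free. The argument for rows
    is dual.\<close>
  have col: "t ^ (b (xs ! j) (xs ! i) + b (xs ! i) (xs ! k)) dvd N $$ (k, j)" if k: "k < n" for k
  proof (cases "r k j dvd 1")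
    case False
    then have "t * t ^ b (xs ! j) (xs ! k) dvd N $$ (k, j)"
      using t_local[of "r k j"] r[OF k j] by (simp add: mult_dvd_mono mult.commute)
    moreover have "t ^ (b (xs ! j) (xs ! i) + b (xs ! i) (xs ! k)) dvd t ^ (b (xs ! j) (xs ! k) + 1)"
      using short[of "xs ! j" "xs ! k" "xs ! i"] xX i j k by (intro le_imp_power_dvd) auto
    ultimately show ?thesis using dvd_trans by fastforce
  next
    case True
    then have "L (i, j) \<le> L (k, j)" using ij(3)[of "(k, j)"] k j by (simp add: U_def)
    then have "(n + 1) * b (xs ! j) (xs ! i) + h i \<le> (n + 1) * b (xs ! j) (xs ! k) + h k"
      by (simp add: L_def)
    then have "b (xs ! j) (xs ! i) + b (xs ! i) (xs ! k) \<le> b (xs ! j) (xs ! k)"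
      using h_iff[OF i k] h_le[of k] h_le[of i] b_le_1[of "xs ! j" "xs ! i"] b_le_1[of "xs ! j" "xs ! k"]
        b_le_1[of "xs ! i" "xs ! k"] xX i j k by (auto simp: le_Suc_eq)
    then have "t ^ (b (xs ! j) (xs ! i) + b (xs ! i) (xs ! k)) dvd t ^ b (xs ! j) (xs ! k)"
      by (rule le_imp_power_dvd)
    then show ?thesis unfolding r[OF k j] by (rule dvd_mult2)
  qed
  have row: "t ^ (b (xs ! k) (xs ! j) + b (xs ! j) (xs ! i)) dvd N $$ (i, k)" if k: "k < n" for k
  proof (cases "r i k dvd 1")
    case False
    then have "t * t ^ b (xs ! k) (xs ! i) dvd N $$ (i, k)"
      using t_local[of "r i k"] r[OF i k] by (simp add: mult_dvd_mono mult.commute)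
    moreover have "t ^ (b (xs ! k) (xs ! j) + b (xs ! j) (xs ! i)) dvd t ^ (b (xs ! k) (xs ! i) + 1)"
      using short[of "xs ! k" "xs ! i" "xs ! j"] xX i j k by (intro le_imp_power_dvd) auto
    ultimately show ?thesis using dvd_trans by fastforce
  next
    case True
    then have "L (i, j) \<le> L (i, k)" using ij(3)[of "(i, k)"] k i by (simp add: U_def)
    then have "(n + 1) * b (xs ! j) (xs ! i) + h k \<le> (n + 1) * b (xs ! k) (xs ! i) + h j"
      using h_le[of k] h_le[of j] by (simp add: L_def)
    then have "b (xs ! k) (xs ! j) + b (xs ! j) (xs ! i) \<le> b (xs ! k) (xs ! i)"
      using h_iff[OF k j] h_le[of k] h_le[of j] b_le_1[of "xs ! j" "xs ! i"] b_le_1[of "xs ! k" "xs ! j"]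
        b_le_1[of "xs ! k" "xs ! i"] xX i j k by (auto simp: le_Suc_eq)
    then have "t ^ (b (xs ! k) (xs ! j) + b (xs ! j) (xs ! i)) dvd t ^ b (xs ! k) (xs ! i)"
      by (rule le_imp_power_dvd)
    then show ?thesis unfolding r[OF i k] by (rule dvd_mult2)
  qed
  show thesis
    using that[of i j "r i j"] i j ij(2) u r[OF i j] col row by (simp add: n_def)
qed

text \<open>The summand is spanned by the basis vector at the pivot column and by its image under
  \<open>N\<close> divided by the power of \<open>t\<close> in the pivot; the divisibility of the
  column makes the quotient a morphism, that of the row does the same for the projection. The
  complement is carried by the other indices.\<close>

lemma split_off:
  assumes A: "A \<in> MFt" and ne: "fst A \<noteq> []"
  obtains x y C where "x \<in> X" "y \<in> X" "tE x y \<in> MFt" "C \<in> MFt" "length (fst C) < length (fst A)"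
    "tiso (msum (tE x y) C) A"
proof -
  obtain xs N where A_eq: "A = (xs, N)" by (cases A)
  define n where "n = length xs"
  have X: "set xs \<subseteq> X" and Ne: "N \<in> dhom t e xs xs" and NN: "N * N = t \<cdot>\<^sub>m 1\<^sub>m n"
    using A by (auto simp: A_eq MFt_def n_def)
  have N: "N \<in> hom xs xs" by (rule dhom_e_hom[OF X X Ne])
  have car: "N \<in> carrier_mat n n" using dhomD(1)[OF N] by (simp add: n_def)
  obtain i j u where i: "i < n" and j: "j < n" and ij: "i \<noteq> j" and u: "u dvd 1"
    and Nij: "N $$ (i, j) = t ^ b (xs ! j) (xs ! i) * u"
    and col: "\<And>k. k < n \<Longrightarrow> t ^ (b (xs ! j) (xs ! i) + b (xs ! i) (xs ! k)) dvd N $$ (k, j)"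
    and row: "\<And>k. k < n \<Longrightarrow> t ^ (b (xs ! k) (xs ! j) + b (xs ! j) (xs ! i)) dvd N $$ (i, k)"
    using pivot[OF X N NN[unfolded n_def]] ne by (auto simp: A_eq n_def)
  define x y where "x = xs ! j" and "y = xs ! i"
  have xy: "x \<in> X" "y \<in> X" using X i j by (auto simp: x_def y_def n_def)
  obtain v where uv: "v * u = 1" using u by (metis dvdE mult.commute)
  define D where "D = snd (tE x y)"
  define T where "T = t ^ b x y"
  have T0: "T \<noteq> 0" using t_nonzero by (simp add: T_def)
  have DT: "t ^ (1 - b x y) * T = t"
    using b_le_1[OF xy] by (simp add: T_def power_add[symmetric])
  have carD: "D \<in> carrier_mat 2 2" by (simp add: D_def)
  have "\<exists>r. N $$ (k, j) = T * r \<and> t ^ b y (xs ! k) dvd r" if "k < n" for k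
  proof -
    have "T * t ^ b y (xs ! k) dvd N $$ (k, j)"
      using col[OF that] by (simp add: power_add T_def x_def y_def)
    then obtain q where "N $$ (k, j) = T * t ^ b y (xs ! k) * q" by (rule dvdE)
    then show ?thesis by (intro exI[of _ "t ^ b y (xs ! k) * q"]) (simp add: mult.assoc)
  qed
  then obtain a where a: "\<And>k. k < n \<Longrightarrow> N $$ (k, j) = T * a k" "\<And>k. k < n \<Longrightarrow> t ^ b y (xs ! k) dvd a k"
    by metis
  have "\<exists>r. N $$ (i, k) = T * r \<and> t ^ b (xs ! k) x dvd r" if "k < n" for k
  proof -
    have "t ^ b (xs ! k) x * T dvd N $$ (i, k)"
      using row[OF that] by (simp add: power_add T_def x_def y_def)
    then obtain q where "N $$ (i, k) = t ^ b (xs ! k) x * T * q" by (rule dvdE)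
    then show ?thesis by (intro exI[of _ "t ^ b (xs ! k) x * q"]) (simp add: mult_ac)
  qed
  then obtain g where g: "\<And>k. k < n \<Longrightarrow> N $$ (i, k) = T * g k" "\<And>k. k < n \<Longrightarrow> t ^ b (xs ! k) x dvd g k"
    by metis
  have "N $$ (i, j) = T * u" using Nij by (simp add: T_def x_def y_def)
  then have ai: "a i = u" and gj: "g j = u"
    using a(1)[OF i] g(1)[OF j] T0 by simp_all
  have NNe: "(\<Sum>l<n. N $$ (k, l) * N $$ (l, k')) = (if k = k' then t else 0)" if "k < n" "k' < n" for k k'
    using mat_mult_entry[OF car car that, symmetric] NN that by simp
  \<comment> \<open>Column 0 is the basis vector at \<open>j\<close>, column 1 is \<open>N\<close>
    applied to it and divided by \<open>T\<close>. Dually, the rows of \<open>\<rho>\<close> are row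
    \<open>i\<close> of \<open>N\<close> divided by \<open>T\<close> and the basis covector at
    \<open>i\<close>, both normalized by the inverse \<open>v\<close> of the unit
    \<open>u\<close>.\<close>
  define \<iota> where "\<iota> = mat n 2 (\<lambda>(k, s). if s = 0 then (if k = j then 1 else 0) else a k)"
  define \<rho> where "\<rho> = mat 2 n (\<lambda>(s, k). if s = 0 then v * g k else if k = i then v else 0)"
  have c\<iota>: "\<iota> \<in> carrier_mat n 2" and c\<rho>: "\<rho> \<in> carrier_mat 2 n" by (simp_all add: \<iota>_def \<rho>_def)
  have \<iota>e [simp]: "k < n \<Longrightarrow> \<iota> $$ (k, 0) = (if k = j then 1 else 0)" "k < n \<Longrightarrow> \<iota> $$ (k, Suc 0) = a k" for k
    by (simp_all add: \<iota>_def)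
  have \<rho>e [simp]: "k < n \<Longrightarrow> \<rho> $$ (0, k) = v * g k" "k < n \<Longrightarrow> \<rho> $$ (Suc 0, k) = (if k = i then v else 0)" for k
    by (simp_all add: \<rho>_def)
  have h\<iota>: "\<iota> \<in> hom [x, y] xs"
  proof (rule dhomI)
    fix k s assume ks: "k < length xs" "s < length [x, y]"
    then have "s = 0 \<or> s = 1" by auto
    then show "t ^ b ([x, y] ! s) (xs ! k) dvd \<iota> $$ (k, s)"
      using ks a(2)[of k] b_refl[OF xy(1)] by (auto simp: n_def x_def)
  qed (use c\<iota> in \<open>simp add: n_def numeral_2_eq_2\<close>)
  have h\<rho>: "\<rho> \<in> hom xs [x, y]"
  proof (rule dhomI)
    fix s k assume ks: "k < length xs" "s < length [x, y]"
    then have "s = 0 \<or> s = 1" by auto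
    then show "t ^ b (xs ! k) ([x, y] ! s) dvd \<rho> $$ (s, k)"
      using ks g(2)[of k] b_refl[OF xy(2)] by (auto simp: n_def y_def)
  qed (use c\<rho> in \<open>simp add: n_def numeral_2_eq_2\<close>)
  have \<rho>\<iota>: "\<rho> * \<iota> = 1\<^sub>m 2"
  proof (rule eq_matI)
    fix s s' assume "s < dim_row (1\<^sub>m 2 :: 'r mat)" "s' < dim_col (1\<^sub>m 2 :: 'r mat)"
    then have s: "s < 2" "s' < 2" by auto
    \<comment> \<open>Up to a unit and powers of \<open>t\<close> the upper right entry of
      \<open>\<rho> * \<iota>\<close> is the entry of \<open>N * N\<close> at \<open>(i, j)\<close>,
      which vanishes as the pivot is off the diagonal.\<close>
    have "T * T * (\<Sum>k<n. g k * a k) = (\<Sum>k<n. N $$ (i, k) * N $$ (k, j))"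
      unfolding sum_distrib_left by (intro sum.cong) (auto simp: a g)
    then have ga: "(\<Sum>k<n. v * g k * a k) = 0"
      using NNe[OF i j] ij T0 by (simp add: sum_distrib_left[symmetric] mult.assoc)
    have "s = 0 \<and> s' = 0 \<or> s = 0 \<and> s' = 1 \<or> s = 1 \<and> s' = 0 \<or> s = 1 \<and> s' = 1" using s by linarith
    then show "(\<rho> * \<iota>) $$ (s, s') = 1\<^sub>m 2 $$ (s, s')"
      unfolding mat_mult_entry[OF c\<rho> c\<iota> s]
      using i j ij ga uv
      by (elim disjE conjE) (simp_all add: if_distrib[of "\<lambda>z. _ * z"] if_distrib[of "\<lambda>z. z * _"] ai gj cong: if_cong)
  qed (use c\<rho> c\<iota> in auto)
  have N\<iota>: "N * \<iota> = \<iota> * D"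
  proof (rule eq_matI)
    fix k s assume "k < dim_row (\<iota> * D)" "s < dim_col (\<iota> * D)"
    then have ks: "k < n" "s < 2" using c\<iota> carD by auto
    have "T * (\<Sum>l<n. N $$ (k, l) * a l) = (\<Sum>l<n. N $$ (k, l) * N $$ (l, j))"
      unfolding sum_distrib_left by (intro sum.cong) (auto simp: a)
    also have "\<dots> = T * (if k = j then t ^ (1 - b x y) else 0)"
      using NNe[OF ks(1) j] DT by (simp add: mult.commute)
    finally have Na: "(\<Sum>l<n. N $$ (k, l) * a l) = (if k = j then t ^ (1 - b x y) else 0)"
      using T0 by simp
    have "s = 0 \<or> s = 1" using ks by auto
    then show "(N * \<iota>) $$ (k, s) = (\<iota> * D) $$ (k, s)"
      unfolding mat_mult_entry[OF car c\<iota> ks] mult_entry2[OF c\<iota> carD ks]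
      using ks j Na by (elim disjE) (simp_all add: if_distrib[of "\<lambda>z. _ * z"] a D_def T_def cong: if_cong)
  qed (use car c\<iota> carD in auto)
  have \<rho>N: "\<rho> * N = D * \<rho>"
  proof (rule eq_matI)
    fix s k assume "s < dim_row (D * \<rho>)" "k < dim_col (D * \<rho>)"
    then have ks: "s < 2" "k < n" using c\<rho> carD by auto
    have "T * (\<Sum>l<n. v * g l * N $$ (l, k)) = v * (\<Sum>l<n. N $$ (i, l) * N $$ (l, k))"
      unfolding sum_distrib_left by (intro sum.cong) (auto simp: g)
    also have "\<dots> = T * (if k = i then v * t ^ (1 - b x y) else 0)"
      using NNe[OF i ks(2)] DT by (auto simp: mult_ac)
    finally have Na: "(\<Sum>l<n. v * g l * N $$ (l, k)) = (if k = i then v * t ^ (1 - b x y) else 0)"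
      using T0 by simp
    have "s = 0 \<or> s = 1" using ks by auto
    then show "(\<rho> * N) $$ (s, k) = (D * \<rho>) $$ (s, k)"
      unfolding mat_mult_entry[OF c\<rho> car ks] mult_entry2[OF carD c\<rho> ks]
      using ks i Na
      by (elim disjE)
        (simp_all add: if_distrib[of "\<lambda>z. z * _"] if_distrib[of "\<lambda>z. _ * z"] g D_def T_def mult_ac cong: if_cong)
  qed (use car c\<rho> carD in auto)
  define P where "P = 1\<^sub>m n - \<iota> * \<rho>"
  have cP: "P \<in> carrier_mat n n" and c\<iota>\<rho>: "\<iota> * \<rho> \<in> carrier_mat n n" using c\<iota> c\<rho> by (auto simp: P_def)
  have Pe: "P $$ (k, k') = 1\<^sub>m n $$ (k, k') - (\<iota> * \<rho>) $$ (k, k')" if "k < n" "k' < n" for k k'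
    unfolding P_def using c\<iota> c\<rho> that by (intro index_minus_mat(1)) auto
  have \<iota>\<rho>\<iota>: "\<iota> * \<rho> * \<iota> = \<iota>" and \<rho>\<iota>\<rho>: "\<rho> * (\<iota> * \<rho>) = \<rho>"
    using c\<iota> c\<rho> \<rho>\<iota> by (simp_all add: assoc_mult_mat[OF c\<iota> c\<rho> c\<iota>] assoc_mult_mat[OF c\<rho> c\<iota> c\<rho>, symmetric])
  have P\<iota>: "P * \<iota> = 0\<^sub>m n 2"
    using c\<iota> c\<iota>\<rho> by (simp add: P_def minus_mult_distrib_mat[of _ n n _ _ 2] \<iota>\<rho>\<iota>)
  have \<rho>P: "\<rho> * P = 0\<^sub>m 2 n"
    using c\<rho> c\<iota>\<rho> by (simp add: P_def mult_minus_distrib_mat[of _ 2 n _ n] \<rho>\<iota>\<rho>)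
  have PP: "P * P = P"
  proof -
    have "P * (\<iota> * \<rho>) = 0\<^sub>m n n"
      using assoc_mult_mat[OF cP c\<iota> c\<rho>] P\<iota> c\<rho> by simp
    moreover have "P * (1\<^sub>m n - \<iota> * \<rho>) = P * 1\<^sub>m n - P * (\<iota> * \<rho>)"
      using cP c\<iota>\<rho> by (intro mult_minus_distrib_mat[of _ n n _ n]) auto
    ultimately have "P * (1\<^sub>m n - \<iota> * \<rho>) = P" using cP by (auto intro!: eq_matI)
    then show ?thesis by (simp only: P_def[symmetric])
  qed
  have NP: "N * P = P * N"
  proof -
    have "N * (\<iota> * \<rho>) = \<iota> * D * \<rho>" using assoc_mult_mat[OF car c\<iota> c\<rho>] N\<iota> by simp
    also have "\<dots> = \<iota> * \<rho> * N"
      using assoc_mult_mat[OF c\<iota> carD c\<rho>] assoc_mult_mat[OF c\<iota> c\<rho> car] \<rho>N by simp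
    finally show ?thesis using car c\<iota>\<rho>
      by (simp add: P_def mult_minus_distrib_mat[of _ n n _ n] minus_mult_distrib_mat[of _ n n _ _ n])
  qed
  \<comment> \<open>Column 0 of \<open>\<iota>\<close> is a basis vector, so
    \<open>P * \<iota> = 0\<close> annihilates column \<open>j\<close> of \<open>P\<close>; likewise
    \<open>\<rho> * P = 0\<close> annihilates row \<open>i\<close>.\<close>
  have Pj: "P $$ (k, j) = 0" if "k < n" for k
  proof -
    have "(P * \<iota>) $$ (k, 0) = (\<Sum>l<n. if l = j then P $$ (k, l) else 0)"
      unfolding mat_mult_entry[OF cP c\<iota> that zero_less_numeral] by (intro sum.cong) auto
    then show ?thesis using P\<iota> j that by simp
  qed
  have Pi: "P $$ (i, k) = 0" if "k < n" for k
  proof -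
    have one_less_numeral: "1 < (2::nat)" by simp
    have "(\<rho> * P) $$ (1, k) = (\<Sum>l<n. if l = i then v * P $$ (l, k) else 0)"
      unfolding mat_mult_entry[OF c\<rho> cP one_less_numeral that] using i that by (intro sum.cong) auto
    then show ?thesis using \<rho>P i that uv by auto
  qed
  define ks where "ks = filter (\<lambda>k. k \<noteq> i \<and> k \<noteq> j) [0..<n]"
  define m where "m = length ks"
  define ys where "ys = map ((!) xs) ks"
  have ks: "set ks = {..<n} - {i, j}" "distinct ks" by (auto simp: ks_def)
  have ksn: "ks ! l < n" "ks ! l \<noteq> i" "ks ! l \<noteq> j" if "l < m" for l
    using nth_mem[of l ks] that ks(1) by (auto simp: m_def)
  have sum_ks: "(\<Sum>l<m. f (ks ! l)) = (\<Sum>k<n. f k)" if "f i = 0" "f j = 0" for f :: "nat \<Rightarrow> 'r"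
  proof -
    have "(\<Sum>l<m. f (ks ! l)) = sum f (set ks)"
      using bij_betw_nth[OF ks(2), of "{..<m}" "set ks"] by (intro sum.reindex_bij_betw) (auto simp: m_def)
    also have "\<dots> = (\<Sum>k<n. f k)"
      using that by (intro sum.mono_neutral_left) (auto simp: ks(1))
    finally show ?thesis .
  qed
  have len: "length ys = m" "m < n"
  proof -
    have "length ks < length [0..<n]" unfolding ks_def using i by (intro length_filter_less[of i]) auto
    then show "length ys = m" "m < n" by (auto simp: ys_def m_def)
  qed
  have Y: "set ys \<subseteq> X" using ks(1) by (auto simp: ys_def n_def intro!: subsetD[OF X] nth_mem)
  define \<kappa> where "\<kappa> = mat n m (\<lambda>(k, l). P $$ (k, ks ! l))"
  define \<tau> where "\<tau> = mat m n (\<lambda>(l, k). P $$ (ks ! l, k))"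
  have c\<kappa>: "\<kappa> \<in> carrier_mat n m" and c\<tau>: "\<tau> \<in> carrier_mat m n" by (simp_all add: \<kappa>_def \<tau>_def)
  \<comment> \<open>The terms for \<open>i\<close> and \<open>j\<close> may be left out of the sum
    for \<open>P * P\<close>: the first contains an entry of row \<open>i\<close>, the second one of
    column \<open>j\<close>.\<close>
  have \<kappa>\<tau>: "\<kappa> * \<tau> = P"
  proof (rule eq_matI)
    fix k k' assume "k < dim_row P" "k' < dim_col P"
    then have k: "k < n" "k' < n" using cP by auto
    have "(\<kappa> * \<tau>) $$ (k, k') = (\<Sum>l<m. P $$ (k, ks ! l) * P $$ (ks ! l, k'))"
      unfolding mat_mult_entry[OF c\<kappa> c\<tau> k] using k by (simp add: \<kappa>_def \<tau>_def)
    also have "\<dots> = (\<Sum>l<n. P $$ (k, l) * P $$ (l, k'))"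
      by (rule sum_ks) (use Pi Pj k in auto)
    also have "\<dots> = P $$ (k, k')" using mat_mult_entry[OF cP cP k] PP by simp
    finally show "(\<kappa> * \<tau>) $$ (k, k') = P $$ (k, k')" .
  qed (use c\<kappa> c\<tau> cP in auto)
  have \<tau>\<kappa>: "\<tau> * \<kappa> = 1\<^sub>m m"
  proof (rule eq_matI)
    fix l l' assume "l < dim_row (1\<^sub>m m :: 'r mat)" "l' < dim_col (1\<^sub>m m :: 'r mat)"
    then have l: "l < m" "l' < m" by auto
    have "(\<tau> * \<kappa>) $$ (l, l') = (\<Sum>k<n. P $$ (ks ! l, k) * P $$ (k, ks ! l'))"
      unfolding mat_mult_entry[OF c\<tau> c\<kappa> l] using l by (simp add: \<kappa>_def \<tau>_def)
    also have "\<dots> = P $$ (ks ! l, ks ! l')" using mat_mult_entry[OF cP cP ksn(1)[OF l(1)] ksn(1)[OF l(2)]] PP by simp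
    \<comment> \<open>An entry of \<open>\<iota> * \<rho>\<close> can be nonzero only in row
      \<open>j\<close> or in column \<open>i\<close>, so on the remaining indices \<open>P\<close>
      is the identity.\<close>
    also have "\<dots> = (if ks ! l = ks ! l' then 1 else 0)"
      using ksn[OF l(1)] ksn[OF l(2)]
      by (simp add: Pe mult_entry2[OF c\<iota> c\<rho>] del: index_mult_mat(1))
    also have "\<dots> = 1\<^sub>m m $$ (l, l')" using l ks(2) by (simp add: m_def nth_eq_iff_index_eq)
    finally show "(\<tau> * \<kappa>) $$ (l, l') = 1\<^sub>m m $$ (l, l')" .
  qed (use c\<kappa> c\<tau> in auto)
  have P\<kappa>: "P * \<kappa> = \<kappa>"
    using assoc_mult_mat[OF c\<kappa> c\<tau> c\<kappa>] \<kappa>\<tau> \<tau>\<kappa> c\<kappa> by simp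
  have \<tau>P: "\<tau> * P = \<tau>"
    using assoc_mult_mat[OF c\<tau> c\<kappa> c\<tau>] \<kappa>\<tau> \<tau>\<kappa> c\<tau> by simp
  have \<rho>\<kappa>: "\<rho> * \<kappa> = 0\<^sub>m 2 m"
    using assoc_mult_mat[OF c\<rho> cP c\<kappa>] P\<kappa> \<rho>P c\<kappa> by simp
  have \<tau>\<iota>: "\<tau> * \<iota> = 0\<^sub>m m 2"
    using assoc_mult_mat[OF c\<tau> cP c\<iota>] \<tau>P P\<iota> c\<tau> by simp
  have sum1: "\<iota> * \<rho> + \<kappa> * \<tau> = 1\<^sub>m n"
    unfolding \<kappa>\<tau> using c\<iota> c\<rho> cP by (intro eq_matI) (auto simp: Pe simp del: index_mult_mat(1))
  have hP: "P \<in> hom xs xs"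
  proof (rule dhomI)
    fix k k' assume kk: "k < length xs" "k' < length xs"
    have "t ^ b (xs ! k') (xs ! k) dvd 1\<^sub>m n $$ (k, k')" "t ^ b (xs ! k') (xs ! k) dvd (\<iota> * \<rho>) $$ (k, k')"
      using dhomD(2)[OF hom_one[OF X] kk] dhomD(2)[OF hom_mult[OF X _ X h\<iota> h\<rho>] kk] xy by (auto simp: n_def)
    then show "t ^ b (xs ! k') (xs ! k) dvd P $$ (k, k')"
      using kk by (simp add: Pe n_def del: index_mult_mat(1))
  qed (use cP n_def in auto)
  have h\<kappa>: "\<kappa> \<in> hom ys xs"
  proof (rule dhomI)
    fix k l assume "k < length xs" "l < length ys"
    then show "t ^ b (ys ! l) (xs ! k) dvd \<kappa> $$ (k, l)"
      using dhomD(2)[OF hP, of k "ks ! l"] ksn[of l] len by (simp add: \<kappa>_def ys_def n_def m_def)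
  qed (use c\<kappa> len n_def in auto)
  have h\<tau>: "\<tau> \<in> hom xs ys"
  proof (rule dhomI)
    fix k l assume "k < length xs" "l < length ys"
    then show "t ^ b (xs ! k) (ys ! l) dvd \<tau> $$ (l, k)"
      using dhomD(2)[OF hP, of "ks ! l" k] ksn[of l] len by (simp add: \<tau>_def ys_def n_def m_def)
  qed (use c\<tau> len n_def in auto)
  define M where "M = \<tau> * (N * \<kappa>)"
  have cM: "M \<in> carrier_mat m m" and cN\<kappa>: "N * \<kappa> \<in> carrier_mat n m" using c\<tau> car c\<kappa> by (auto simp: M_def)
  have \<kappa>M: "N * \<kappa> = \<kappa> * M"
  proof -
    have "\<kappa> * M = P * (N * \<kappa>)" unfolding M_def using assoc_mult_mat[OF c\<kappa> c\<tau> cN\<kappa>] \<kappa>\<tau> by simp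
    also have "\<dots> = N * (P * \<kappa>)"
      using assoc_mult_mat[OF cP car c\<kappa>] assoc_mult_mat[OF car cP c\<kappa>] NP by simp
    finally show ?thesis unfolding P\<kappa> by simp
  qed
  have MM: "M * M = t \<cdot>\<^sub>m 1\<^sub>m m"
  proof -
    have "M * M = \<tau> * (N * \<kappa> * M)"
      using assoc_mult_mat[OF c\<tau> cN\<kappa> cM] by (simp only: M_def[symmetric])
    also have "N * \<kappa> * M = N * (N * \<kappa>)" using assoc_mult_mat[OF car c\<kappa> cM] \<kappa>M by simp
    also have "\<dots> = t \<cdot>\<^sub>m \<kappa>" using assoc_mult_mat[OF car car c\<kappa>] NN c\<kappa> mult_smult_assoc_mat[of "1\<^sub>m n" n n \<kappa> m t]
      by simp
    also have "\<tau> * (t \<cdot>\<^sub>m \<kappa>) = t \<cdot>\<^sub>m 1\<^sub>m m" using mult_smult_distrib[OF c\<tau> c\<kappa>] \<tau>\<kappa> by simp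
    finally show ?thesis .
  qed
  \<comment> \<open>A product with \<open>N\<close> in the middle inherits the exponent
    \<open>e\<close>, so the complement stays in the category; \<open>hD\<close> below treats the
    summand \<open>E(x, y)\<close> in the same way.\<close>
  have hM: "M \<in> dhom t e ys ys"
    unfolding M_def using hom_e_mult[OF Y X Y h\<tau> e_hom_mult[OF Y X X Ne h\<kappa>]] .
  have C: "(ys, M) \<in> MFt" using Y hM MM len by (simp add: MFt_def)
  have D: "D = \<rho> * (N * \<iota>)"
    unfolding N\<iota> using assoc_mult_mat[OF c\<rho> c\<iota> carD] \<rho>\<iota> carD by simp
  have xyX: "set [x, y] \<subseteq> X" using xy by simp
  have hD: "D \<in> dhom t e [x, y] [x, y]"
    unfolding D using hom_e_mult[OF xyX X xyX h\<rho> e_hom_mult[OF xyX X X Ne h\<iota>]] .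
  have E: "tE x y \<in> MFt"
    using xy hD tE_square[OF xy] by (simp add: MFt_def D_def tE_def numeral_2_eq_2)
  have "tiso (msum (tE x y) (ys, M)) A"
    unfolding A_eq
    by (rule tiso_biproduct[where i = \<iota> and j = \<kappa> and p = \<rho> and q = \<tau>])
      (use mobj_tE[OF xy] mobj_MFt[OF C] mobj_MFt[OF A] h\<iota> h\<rho> h\<kappa> h\<tau> N\<iota> \<kappa>M \<rho>\<iota> \<rho>\<kappa> \<tau>\<iota> \<tau>\<kappa> sum1 len
        in \<open>simp_all add: A_eq D_def n_def numeral_2_eq_2\<close>)
  then show thesis using that[OF xy E C] len by (simp add: A_eq n_def)
qed

lemma decomposition:
  assumes "A \<in> MFt"
  shows "\<exists>ps. (\<forall>(x, y)\<in>set ps. x \<in> X \<and> y \<in> X \<and> tE x y \<in> MFt) \<and> tiso A (MF_sum (map (\<lambda>(x, y). tE x y) ps))"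
  using assms
proof (induction "length (fst A)" arbitrary: A rule: less_induct)
  case less
  show ?case
  proof (cases "fst A = []")
    case True
    then have "A = ([], 0\<^sub>m 0 0)" using less(2) mobj_MFt[of A] by (cases A) (auto simp: mobj_def)
    then show ?thesis using tiso_refl[OF mobj_MFt[OF less(2)]] by (intro exI[of _ "[]"]) simp
  next
    case False
    obtain x y C where xy: "x \<in> X" "y \<in> X" "tE x y \<in> MFt" and C: "C \<in> MFt" "length (fst C) < length (fst A)"
      "tiso (msum (tE x y) C) A"
      using split_off[OF less(2) False] by blast
    obtain ps where ps: "\<And>x y. (x, y) \<in> set ps \<Longrightarrow> x \<in> X \<and> y \<in> X \<and> tE x y \<in> MFt"
      "tiso C (MF_sum (map (\<lambda>(x, y). tE x y) ps))"
      using less(1)[OF C(2,1)] by auto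
    have ob: "mobj B" if "B \<in> set (map (\<lambda>(x, y). tE x y) ps)" for B using ps(1) that mobj_tE by auto
    note m = mobj_MFt[OF C(1)] mobj_tE[OF xy(1,2)] mobj_MFt[OF less(2)] MF_sum_Cons[of "tE x y" "map (\<lambda>(x, y). tE x y) ps", OF mobj_tE[OF xy(1,2)] ob]
    have "tiso (msum (tE x y) C) (MF_sum (map (\<lambda>(x, y). tE x y) ((x, y) # ps)))"
      using tiso_msum[OF m(2,1,2,5) tiso_refl[OF m(2)] ps(2)] m(4) by simp
    moreover have "tiso A (msum (tE x y) C)"
      using tiso_sym[OF mobj_msum[OF m(2,1)] m(3) C(3)] .
    ultimately have "tiso A (MF_sum (map (\<lambda>(x, y). tE x y) ((x, y) # ps)))"
      using tiso_trans[OF m(3) mobj_msum[OF m(2,1)] _] mobj_msum[OF m(2,5)] m(4) by simp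
    then show ?thesis using ps(1) xy by (intro exI[of _ "(x, y) # ps"]) auto
  qed
qed

section \<open>Indecomposable objects and uniqueness\<close>

lemma t_power_dvd_iff: "t ^ k dvd t ^ m \<longleftrightarrow> k \<le> m"
proof
  assume dvd: "t ^ k dvd t ^ m"
  show "k \<le> m"
  proof (rule ccontr)
    assume "\<not> k \<le> m"
    then have "t ^ Suc m dvd t ^ k" by (intro le_imp_power_dvd) simp
    then have "t ^ Suc m dvd t ^ m" using dvd by (rule dvd_trans)
    then have "t ^ m * t dvd t ^ m * 1" by (simp add: mult.commute)
    then have "t dvd 1" using t_nonzero by (simp only: dvd_mult_cancel_left) simp
    then show False using t_nonunit by simp
  qed
qed (rule le_imp_power_dvd)

text \<open>The entries are powers of \<open>t\<close>, so membership means
  \<open>e x y \<le> b x y\<close> and \<open>e y x \<le> 1 - b x y\<close>. In the converse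
  direction \<open>b \<le> e\<close> settles the case of inequivalent points; for equivalent ones
  \<open>e x y = e y x\<close>, and a sum of at most 1 makes both 0.\<close>

lemma tE_MFt_iff:
  assumes x: "x \<in> X" and y: "y \<in> X"
  shows "tE x y \<in> MFt \<longleftrightarrow> e x y + e y x \<le> 1"
proof -
  have sq: "snd (tE x y) * snd (tE x y) = t \<cdot>\<^sub>m 1\<^sub>m (length [x, y])"
    using tE_square[OF x y] by (simp add: numeral_2_eq_2)
  have dh: "snd (tE x y) \<in> dhom t e [x, y] [x, y] \<longleftrightarrow> e x y \<le> b x y \<and> e y x \<le> 1 - b x y"
  proof
    assume *: "snd (tE x y) \<in> dhom t e [x, y] [x, y]"
    show "e x y \<le> b x y \<and> e y x \<le> 1 - b x y"
      using dhomD(2)[OF *, of 1 0] dhomD(2)[OF *, of 0 1] by (simp add: t_power_dvd_iff)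
  next
    assume *: "e x y \<le> b x y \<and> e y x \<le> 1 - b x y"
    show "snd (tE x y) \<in> dhom t e [x, y] [x, y]"
    proof (rule dhomI)
      fix i j assume "i < length [x, y]" "j < length [x, y]"
      then have "i = 0 \<and> j = 0 \<or> i = 0 \<and> j = 1 \<or> i = 1 \<and> j = 0 \<or> i = 1 \<and> j = 1" by auto
      then show "t ^ e ([x, y] ! j) ([x, y] ! i) dvd snd (tE x y) $$ (i, j)"
        using * by (elim disjE conjE) (simp_all add: t_power_dvd_iff)
    qed (use snd_tE_carrier in \<open>simp add: numeral_2_eq_2\<close>)
  qed
  have "e x y \<le> b x y \<and> e y x \<le> 1 - b x y \<longleftrightarrow> e x y + e y x \<le> 1"
  proof
    assume *: "e x y + e y x \<le> 1"
    have 1: "b x y \<le> e x y" "b y x \<le> e y x" using e_eq x y by auto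
    show "e x y \<le> b x y \<and> e y x \<le> 1 - b x y"
    proof (cases "b x y = 0 \<and> b y x = 0")
      case True
      then have "e x y \<le> e y x" "e y x \<le> e x y"
        using e_left[of x y y] e_right[of y x y] e_left[of y x x] e_right[of x y x] x y by auto
      then show ?thesis using * True by simp
    qed (use 1 * in linarith)
  qed (use b_le_1[OF x y] in linarith)
  then show ?thesis using x y sq dh unfolding MFt_def by (auto simp: tE_def)
qed

lemma MFt_square: "A \<in> MFt \<Longrightarrow> snd A * snd A = t \<cdot>\<^sub>m 1\<^sub>m (length (fst A))"
  by (auto simp: MFt_def)

lemma msum_MFt:
  assumes A: "A \<in> MFt" and B: "B \<in> MFt" shows "msum A B \<in> MFt"
proof -
  let ?a = "length (fst A)" and ?b = "length (fst B)"
  have d: "snd A \<in> dhom t e (fst A) (fst A)" "snd B \<in> dhom t e (fst B) (fst B)"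
    and X: "set (fst A) \<subseteq> X" "set (fst B) \<subseteq> X" using A B by (auto simp: MFt_def)
  note c = dhomD(1)[OF d(1)] dhomD(1)[OF d(2)]
  have "snd (msum A B) \<in> dhom t e (fst A @ fst B) (fst A @ fst B)"
    using d by (auto simp: msum_def intro!: dhom_four_block dhom_zero)
  moreover have "snd (msum A B) * snd (msum A B) = t \<cdot>\<^sub>m 1\<^sub>m (?a + ?b)"
    unfolding msum_def snd_conv
    by (subst mult_four_block_mat[of _ ?a ?a _ ?b _ ?b _ _ ?a _ ?b])
      (use c MFt_square[OF A] MFt_square[OF B] in \<open>auto intro!: eq_matI\<close>)
  ultimately show ?thesis using X by (auto simp: MFt_def msum_def)
qed

lemma MF_sum_MFt:
  assumes "\<And>A. A \<in> set As \<Longrightarrow> A \<in> MFt" shows "MF_sum As \<in> MFt"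
  using assms
proof (induction As)
  case Nil
  then show ?case by (auto simp: MFt_def intro!: dhomI)
next
  case (Cons A As)
  then show ?case using MF_sum_Cons[of A As] mobj_MFt msum_MFt by simp
qed

lemma tiso_length:
  assumes "tiso A B" shows "length (fst A) = length (fst B)"
proof -
  obtain F G where FG: "F \<in> hom (fst A) (fst B)" "G \<in> hom (fst B) (fst A)"
    "G * F = 1\<^sub>m (length (fst A))" "F * G = 1\<^sub>m (length (fst B))"
    using assms by (auto simp: tiso_def)
  note c = dhomD(1)[OF FG(1)] dhomD(1)[OF FG(2)]
  show ?thesis
    using left_invertible_mod_imp_le[OF c(2,1) t_nonunit] left_invertible_mod_imp_le[OF c t_nonunit]
    unfolding FG(3,4) by simp
qed

text \<open>A square root of \<open>t\<close> would be neither a unit, for then \<open>t\<close>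
  would be one, nor divisible by \<open>t\<close>, for then \<open>t * t\<close> would divide
  \<open>t\<close>.\<close>

lemma MFt_length_neq_1:
  assumes "A \<in> MFt" shows "length (fst A) \<noteq> 1"
proof
  assume 1: "length (fst A) = 1"
  define r where "r = snd A $$ (0, 0)"
  have c: "snd A \<in> carrier_mat 1 1" using mobj_MFt[OF assms] 1 by (simp add: mobj_def)
  have "(snd A * snd A) $$ (0, 0) = r * r" using mat_mult_entry[OF c c, of 0 0] by (simp add: r_def)
  then have rr: "r * r = t" using MFt_square[OF assms] 1 by simp
  consider "r dvd 1" | "t dvd r" using t_local by blast
  then show False
  proof cases
    case 1
    then have "r * r dvd 1" using mult_dvd_mono[OF 1 1] by simp
    then show False using rr t_nonunit by simp
  next
    case 2
    then have "t * t dvd t * 1" using mult_dvd_mono[OF 2 2] rr by simp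
    then show False using t_nonzero t_nonunit by (simp only: dvd_mult_cancel_left) simp
  qed
qed

lemma mobj_zero: "mobj MF_zero" and tw_zero: "tw MF_zero = MF_zero"
  by (auto simp: mobj_def MF_zero_def tw_def)

lemma mobj_length_0: "mobj A \<Longrightarrow> length (fst A) = 0 \<Longrightarrow> A = MF_zero"
  by (cases A) (auto simp: mobj_def MF_zero_def)

lemma MF_iso_zero_iff: "mobj A \<Longrightarrow> MF_iso c t A MF_zero \<longleftrightarrow> fst A = []"
proof -
  assume A: "mobj A"
  have "tiso (tw A) MF_zero \<longleftrightarrow> fst A = []"
  proof
    assume "tiso (tw A) MF_zero"
    then show "fst A = []" using tiso_length by (fastforce simp: MF_zero_def)
  next
    assume "fst A = []"
    then show "tiso (tw A) MF_zero" using mobj_length_0[OF A] tiso_refl[OF mobj_zero] by (simp add: tw_zero)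
  qed
  then show ?thesis unfolding MF_iso_iff[OF A mobj_zero] tw_zero .
qed

lemma MF_sum_single: "MF_sum [A] = A"
  by (simp add: MF_sum_def del: diag_block_mat.simps)

lemma MF_sum_two: "mobj B \<Longrightarrow> mobj C \<Longrightarrow> MF_sum [B, C] = msum B C"
  using MF_sum_Cons[of B "[C]"] by (simp add: MF_sum_single)

text \<open>The rank is 2 and no object has rank 1, so in any decomposition into two summands one of
  them has rank 0.\<close>

lemma E_indecomposable:
  assumes xy: "x \<in> X" "y \<in> X" and E: "tE x y \<in> MFt"
  shows "MFphi_indecomposable (E c t x y)"
  unfolding MF_indecomposable_def
proof (intro conjI ballI impI)
  show "E c t x y \<in> MFphi" using E by (simp add: MF_phi_iff mobj_E[OF xy] tw_E[OF xy])
  show "\<not> MF_iso c t (E c t x y) MF_zero" using MF_iso_zero_iff[OF mobj_E[OF xy]] by (simp add: E_def)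
  fix B C assume "B \<in> MFphi" "C \<in> MFphi"
    and iso: "MF_iso c t (E c t x y) (MF_sum [B, C])"
  then have B: "mobj B" "tw B \<in> MFt" and C: "mobj C" "tw C \<in> MFt" by (simp_all add: MF_phi_iff)
  have "length (fst B) + length (fst C) = 2"
    using iso MF_iso_iff[OF mobj_E[OF xy] mobj_msum[OF B(1) C(1)]] tiso_length[of "tw (E c t x y)" "tw (msum B C)"]
    unfolding MF_sum_two[OF B(1) C(1)] by (simp add: msum_def E_def)
  moreover have "length (fst B) \<noteq> 1" "length (fst C) \<noteq> 1" using MFt_length_neq_1 B C by fastforce+
  ultimately have "length (fst B) = 0 \<or> length (fst C) = 0" by linarith
  then show "MF_iso c t B MF_zero \<or> MF_iso c t C MF_zero" using B C by (auto simp: MF_iso_zero_iff)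
qed

text \<open>After the first summand of a decomposition is set apart, the rest must be zero. The
  object \<open>S\<close> realizes this rest, since indecomposability speaks of
  \<open>MF_phi\<close> while the decomposition takes place in the matrix model.\<close>

lemma indecomposable_imp_E:
  assumes ind: "MFphi_indecomposable B"
  shows "\<exists>x y. x \<in> X \<and> y \<in> X \<and> tiso (tw B) (tE x y)"
proof -
  have B: "mobj B" "tw B \<in> MFt"
    using ind by (auto simp: MF_indecomposable_def MF_phi_iff)
  have nz: "fst B \<noteq> []"
    using ind MF_iso_zero_iff[OF B(1)] by (simp add: MF_indecomposable_def)
  obtain ps where ps: "\<And>x y. (x, y) \<in> set ps \<Longrightarrow> x \<in> X \<and> y \<in> X \<and> tE x y \<in> MFt"
    "tiso (tw B) (MF_sum (map (\<lambda>(x, y). tE x y) ps))"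
    using decomposition[OF B(2)] by auto
  show ?thesis
  proof (cases ps)
    case Nil
    then show ?thesis using ps(2) tiso_length[OF ps(2)] nz by simp
  next
    case (Cons p ps')
    obtain x y where p: "p = (x, y)" by (cases p)
    have xy: "x \<in> X" "y \<in> X" "tE x y \<in> MFt" using ps(1) Cons p by auto
    let ?T = "map (\<lambda>(x, y). tE x y) ps'"
    have T: "A \<in> MFt" if "A \<in> set ?T" for A using ps(1) Cons that by auto
    note sum = MF_sum_Cons[of "tE x y" ?T, OF mobj_tE[OF xy(1,2)] mobj_MFt[OF T]]
    obtain S where S: "S \<in> MFphi" "tw S = MF_sum ?T"
      using MFt_untwist[OF MF_sum_MFt[OF T]] by blast
    then have mS: "mobj S" by (simp add: MF_phi_iff)
    have "tw (msum (E c t x y) S) = msum (tE x y) (MF_sum ?T)"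
      by (simp add: tw_msum[OF mobj_E[OF xy(1,2)] mS] tw_E[OF xy(1,2)] S(2))
    then have "MF_iso c t B (MF_sum [E c t x y, S])"
      using ps(2) sum MF_iso_iff[OF B(1) mobj_msum[OF mobj_E[OF xy(1,2)] mS]]
      by (simp add: Cons p MF_sum_two[OF mobj_E[OF xy(1,2)] mS])
    moreover have "E c t x y \<in> MFphi" using xy by (simp add: MF_phi_iff mobj_E tw_E)
    moreover have "\<not> MF_iso c t (E c t x y) MF_zero"
      using MF_iso_zero_iff[OF mobj_E[OF xy(1,2)]] by (simp add: E_def)
    ultimately have "MF_iso c t S MF_zero" using ind S(1) unfolding MF_indecomposable_def by blast
    then have "fst (MF_sum ?T) = []" using MF_iso_zero_iff[OF mS] S(2) fst_tw[of S] by simp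
    then have "ps' = []" by (cases ps') (auto simp: MF_sum_def)
    then have "MF_sum (map (\<lambda>(x, y). tE x y) ps) = tE x y" by (simp add: Cons p MF_sum_single)
    then show ?thesis using ps(2) xy by auto
  qed
qed

section \<open>Local endomorphism rings and multiplicities\<close>

lemma tE_endomorphism:
  assumes xy: "x \<in> X" "y \<in> X" and K: "K \<in> carrier_mat 2 2"
    and comm: "snd (tE x y) * K = K * snd (tE x y)"
  shows "K $$ (1, 1) = K $$ (0, 0)"
    and "b x y = 0 \<Longrightarrow> K $$ (0, 1) = t * K $$ (1, 0)" and "b x y = 1 \<Longrightarrow> K $$ (1, 0) = t * K $$ (0, 1)"
proof -
  have e: "(snd (tE x y) * K) $$ (0, k) = (K * snd (tE x y)) $$ (0, k)" for k using comm by simp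
  have "t ^ (1 - b x y) * K $$ (1, 1) = K $$ (0, 0) * t ^ (1 - b x y)"
    using e[of 1] by (simp add: mult_entry2[OF snd_tE_carrier K] mult_entry2[OF K snd_tE_carrier] del: index_mult_mat(1))
  then show "K $$ (1, 1) = K $$ (0, 0)" using t_nonzero by (simp add: mult.commute)
  have "t ^ (1 - b x y) * K $$ (1, 0) = K $$ (0, 1) * t ^ b x y"
    using e[of 0] by (simp add: mult_entry2[OF snd_tE_carrier K] mult_entry2[OF K snd_tE_carrier] del: index_mult_mat(1))
  then show "b x y = 0 \<Longrightarrow> K $$ (0, 1) = t * K $$ (1, 0)" "b x y = 1 \<Longrightarrow> K $$ (1, 0) = t * K $$ (0, 1)"
    by simp_all
qed

text \<open>\<open>t\<close> divides the first factor if \<open>b x y = 0\<close> and the second if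
  \<open>b x y = 1\<close>. Consequently the \<open>(0, 0)\<close> entry is multiplicative modulo
  \<open>t\<close> on endomorphisms of \<open>E(x, y)\<close>; it is the map to the residue
  field.\<close>

lemma tE_endomorphisms_dvd:
  assumes xy: "x \<in> X" "y \<in> X" and K: "K \<in> carrier_mat 2 2" "snd (tE x y) * K = K * snd (tE x y)"
    and L: "L \<in> carrier_mat 2 2" "snd (tE x y) * L = L * snd (tE x y)"
  shows "t dvd K $$ (0, 1) * L $$ (1, 0)"
  using tE_endomorphism(2)[OF xy K] tE_endomorphism(3)[OF xy L] b_le_1[OF xy] by (auto simp: le_Suc_eq)

text \<open>The endomorphism \<open>G * F\<close> has equal diagonal entries and an off-diagonal
  product divisible by \<open>t\<close>, so its determinant is a unit once the \<open>(0, 0)\<close>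
  entry is one. Then \<open>H * G\<close> is a left inverse of \<open>F\<close>, and a two-sided one
  because the matrices are square.\<close>

lemma tE_local:
  assumes p: "x \<in> X" "y \<in> X" and q: "x' \<in> X" "y' \<in> X"
    and F: "F \<in> hom [x, y] [x', y']" and G: "G \<in> hom [x', y'] [x, y]"
    and DF: "snd (tE x' y') * F = F * snd (tE x y)" and DG: "snd (tE x y) * G = G * snd (tE x' y')"
    and nz: "\<not> t dvd (G * F) $$ (0, 0)"
  shows "tiso (tE x y) (tE x' y')"
proof -
  define K where "K = G * F"
  have Xp: "set [x, y] \<subseteq> X" and Xq: "set [x', y'] \<subseteq> X" using p q by simp_all
  have cF: "F \<in> carrier_mat 2 2" and cG: "G \<in> carrier_mat 2 2"
    using dhomD(1)[OF F] dhomD(1)[OF G] by (simp_all add: numeral_2_eq_2)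
  have cK: "K \<in> carrier_mat 2 2" using cF cG by (simp add: K_def)
  have hK: "K \<in> hom [x, y] [x, y]" unfolding K_def by (rule hom_mult[OF Xp Xq Xp G F])
  have DK: "snd (tE x y) * K = K * snd (tE x y)"
    unfolding K_def by (rule commute_mult[OF _ _ _ cF DF cG DG]) simp_all
  define r s s' where "r = K $$ (0, 0)" and "s = K $$ (0, 1)" and "s' = K $$ (1, 0)"
  have K11: "K $$ (1, 1) = r" using tE_endomorphism(1)[OF p cK DK] by (simp add: r_def)
  have Ke: "K $$ (0, 0) = r" "K $$ (0, Suc 0) = s" "K $$ (Suc 0, 0) = s'" "K $$ (Suc 0, Suc 0) = r"
    using K11 by (simp_all add: r_def s_def s'_def)
  have "t dvd s * s'" using tE_endomorphisms_dvd[OF p cK DK cK DK] by (simp add: s_def s'_def)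
  moreover have "\<not> t dvd r * r"
  proof -
    have "r dvd 1" using t_local[of r] nz by (auto simp: r_def K_def)
    then have "r * r dvd 1" using mult_dvd_mono[of r 1 r 1] by simp
    then show ?thesis using t_nonunit dvd_trans by blast
  qed
  ultimately have "\<not> t dvd r * r - s * s'" by (metis dvd_add_left_iff diff_add_cancel)
  then obtain w where w: "1 = (r * r - s * s') * w" using t_local[of "r * r - s * s'"] by (auto elim: dvdE)
  \<comment> \<open>The adjugate of \<open>K\<close> divided by its determinant. Its off-diagonal
    entries are multiples of those of \<open>K\<close> in the same positions and hence satisfy the
    same divisibility conditions.\<close>
  define H where "H = mat 2 2 (\<lambda>(i, j). w * (if i = j then r else if i = 0 then - s else - s'))"
  have cH: "H \<in> carrier_mat 2 2" by (simp add: H_def)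
  have hH: "H \<in> hom [x, y] [x, y]"
  proof (rule dhomI)
    fix i j assume "i < length [x, y]" "j < length [x, y]"
    then have "i = 0 \<and> j = 0 \<or> i = 0 \<and> j = 1 \<or> i = 1 \<and> j = 0 \<or> i = 1 \<and> j = 1" by auto
    then show "t ^ b ([x, y] ! j) ([x, y] ! i) dvd H $$ (i, j)"
      using dhomD(2)[OF hK, of 0 1] dhomD(2)[OF hK, of 1 0] b_refl p
      by (elim disjE conjE) (auto simp: H_def s_def s'_def)
  qed (use cH in \<open>simp add: numeral_2_eq_2\<close>)
  have HK: "H * K = 1\<^sub>m 2"
  proof (rule eq_matI)
    fix i j assume "i < dim_row (1\<^sub>m 2 :: 'r mat)" "j < dim_col (1\<^sub>m 2 :: 'r mat)"
    then have ij: "i < 2" "j < 2" by simp_all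
    then have "i = 0 \<and> j = 0 \<or> i = 0 \<and> j = 1 \<or> i = 1 \<and> j = 0 \<or> i = 1 \<and> j = 1" by auto
    moreover have "r * (r * w) - s * (s' * w) = 1"
      using w by (simp add: algebra_simps)
    ultimately show "(H * K) $$ (i, j) = 1\<^sub>m 2 $$ (i, j)"
      unfolding mult_entry2[OF cH cK ij]
      by (elim disjE conjE) (simp_all add: H_def Ke mult_ac)
  qed (use cH cK in auto)
  have 1: "H * G * F = 1\<^sub>m 2" using HK assoc_mult_mat[OF cH cG cF] by (simp add: K_def)
  have 2: "F * (H * G) = 1\<^sub>m 2"
    by (rule square_left_inverse_imp_right_inverse[OF cF _ 1]) (use cH cG in simp)
  show ?thesis
    unfolding tiso_def fst_tE
    using F hom_mult[OF Xq Xp Xp hH G] DF 1 2 by (auto simp: numeral_2_eq_2)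
qed

lemma tE_sum_entries:
  assumes "set ps \<subseteq> X \<times> X"
  shows "length (fst (MF_sum (map (\<lambda>(x, y). tE x y) ps))) = 2 * length ps"
    and "i < length ps \<Longrightarrow> s < 2 \<Longrightarrow>
      fst (MF_sum (map (\<lambda>(x, y). tE x y) ps)) ! (2 * i + s) = (if s = 0 then fst (ps ! i) else snd (ps ! i))"
    and "i < length ps \<Longrightarrow> s < 2 \<Longrightarrow> i' < length ps \<Longrightarrow> s' < 2 \<Longrightarrow>
      snd (MF_sum (map (\<lambda>(x, y). tE x y) ps)) $$ (2 * i + s, 2 * i' + s') =
        (if i = i' then snd (tE (fst (ps ! i)) (snd (ps ! i))) $$ (s, s') else 0)"
    and "mobj (MF_sum (map (\<lambda>(x, y). tE x y) ps))"
proof -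
  let ?S = "\<lambda>ps. MF_sum (map (\<lambda>(x, y). tE x y) ps)"
  have "length (fst (?S ps)) = 2 * length ps \<and> mobj (?S ps) \<and>
     (\<forall>i s. i < length ps \<longrightarrow> s < 2 \<longrightarrow> fst (?S ps) ! (2 * i + s) = (if s = 0 then fst (ps ! i) else snd (ps ! i))) \<and>
     (\<forall>i s i' s'. i < length ps \<longrightarrow> s < 2 \<longrightarrow> i' < length ps \<longrightarrow> s' < 2 \<longrightarrow>
       snd (?S ps) $$ (2 * i + s, 2 * i' + s') =
        (if i = i' then snd (tE (fst (ps ! i)) (snd (ps ! i))) $$ (s, s') else 0))"
    using assms
  proof (induction ps)
    case Nil
    then show ?case by (simp add: mobj_def)
  next
    case (Cons p ps)
    obtain x y where p: "p = (x, y)" by (cases p)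
    have xy: "x \<in> X" "y \<in> X" and ps: "set ps \<subseteq> X \<times> X" using Cons(2) p by auto
    have ob: "mobj A" if "A \<in> set (map (\<lambda>(x, y). tE x y) ps)" for A using that ps mobj_tE by auto
    have S: "?S (p # ps) = msum (tE x y) (?S ps)" and mS: "mobj (?S ps)"
      using MF_sum_Cons[OF mobj_tE[OF xy] ob, of "map (\<lambda>(x, y). tE x y) ps"] by (simp_all add: p)
    note IH = Cons(1)[OF ps]
    have cS: "snd (?S ps) \<in> carrier_mat (2 * length ps) (2 * length ps)" using mS IH by (simp add: mobj_def)
    show ?case
    proof (intro conjI allI impI)
      show "length (fst (?S (p # ps))) = 2 * length (p # ps)" unfolding S using IH by (simp add: msum_def)
      show "mobj (?S (p # ps))" unfolding S by (rule mobj_msum[OF mobj_tE[OF xy] mS])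
    next
      fix i s :: nat assume bd: "i < length (p # ps)" "s < 2"
      show "fst (?S (p # ps)) ! (2 * i + s) = (if s = 0 then fst ((p # ps) ! i) else snd ((p # ps) ! i))"
      proof (cases i)
        case 0
        then show ?thesis unfolding S using bd by (auto simp: msum_def p nth_append less_2_iff)
      next
        case (Suc k)
        then show ?thesis unfolding S using bd IH by (simp add: msum_def nth_append)
      qed
    next
      fix i s i' s' :: nat assume bd: "i < length (p # ps)" "s < 2" "i' < length (p # ps)" "s' < 2"
      have lt: "2 * i + s < 2 + 2 * length ps" "2 * i' + s' < 2 + 2 * length ps" using bd by auto
      have dims: "dim_row (snd (tE x y)) = 2" "dim_col (snd (tE x y)) = 2"
        by (simp_all add: carrier_matD[OF snd_tE_carrier])
      have "snd (?S (p # ps)) $$ (2 * i + s, 2 * i' + s') =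
        (if 2 * i + s < 2 then if 2 * i' + s' < 2 then snd (tE x y) $$ (2 * i + s, 2 * i' + s') else 0
         else if 2 * i' + s' < 2 then 0 else snd (?S ps) $$ (2 * i + s - 2, 2 * i' + s' - 2))"
        unfolding S using lt cS IH dims by (auto simp: msum_def)
      then show "snd (?S (p # ps)) $$ (2 * i + s, 2 * i' + s') =
        (if i = i' then snd (tE (fst ((p # ps) ! i)) (snd ((p # ps) ! i))) $$ (s, s') else 0)"
        using bd IH by (cases i; cases i') (simp_all add: p)
    qed
  qed
  then show "length (fst (?S ps)) = 2 * length ps"
    and "i < length ps \<Longrightarrow> s < 2 \<Longrightarrow> fst (?S ps) ! (2 * i + s) = (if s = 0 then fst (ps ! i) else snd (ps ! i))"
    and "i < length ps \<Longrightarrow> s < 2 \<Longrightarrow> i' < length ps \<Longrightarrow> s' < 2 \<Longrightarrow>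
      snd (?S ps) $$ (2 * i + s, 2 * i' + s') =
        (if i = i' then snd (tE (fst (ps ! i)) (snd (ps ! i))) $$ (s, s') else 0)"
    and "mobj (?S ps)"
    by blast+
qed

definition block :: "'r mat \<Rightarrow> nat \<Rightarrow> nat \<Rightarrow> 'r mat" where
  "block F j i = mat 2 2 (\<lambda>(u, s). F $$ (2 * j + u, 2 * i + s))"

lemma block_carrier [simp]: "block F j i \<in> carrier_mat 2 2"
  and block_entry: "u < 2 \<Longrightarrow> s < 2 \<Longrightarrow> block F j i $$ (u, s) = F $$ (2 * j + u, 2 * i + s)"
  by (simp_all add: block_def)

lemma block_sum:
  assumes G: "G \<in> carrier_mat (2 * l) (2 * m)" and F: "F \<in> carrier_mat (2 * m) (2 * n)"
    and "i' < l" "i < n" "u < 2" "s < 2"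
  shows "(G * F) $$ (2 * i' + u, 2 * i + s) = (\<Sum>j<m. (block G i' j * block F j i) $$ (u, s))"
proof -
  have "(G * F) $$ (2 * i' + u, 2 * i + s) = (\<Sum>k<2 * m. G $$ (2 * i' + u, k) * F $$ (k, 2 * i + s))"
    using assms by (intro mat_mult_entry[OF G F]) auto
  also have "\<dots> = (\<Sum>j<m. (block G i' j * block F j i) $$ (u, s))"
    unfolding sum_double using assms
    by (intro sum.cong) (simp_all add: mult_entry2[OF block_carrier block_carrier] block_entry del: index_mult_mat(1))
  finally show ?thesis .
qed

text \<open>Only the \<open>(0, 0)\<close> entries of blocks between copies of
  \<open>E(x, y)\<close> are kept, in \<open>\<Phi>\<close> and \<open>\<Gamma>\<close>. The
  equation \<open>G * F = 1\<close> becomes \<open>\<Gamma> * \<Phi> = 1\<close> modulo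
  \<open>t\<close>, and the rank inequality compares the numbers of copies. The assumption
  \<open>rep\<close> makes isomorphic summands have equal pairs, so that counting pairs counts
  isomorphism classes.\<close>

lemma sum_tE_count_le:
  assumes ps: "set ps \<subseteq> X \<times> X" and qs: "set qs \<subseteq> X \<times> X"
    and rep: "\<And>x y x' y'. (x, y) \<in> set ps \<Longrightarrow> (x', y') \<in> set qs \<Longrightarrow> tiso (tE x y) (tE x' y') \<Longrightarrow> (x, y) = (x', y')"
    and iso: "tiso (MF_sum (map (\<lambda>(x, y). tE x y) ps)) (MF_sum (map (\<lambda>(x, y). tE x y) qs))"
    and xy: "(x, y) \<in> set ps"
  shows "card {i. i < length ps \<and> ps ! i = (x, y)} \<le> card {j. j < length qs \<and> qs ! j = (x, y)}"
proof -
  let ?S = "\<lambda>ps. MF_sum (map (\<lambda>(x, y). tE x y) ps)" and ?n = "length ps" and ?m = "length qs"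
  let ?D = "\<lambda>p. snd (tE (fst p) (snd p))"
  have Xxy: "x \<in> X" "y \<in> X" using ps xy by auto
  obtain F G where F: "F \<in> hom (fst (?S ps)) (fst (?S qs))" and G: "G \<in> hom (fst (?S qs)) (fst (?S ps))"
    and NF: "snd (?S qs) * F = F * snd (?S ps)" and GF: "G * F = 1\<^sub>m (2 * ?n)" and FG: "F * G = 1\<^sub>m (2 * ?m)"
    using iso tE_sum_entries(1)[OF ps] tE_sum_entries(1)[OF qs] by (auto simp: tiso_def)
  note Ep = tE_sum_entries[OF ps] and Eq = tE_sum_entries[OF qs]
  have cF: "F \<in> carrier_mat (2 * ?m) (2 * ?n)" and cG: "G \<in> carrier_mat (2 * ?n) (2 * ?m)"
    using dhomD(1)[OF F] dhomD(1)[OF G] Ep(1) Eq(1) by simp_all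
  have cp: "snd (?S ps) \<in> carrier_mat (2 * ?n) (2 * ?n)" and cq: "snd (?S qs) \<in> carrier_mat (2 * ?m) (2 * ?m)"
    using Ep(1,4) Eq(1,4) by (simp_all add: mobj_def)
  have NG: "snd (?S ps) * G = G * snd (?S qs)"
    by (rule left_inverse_commutes[OF cp cq cF cG NF GF FG])
  \<comment> \<open>Both differentials are block diagonal, so each block of a morphism is itself a
    morphism between two summands. The lists are generic because the fact is applied to
    \<open>F\<close> and, with the roles exchanged, to \<open>G\<close>.\<close>
  have comm: "?D (qs' ! j) * block H j i = block H j i * ?D (ps' ! i)"
    if H: "H \<in> carrier_mat (2 * length qs') (2 * length ps')" and NH: "snd (?S qs') * H = H * snd (?S ps')"
      and i: "i < length ps'" and j: "j < length qs'"
      and P: "set ps' \<subseteq> X \<times> X" and Q: "set qs' \<subseteq> X \<times> X"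
    for H i j ps' qs'
  proof (rule eq_matI)
    note Ep = tE_sum_entries[OF P] and Eq = tE_sum_entries[OF Q]
    have cp: "snd (?S ps') \<in> carrier_mat (2 * length ps') (2 * length ps')"
      and cq: "snd (?S qs') \<in> carrier_mat (2 * length qs') (2 * length qs')"
      using Ep(1,4) Eq(1,4) by (simp_all add: mobj_def)
    fix u s assume "u < dim_row (block H j i * ?D (ps' ! i))" "s < dim_col (block H j i * ?D (ps' ! i))"
    then have us: "u < 2" "s < 2"
      using carrier_matD[OF block_carrier[of H j i]] carrier_matD[OF snd_tE_carrier[of "fst (ps' ! i)" "snd (ps' ! i)"]] by auto
    have bp: "block (snd (?S ps')) k i = (if k = i then ?D (ps' ! i) else 0\<^sub>m 2 2)" if "k < length ps'" for k
      using that i carrier_matD[OF snd_tE_carrier] by (intro eq_matI) (auto simp: block_def Ep(3))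
    have bq: "block (snd (?S qs')) j k = (if j = k then ?D (qs' ! j) else 0\<^sub>m 2 2)" if "k < length qs'" for k
      using that j carrier_matD[OF snd_tE_carrier] by (intro eq_matI) (auto simp: block_def Eq(3))
    have z: "0\<^sub>m 2 2 * block A k l = 0\<^sub>m 2 2" "block A k l * 0\<^sub>m 2 2 = 0\<^sub>m 2 2" for A k l
      using left_mult_zero_mat[OF block_carrier] right_mult_zero_mat[OF block_carrier] by auto
    have "(?D (qs' ! j) * block H j i) $$ (u, s) =
        (\<Sum>k<length qs'. (block (snd (?S qs')) j k * block H k i) $$ (u, s))"
    proof -
      have "(block (snd (?S qs')) j k * block H k i) $$ (u, s)
        = (if k = j then (?D (qs' ! j) * block H j i) $$ (u, s) else 0)" if "k < length qs'" for k
        unfolding bq[OF that] using us by (auto simp: z simp del: index_mult_mat(1))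
      then show ?thesis using j by simp
    qed
    also have "\<dots> = (\<Sum>k<length ps'. (block H j k * block (snd (?S ps')) k i) $$ (u, s))"
      using block_sum[OF cq H j i us] block_sum[OF H cp j i us] NH by simp
    also have "\<dots> = (block H j i * ?D (ps' ! i)) $$ (u, s)"
    proof -
      have "(block H j k * block (snd (?S ps')) k i) $$ (u, s)
        = (if k = i then (block H j i * ?D (ps' ! i)) $$ (u, s) else 0)" if "k < length ps'" for k
        unfolding bp[OF that] using us by (auto simp: z simp del: index_mult_mat(1))
      then show ?thesis using i by simp
    qed
    finally show "(?D (qs' ! j) * block H j i) $$ (u, s) = (block H j i * ?D (ps' ! i)) $$ (u, s)" .
  qed (use carrier_matD[OF block_carrier] carrier_matD[OF snd_tE_carrier] in auto)
  have hF: "block F j i \<in> hom [fst (ps ! i), snd (ps ! i)] [fst (qs ! j), snd (qs ! j)]" if "i < ?n" "j < ?m" for i j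
  proof (rule dhomI)
    fix u s assume "u < length [fst (qs ! j), snd (qs ! j)]" "s < length [fst (ps ! i), snd (ps ! i)]"
    then have us: "u < 2" "s < 2" by auto
    have "2 * j + u < length (fst (?S qs))" "2 * i + s < length (fst (?S ps))"
      using us that Ep(1) Eq(1) by auto
    from dhomD(2)[OF F this] show "t ^ b ([fst (ps ! i), snd (ps ! i)] ! s) ([fst (qs ! j), snd (qs ! j)] ! u) dvd block F j i $$ (u, s)"
      unfolding block_entry[OF us] Ep(2)[OF that(1) us(2)] Eq(2)[OF that(2) us(1)]
      using us by (auto simp: less_2_iff)
  qed (use block_carrier in \<open>simp add: numeral_2_eq_2\<close>)
  have hG: "block G i j \<in> hom [fst (qs ! j), snd (qs ! j)] [fst (ps ! i), snd (ps ! i)]" if "i < ?n" "j < ?m" for i j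
  proof (rule dhomI)
    fix s u assume "u < length [fst (qs ! j), snd (qs ! j)]" "s < length [fst (ps ! i), snd (ps ! i)]"
    then have us: "u < 2" "s < 2" by auto
    have "2 * j + u < length (fst (?S qs))" "2 * i + s < length (fst (?S ps))"
      using us that Ep(1) Eq(1) by auto
    from dhomD(2)[OF G this(2,1)] show "t ^ b ([fst (qs ! j), snd (qs ! j)] ! u) ([fst (ps ! i), snd (ps ! i)] ! s) dvd block G i j $$ (s, u)"
      unfolding block_entry[OF us(2,1)] Ep(2)[OF that(1) us(2)] Eq(2)[OF that(2) us(1)]
      using us by (auto simp: less_2_iff)
  qed (use block_carrier in \<open>simp add: numeral_2_eq_2\<close>)
  let ?I = "{i. i < ?n \<and> ps ! i = (x, y)}" and ?J = "{j. j < ?m \<and> qs ! j = (x, y)}"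
  obtain hI where hI: "bij_betw hI {0..<card ?I} ?I" using ex_bij_betw_nat_finite[of ?I] by auto
  obtain hJ where hJ: "bij_betw hJ {0..<card ?J} ?J" using ex_bij_betw_nat_finite[of ?J] by auto
  have I: "hI i < ?n" "ps ! hI i = (x, y)" if "i < card ?I" for i using bij_betwE[OF hI] that by auto
  define \<Phi> where "\<Phi> = mat (card ?J) (card ?I) (\<lambda>(j, i). block F (hJ j) (hI i) $$ (0, 0))"
  define \<Gamma> where "\<Gamma> = mat (card ?I) (card ?J) (\<lambda>(i, j). block G (hI i) (hJ j) $$ (0, 0))"
  have c: "\<Phi> \<in> carrier_mat (card ?J) (card ?I)" "\<Gamma> \<in> carrier_mat (card ?I) (card ?J)"
    by (simp_all add: \<Phi>_def \<Gamma>_def)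
  show ?thesis
  proof (rule left_invertible_mod_imp_le[OF c(2,1) t_nonunit])
    fix k' k assume k: "k' < card ?I" "k < card ?I"
    define i' i where "i' = hI k'" and "i = hI k"
    have i: "i < ?n" "ps ! i = (x, y)" "i' < ?n" "ps ! i' = (x, y)" using I k by (auto simp: i_def i'_def)
    let ?p = "\<lambda>j. (block G i' j * block F j i) $$ (0, 0)"
    let ?q = "\<lambda>j. block G i' j $$ (0, 0) * block F j i $$ (0, 0)"
    have one: "(\<Sum>j<?m. ?p j) = 1\<^sub>m (card ?I) $$ (k', k)"
    proof -
      have "(\<Sum>j<?m. ?p j) = (G * F) $$ (2 * i' + 0, 2 * i + 0)"
        by (rule block_sum[OF cG cF, symmetric]) (use i in auto)
      also have "\<dots> = (if i' = i then 1 else 0)" using i unfolding GF by auto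
      also have "i' = i \<longleftrightarrow> k' = k"
        using hI k unfolding i'_def i_def bij_betw_def inj_on_def by auto
      finally show ?thesis using k by simp
    qed
    have "(\<Gamma> * \<Phi>) $$ (k', k) = (\<Sum>j<card ?J. ?q (hJ j))"
      unfolding mat_mult_entry[OF c(2,1) k] using k by (intro sum.cong) (auto simp: \<Gamma>_def \<Phi>_def i'_def i_def)
    also have "\<dots> = (\<Sum>j\<in>?J. ?q j)"
      using sum.reindex_bij_betw[OF hJ, of ?q] by (simp add: lessThan_atLeast0)
    finally have "1\<^sub>m (card ?I) $$ (k', k) - (\<Gamma> * \<Phi>) $$ (k', k) = (\<Sum>j\<in>?J. ?p j - ?q j) + (\<Sum>j\<in>{..<?m} - ?J. ?p j)"
      unfolding one[symmetric] by (subst sum.subset_diff[of ?J]) (auto simp: sum_subtractf)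
    moreover have "t dvd ?p j - ?q j" if "j \<in> ?J" for j
    proof -
      have j: "j < ?m" "qs ! j = (x, y)" using that by auto
      have "snd (tE x y) * block F j i = block F j i * snd (tE x y)"
        using comm[OF cF NF i(1) j(1) ps qs] i j by simp
      moreover have "snd (tE x y) * block G i' j = block G i' j * snd (tE x y)"
        using comm[OF cG NG j(1) i(3) qs ps] i j by simp
      ultimately have "t dvd block G i' j $$ (0, 1) * block F j i $$ (1, 0)"
        using tE_endomorphisms_dvd[OF Xxy] by simp
      then show ?thesis
        by (simp add: mult_entry2[OF block_carrier block_carrier] del: index_mult_mat(1))
    qed
    \<comment> \<open>Otherwise \<open>E(x, y)\<close> would be isomorphic to a summand with a
      different pair, against \<open>rep\<close>.\<close>
    moreover have "t dvd ?p j" if "j \<in> {..<?m} - ?J" for j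
    proof (rule ccontr)
      assume nd: "\<not> t dvd ?p j"
      obtain x' y' where q: "qs ! j = (x', y')" by (cases "qs ! j")
      have j: "j < ?m" "(x', y') \<noteq> (x, y)" "(x', y') \<in> set qs" using that q by (auto simp: in_set_conv_nth)
      have X': "x' \<in> X" "y' \<in> X" using qs j(3) by auto
      have "tiso (tE x y) (tE x' y')"
      proof (rule tE_local[OF Xxy X' _ _ _ _ nd])
        show "block F j i \<in> hom [x, y] [x', y']" using hF[OF i(1) j(1)] i q by simp
        show "block G i' j \<in> hom [x', y'] [x, y]" using hG[OF i(3) j(1)] i q by simp
        show "snd (tE x' y') * block F j i = block F j i * snd (tE x y)"
          using comm[OF cF NF i(1) j(1) ps qs] i q by simp
        show "snd (tE x y) * block G i' j = block G i' j * snd (tE x' y')"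
          using comm[OF cG NG j(1) i(3) qs ps] i q by simp
      qed
      then show False using rep[OF xy j(3)] j(2) by simp
    qed
    ultimately have "t dvd 1\<^sub>m (card ?I) $$ (k', k) - (\<Gamma> * \<Phi>) $$ (k', k)"
      by (auto intro!: dvd_add dvd_sum)
    then show "t dvd (\<Gamma> * \<Phi>) $$ (k', k) - 1\<^sub>m (card ?I) $$ (k', k)"
      using dvd_minus_iff[of t "1\<^sub>m (card ?I) $$ (k', k) - (\<Gamma> * \<Phi>) $$ (k', k)"] by simp
  qed
qed

lemma tiso_MF_sum:
  assumes "list_all2 tiso As Bs" "\<And>A. A \<in> set As \<Longrightarrow> mobj A" "\<And>B. B \<in> set Bs \<Longrightarrow> mobj B"
  shows "tiso (MF_sum As) (MF_sum Bs)"
  using assms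
proof (induction rule: list_all2_induct)
  case Nil
  then show ?case using tiso_refl[of "([], 0\<^sub>m 0 0)"] by (simp add: mobj_def)
next
  case (Cons A As B Bs)
  then show ?case using MF_sum_Cons[of A As] MF_sum_Cons[of B Bs] tiso_msum by simp
qed

text \<open>The pair \<open>rep B\<close> is chosen by a predicate that depends on the isomorphism
  class of \<open>B\<close> only, so isomorphic objects receive equal pairs and conversely. The
  counting inequality in both directions makes the multisets of pairs equal, and equal multisets
  differ by a permutation.\<close>

lemma Krull_Schmidt:
  assumes Bs: "\<And>B. B \<in> set Bs \<Longrightarrow> MFphi_indecomposable B"
    and Cs: "\<And>C. C \<in> set Cs \<Longrightarrow> MFphi_indecomposable C"
    and A: "mobj A" "MF_iso c t A (MF_sum Bs)" "MF_iso c t A (MF_sum Cs)"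
  shows "\<exists>p. bij_betw p {..<length Bs} {..<length Cs} \<and> (\<forall>i<length Bs. MF_iso c t (Bs ! i) (Cs ! p i))"
proof -
  let ?tE = "\<lambda>(x, y). tE x y"
  define rep where "rep B = (SOME q. q \<in> X \<times> X \<and> tiso (tw B) (?tE q))" for B
  have mI: "mobj B" if "MFphi_indecomposable B" for B
    using that by (simp add: MF_indecomposable_def MF_phi_iff)
  have rep: "rep B \<in> X \<times> X" "tiso (tw B) (?tE (rep B))" if B: "MFphi_indecomposable B" for B
  proof -
    obtain x y where "x \<in> X" "y \<in> X" "tiso (tw B) (tE x y)" using indecomposable_imp_E[OF B] by blast
    then have "\<exists>q. q \<in> X \<times> X \<and> tiso (tw B) (?tE q)" by (intro exI[of _ "(x, y)"]) simp
    from someI_ex[OF this] show "rep B \<in> X \<times> X" "tiso (tw B) (?tE (rep B))" by (simp_all add: rep_def)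
  qed
  have mE: "mobj (?tE q)" if "q \<in> X \<times> X" for q using that mobj_tE by auto
  have rep_eq: "rep B = rep C" if B: "mobj B" and C: "mobj C" and BC: "tiso (tw B) (tw C)" for B C
  proof -
    have "tiso (tw B) (?tE q) \<longleftrightarrow> tiso (tw C) (?tE q)" if "q \<in> X \<times> X" for q
      using tiso_trans[OF mobj_tw[OF B] mobj_tw[OF C] mE[OF that] BC]
        tiso_trans[OF mobj_tw[OF C] mobj_tw[OF B] mE[OF that] tiso_sym[OF mobj_tw[OF B] mobj_tw[OF C] BC]] by blast
    then have "(\<lambda>q. q \<in> X \<times> X \<and> tiso (tw B) (?tE q)) = (\<lambda>q. q \<in> X \<times> X \<and> tiso (tw C) (?tE q))" by blast
    then show ?thesis by (simp add: rep_def)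
  qed
  have via: "tiso (tw B) (tw C)" if B: "MFphi_indecomposable B"
    and C: "MFphi_indecomposable C" and BC: "tiso (?tE (rep B)) (?tE (rep C))" for B C
  proof -
    note m = mobj_tw[OF mI[OF B]] mobj_tw[OF mI[OF C]] mE[OF rep(1)[OF B]] mE[OF rep(1)[OF C]]
    have "tiso (tw B) (?tE (rep C))" by (rule tiso_trans[OF m(1,3,4) rep(2)[OF B] BC])
    then show ?thesis using tiso_trans[OF m(1,4,2) _ tiso_sym[OF m(2,4) rep(2)[OF C]]] by blast
  qed
  have sub: "set (map rep Ds) \<subseteq> X \<times> X"
    if Ds: "\<And>B. B \<in> set Ds \<Longrightarrow> MFphi_indecomposable B" for Ds
    using rep(1)[OF Ds] by (simp add: image_subset_iff)
  have sum: "mobj (MF_sum Ds) \<and> tiso (tw (MF_sum Ds)) (MF_sum (map ?tE (map rep Ds)))"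
    if Ds: "\<And>B. B \<in> set Ds \<Longrightarrow> MFphi_indecomposable B" for Ds
  proof
    have m: "mobj B" if "B \<in> set Ds" for B using mI Ds that by blast
    show "mobj (MF_sum Ds)"
      using MF_sum_Cons(2)[of "MF_zero" Ds] mobj_zero m by blast
    have "list_all2 tiso (map tw Ds) (map ?tE (map rep Ds))"
      using rep(2)[OF Ds] by (simp add: list_all2_conv_all_nth)
    then have "tiso (MF_sum (map tw Ds)) (MF_sum (map ?tE (map rep Ds)))"
    proof (rule tiso_MF_sum)
      show "mobj A" if "A \<in> set (map tw Ds)" for A using that m mobj_tw by auto
      show "mobj A" if A: "A \<in> set (map ?tE (map rep Ds))" for A
      proof -
        obtain q where q: "q \<in> set (map rep Ds)" "A = ?tE q"
          using A unfolding set_map[of ?tE] by blast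
        have "q \<in> X \<times> X" by (rule subsetD[OF sub q(1)]) (rule Ds)
        then show ?thesis unfolding q(2) by (rule mE)
      qed
    qed
    then show "tiso (tw (MF_sum Ds)) (MF_sum (map ?tE (map rep Ds)))" using tw_MF_sum m by simp
  qed
  have le: "card {i. i < length Ds \<and> map rep Ds ! i = q} \<le> card {i. i < length Ds' \<and> map rep Ds' ! i = q}"
    if Ds: "\<And>B. B \<in> set Ds \<Longrightarrow> MFphi_indecomposable B"
      and Ds': "\<And>B. B \<in> set Ds' \<Longrightarrow> MFphi_indecomposable B"
      and D: "MF_iso c t A (MF_sum Ds)" and D': "MF_iso c t A (MF_sum Ds')" for Ds Ds' q
  proof (cases "q \<in> set (map rep Ds)")
    case False
    then have "{i. i < length Ds \<and> map rep Ds ! i = q} = {}" by auto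
    then show ?thesis by (simp only: card.empty)
  next
    case True
    let ?S = "\<lambda>Ds. MF_sum (map ?tE (map rep Ds))"
    note m = mobj_tw[OF A(1)] mobj_tw[OF conjunct1[OF sum[OF Ds]]] mobj_tw[OF conjunct1[OF sum[OF Ds']]]
      tE_sum_entries(4)[OF sub[OF Ds]] tE_sum_entries(4)[OF sub[OF Ds']]
    have "tiso (tw A) (tw (MF_sum Ds))" "tiso (tw A) (tw (MF_sum Ds'))"
      using D D' MF_iso_iff A(1) sum[OF Ds] sum[OF Ds'] by auto
    then have "tiso (tw A) (?S Ds)" "tiso (tw A) (?S Ds')"
      using tiso_trans[OF m(1,2,4)] tiso_trans[OF m(1,3,5)] sum[OF Ds] sum[OF Ds'] by blast+
    then have iso: "tiso (?S Ds) (?S Ds')" using tiso_trans[OF m(4,1,5)] tiso_sym[OF m(1,4)] by blast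
    obtain x y where q: "q = (x, y)" by (cases q)
    have "card {i. i < length (map rep Ds) \<and> map rep Ds ! i = (x, y)}
      \<le> card {j. j < length (map rep Ds') \<and> map rep Ds' ! j = (x, y)}"
    proof (rule sum_tE_count_le[OF sub[OF Ds] sub[OF Ds'] _ iso])
      show "(x, y) \<in> set (map rep Ds)" using True q by simp
      fix u v u' v' assume uv: "(u, v) \<in> set (map rep Ds)" "(u', v') \<in> set (map rep Ds')"
        and "tiso (tE u v) (tE u' v')"
      obtain B C where B: "B \<in> set Ds" "rep B = (u, v)" and C: "C \<in> set Ds'" "rep C = (u', v')"
        using uv by auto
      have "tiso (tw B) (tw C)"
        by (rule via[OF Ds[OF B(1)] Ds'[OF C(1)]]) (use B C \<open>tiso (tE u v) (tE u' v')\<close> in simp)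
      then have "rep B = rep C" using rep_eq mI Ds[OF B(1)] Ds'[OF C(1)] by blast
      then show "(u, v) = (u', v')" using B C by simp
    qed
    then show ?thesis by (simp add: q)
  qed
  have "mset (map rep Bs) = mset (map rep Cs)"
  proof (rule multiset_eqI)
    fix q
    have cnt: "count (mset xs) q = card {i. i < length xs \<and> xs ! i = q}" for xs :: "('x \<times> 'x) list"
      by (simp add: count_mset count_list_eq_length_filter length_filter_conv_card eq_commute)
    show "count (mset (map rep Bs)) q = count (mset (map rep Cs)) q"
      unfolding cnt using le[OF Bs Cs A(2,3), of q] le[OF Cs Bs A(3,2), of q] by simp
  qed
  then obtain p where p: "bij_betw p {..<length Bs} {..<length Cs}"
    "\<And>i. i < length Bs \<Longrightarrow> map rep Bs ! i = map rep Cs ! p i"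
    using permutation_Ex_bij[of "map rep Bs" "map rep Cs"] by auto
  have "MF_iso c t (Bs ! i) (Cs ! p i)" if i: "i < length Bs" for i
  proof -
    have pi: "p i < length Cs" using bij_betwE[OF p(1)] i by auto
    have B: "MFphi_indecomposable (Bs ! i)" and C: "MFphi_indecomposable (Cs ! p i)"
      using Bs Cs i pi by auto
    have "rep (Bs ! i) = rep (Cs ! p i)" using p(2)[OF i] i pi by simp
    then have "tiso (tw (Bs ! i)) (tw (Cs ! p i))"
      using via[OF B C] tiso_refl[OF mE[OF rep(1)[OF C]]] by simp
    then show ?thesis using MF_iso_iff[OF mI[OF B] mI[OF C]] by simp
  qed
  then show ?thesis using p(1) by blast
qed

section \<open>Projective and injective objects\<close>

text \<open>Column \<open>j\<close> of \<open>snd C * k = k * snd (tE x y)\<close> forces the other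
  column: it is the differential applied to column \<open>j\<close>, divided by the entry
  \<open>d\<close>. The assumption \<open>cond\<close> ensures that the quotient exists with the
  required divisibility, and the remaining column of the equation holds because the differential
  squares to \<open>t\<close>.\<close>

lemma extend_from_column:
  assumes xy: "x \<in> X" "y \<in> X" and C: "C \<in> MFt" and f: "f \<in> hom [x, y] (fst C)" and j: "j < 2"
    and cond: "\<And>z. z \<in> X \<Longrightarrow> (if j = 0 then b y z + b x y \<le> e x z else b x z + (1 - b x y) \<le> e y z)"
  shows "\<exists>k\<in>hom [x, y] (fst C). snd C * k = k * snd (tE x y) \<and> (\<forall>i<length (fst C). k $$ (i, j) = f $$ (i, j))"
proof -
  obtain zs N where C_eq: "C = (zs, N)" by (cases C)
  define n where "n = length zs"
  have X: "set zs \<subseteq> X" and Ne: "N \<in> dhom t e zs zs" and NN: "N * N = t \<cdot>\<^sub>m 1\<^sub>m n"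
    using C by (auto simp: C_eq MFt_def n_def)
  have Xxy: "set [x, y] \<subseteq> X" using xy by simp
  have cN: "N \<in> carrier_mat n n" and cf: "f \<in> carrier_mat n 2" using dhomD(1)[OF Ne] dhomD(1)[OF f]
    by (simp_all add: n_def C_eq numeral_2_eq_2)
  let ?D = "snd (tE x y)"
  \<comment> \<open>\<open>d\<close> is the nonzero entry of \<open>?D\<close> in column
    \<open>j\<close>, and \<open>d'\<close> the one in the other column.\<close>
  define d where "d = (if j = 0 then t ^ b x y else t ^ (1 - b x y))"
  define d' where "d' = (if j = 0 then t ^ (1 - b x y) else t ^ b x y)"
  have d0: "d \<noteq> 0" using t_nonzero by (simp add: d_def)
  have dd: "d * d' = t" using b_le_1[OF xy] by (simp add: d_def d'_def power_add[symmetric])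
  have hNf: "N * f \<in> dhom t e [x, y] zs"
    by (rule e_hom_mult[OF Xxy X X Ne]) (use f in \<open>simp add: C_eq\<close>)
  have "\<exists>w. (N * f) $$ (i, j) = d * w \<and> t ^ b ([x, y] ! (1 - j)) (zs ! i) dvd w" if i: "i < n" for i
  proof -
    have zi: "zs ! i \<in> X" using X i by (simp add: n_def subset_iff)
    have "t ^ b ([x, y] ! (1 - j)) (zs ! i) * d dvd t ^ e ([x, y] ! j) (zs ! i)"
      using cond[OF zi] j by (auto simp: less_2_iff d_def power_add[symmetric] intro!: le_imp_power_dvd)
    also have "\<dots> dvd (N * f) $$ (i, j)" using dhomD(2)[OF hNf, of i j] i j by (simp add: n_def)
    finally obtain q where "(N * f) $$ (i, j) = t ^ b ([x, y] ! (1 - j)) (zs ! i) * d * q" by (rule dvdE)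
    then show ?thesis by (intro exI[of _ "t ^ b ([x, y] ! (1 - j)) (zs ! i) * q"]) (simp add: mult_ac)
  qed
  then obtain w where w: "\<And>i. i < n \<Longrightarrow> (N * f) $$ (i, j) = d * w i"
    "\<And>i. i < n \<Longrightarrow> t ^ b ([x, y] ! (1 - j)) (zs ! i) dvd w i" by metis
  define k where "k = mat n 2 (\<lambda>(i, s). if s = j then f $$ (i, j) else w i)"
  have ck: "k \<in> carrier_mat n 2" by (simp add: k_def)
  have hk: "k \<in> hom [x, y] zs"
  proof (rule dhomI)
    fix i s assume "i < length zs" "s < length [x, y]"
    then show "t ^ b ([x, y] ! s) (zs ! i) dvd k $$ (i, s)"
      using dhomD(2)[OF f, of i s] w(2)[of i] j by (auto simp: k_def n_def C_eq less_2_iff less_Suc_eq)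
  qed (use ck in \<open>simp add: n_def numeral_2_eq_2\<close>)
  have eq: "N * k = k * ?D"
  proof (rule eq_matI)
    fix i s assume "i < dim_row (k * ?D)" "s < dim_col (k * ?D)"
    then have bd: "i < n" "s < 2" using ck carrier_matD[OF snd_tE_carrier] by auto
    have "d * (\<Sum>l<n. N $$ (i, l) * w l) = (\<Sum>l<n. N $$ (i, l) * (N * f) $$ (l, j))"
      unfolding sum_distrib_left using w by (intro sum.cong) (auto simp: mult_ac)
    also have "\<dots> = (N * (N * f)) $$ (i, j)"
      using cN cf bd j by (intro mat_mult_entry[OF cN _ bd(1) j, symmetric]) auto
    also have "N * (N * f) = t \<cdot>\<^sub>m f"
      using assoc_mult_mat[OF cN cN cf] NN mult_smult_assoc_mat[of "1\<^sub>m n" n n f 2 t] cf by simp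
    also have "(t \<cdot>\<^sub>m f) $$ (i, j) = d * (d' * f $$ (i, j))" using cf bd j dd by (simp add: mult.assoc[symmetric])
    finally have Nw: "(\<Sum>l<n. N $$ (i, l) * w l) = d' * f $$ (i, j)" using d0 by simp
    have Nf: "(\<Sum>l<n. N $$ (i, l) * f $$ (l, j)) = d * w i"
      using w(1)[OF bd(1)] mat_mult_entry[OF cN cf bd(1) j] by simp
    show "(N * k) $$ (i, s) = (k * ?D) $$ (i, s)"
      unfolding mat_mult_entry[OF cN ck bd] mult_entry2[OF ck snd_tE_carrier bd]
      using j bd Nw Nf by (auto simp: less_2_iff k_def d_def d'_def mult.commute)
  qed (use cN ck carrier_matD[OF snd_tE_carrier] in auto)
  show ?thesis
    using hk eq j by (intro bexI[of _ k]) (auto simp: C_eq k_def n_def)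
qed

lemma determined_by_column:
  assumes N: "N \<in> carrier_mat n n" and k: "k \<in> carrier_mat n 2" "N * k = k * snd (tE x y)"
    and k': "k' \<in> carrier_mat n 2" "N * k' = k' * snd (tE x y)"
    and j: "j < 2" "\<And>i. i < n \<Longrightarrow> k $$ (i, j) = k' $$ (i, j)"
  shows "k = k'"
proof (rule eq_matI)
  fix i s assume "i < dim_row k'" "s < dim_col k'"
  then have bd: "i < n" "s < 2" using k' by auto
  have "(N * k) $$ (i, j) = (N * k') $$ (i, j)"
    unfolding mat_mult_entry[OF N k(1) bd(1) j(1)] mat_mult_entry[OF N k'(1) bd(1) j(1)] using j by simp
  then have "k $$ (i, 1 - j) = k' $$ (i, 1 - j)"
    unfolding k(2) k'(2) mult_entry2[OF k(1) snd_tE_carrier bd(1) j(1)] mult_entry2[OF k'(1) snd_tE_carrier bd(1) j(1)]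
    using j(1) t_nonzero by (auto simp: less_2_iff)
  then show "k $$ (i, s) = k' $$ (i, s)" using j bd by (auto simp: less_2_iff)
qed (use k k' in auto)

text \<open>Dual to the extension from a column: row \<open>j\<close> of the equation gives the
  other row as row \<open>j\<close> of \<open>f * N\<close> divided by the nonzero entry of
  \<open>?D\<close> in row \<open>j\<close>.\<close>

lemma extend_from_row:
  assumes xy: "x \<in> X" "y \<in> X" and C: "C \<in> MFt" and f: "f \<in> hom (fst C) [x, y]" and j: "j < 2"
    and cond: "\<And>z. z \<in> X \<Longrightarrow> (if j = 0 then b z y + (1 - b x y) \<le> e z x else b z x + b x y \<le> e z y)"
  shows "\<exists>k\<in>hom (fst C) [x, y]. snd (tE x y) * k = k * snd C \<and> (\<forall>i<length (fst C). k $$ (j, i) = f $$ (j, i))"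
proof -
  obtain zs N where C_eq: "C = (zs, N)" by (cases C)
  define n where "n = length zs"
  have X: "set zs \<subseteq> X" and Ne: "N \<in> dhom t e zs zs" and NN: "N * N = t \<cdot>\<^sub>m 1\<^sub>m n"
    using C by (auto simp: C_eq MFt_def n_def)
  have Xxy: "set [x, y] \<subseteq> X" using xy by simp
  have cN: "N \<in> carrier_mat n n" and cf: "f \<in> carrier_mat 2 n" using dhomD(1)[OF Ne] dhomD(1)[OF f]
    by (simp_all add: n_def C_eq numeral_2_eq_2)
  let ?D = "snd (tE x y)"
  define d where "d = (if j = 0 then t ^ (1 - b x y) else t ^ b x y)"
  define d' where "d' = (if j = 0 then t ^ b x y else t ^ (1 - b x y))"
  have d0: "d \<noteq> 0" using t_nonzero by (simp add: d_def)
  have dd: "d * d' = t" using b_le_1[OF xy] by (simp add: d_def d'_def power_add[symmetric])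
  have hfN: "f * N \<in> dhom t e zs [x, y]"
    by (rule hom_e_mult[OF X X Xxy _ Ne]) (use f in \<open>simp add: C_eq\<close>)
  have "\<exists>w. (f * N) $$ (j, i) = d * w \<and> t ^ b (zs ! i) ([x, y] ! (1 - j)) dvd w" if i: "i < n" for i
  proof -
    have zi: "zs ! i \<in> X" using X i by (simp add: n_def subset_iff)
    have "t ^ b (zs ! i) ([x, y] ! (1 - j)) * d dvd t ^ e (zs ! i) ([x, y] ! j)"
      using cond[OF zi] j by (auto simp: less_2_iff d_def power_add[symmetric] intro!: le_imp_power_dvd)
    also have "\<dots> dvd (f * N) $$ (j, i)" using dhomD(2)[OF hfN, of j i] i j by (simp add: n_def)
    finally obtain q where "(f * N) $$ (j, i) = t ^ b (zs ! i) ([x, y] ! (1 - j)) * d * q" by (rule dvdE)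
    then show ?thesis by (intro exI[of _ "t ^ b (zs ! i) ([x, y] ! (1 - j)) * q"]) (simp add: mult_ac)
  qed
  then obtain w where w: "\<And>i. i < n \<Longrightarrow> (f * N) $$ (j, i) = d * w i"
    "\<And>i. i < n \<Longrightarrow> t ^ b (zs ! i) ([x, y] ! (1 - j)) dvd w i" by metis
  define k where "k = mat 2 n (\<lambda>(s, i). if s = j then f $$ (j, i) else w i)"
  have ck: "k \<in> carrier_mat 2 n" by (simp add: k_def)
  have hk: "k \<in> hom zs [x, y]"
  proof (rule dhomI)
    fix s i assume "s < length [x, y]" "i < length zs"
    then show "t ^ b (zs ! i) ([x, y] ! s) dvd k $$ (s, i)"
      using dhomD(2)[OF f, of s i] w(2)[of i] j by (auto simp: k_def n_def C_eq less_2_iff less_Suc_eq)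
  qed (use ck in \<open>simp add: n_def numeral_2_eq_2\<close>)
  have eq: "?D * k = k * N"
  proof (rule eq_matI)
    fix s i assume "s < dim_row (k * N)" "i < dim_col (k * N)"
    then have si: "s < 2" "i < n" using ck cN by auto
    have "d * (\<Sum>l<n. w l * N $$ (l, i)) = (\<Sum>l<n. (f * N) $$ (j, l) * N $$ (l, i))"
      unfolding sum_distrib_left using w by (intro sum.cong) (auto simp: mult_ac)
    also have "\<dots> = (f * N * N) $$ (j, i)"
      using cN cf si j by (intro mat_mult_entry[OF _ cN j si(2), symmetric]) auto
    also have "f * N * N = t \<cdot>\<^sub>m f"
      using assoc_mult_mat[OF cf cN cN] NN mult_smult_distrib[OF cf, of "1\<^sub>m n" n t] cf by simp
    also have "(t \<cdot>\<^sub>m f) $$ (j, i) = d * (d' * f $$ (j, i))" using cf si j dd by (simp add: mult.assoc[symmetric])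
    finally have Nw: "(\<Sum>l<n. w l * N $$ (l, i)) = d' * f $$ (j, i)" using d0 by simp
    have Nf: "(\<Sum>l<n. f $$ (j, l) * N $$ (l, i)) = d * w i"
      using w(1)[OF si(2)] mat_mult_entry[OF cf cN j si(2)] by simp
    show "(?D * k) $$ (s, i) = (k * N) $$ (s, i)"
      unfolding mat_mult_entry[OF ck cN si] mult_entry2[OF snd_tE_carrier ck si]
      using j si Nw Nf by (auto simp: less_2_iff k_def d_def d'_def mult.commute)
  qed (use cN ck carrier_matD[OF snd_tE_carrier] in auto)
  show ?thesis
    using hk eq j by (intro bexI[of _ k]) (auto simp: C_eq k_def n_def)
qed

lemma determined_by_row:
  assumes N: "N \<in> carrier_mat n n" and k: "k \<in> carrier_mat 2 n" "snd (tE x y) * k = k * N"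
    and k': "k' \<in> carrier_mat 2 n" "snd (tE x y) * k' = k' * N"
    and j: "j < 2" "\<And>i. i < n \<Longrightarrow> k $$ (j, i) = k' $$ (j, i)"
  shows "k = k'"
proof (rule eq_matI)
  fix s i assume "s < dim_row k'" "i < dim_col k'"
  then have si: "s < 2" "i < n" using k' by auto
  have "(k * N) $$ (j, i) = (k' * N) $$ (j, i)"
    unfolding mat_mult_entry[OF k(1) N j(1) si(2)] mat_mult_entry[OF k'(1) N j(1) si(2)] using j by simp
  then have "k $$ (1 - j, i) = k' $$ (1 - j, i)"
    unfolding k(2)[symmetric] k'(2)[symmetric]
      mult_entry2[OF snd_tE_carrier k(1) j(1) si(2)] mult_entry2[OF snd_tE_carrier k'(1) j(1) si(2)]
    using j(1) t_nonzero by (auto simp: less_2_iff)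
  then show "k $$ (s, i) = k' $$ (s, i)" using j si by (auto simp: less_2_iff)
qed (use k k' in auto)

section \<open>Exact sequences, projectivity and injectivity in the matrix model\<close>

lemma MF_exactD:
  assumes "MF_exact c t MFphi A B C i p"
  obtains r s where "tw A \<in> MFt" "tw B \<in> MFt" "tw C \<in> MFt" "mobj A" "mobj B" "mobj C"
    and "snd (tw B) * twist b t (fst A) (fst B) i = twist b t (fst A) (fst B) i * snd (tw A)"
    and "snd (tw C) * twist b t (fst B) (fst C) p = twist b t (fst B) (fst C) p * snd (tw B)"
    and "r \<in> hom (fst B) (fst A)" "s \<in> hom (fst C) (fst B)"
    and "r * twist b t (fst A) (fst B) i = 1\<^sub>m (length (fst A))"
    and "twist b t (fst B) (fst C) p * s = 1\<^sub>m (length (fst C))"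
proof -
  have ABC: "tw A \<in> MFt" "tw B \<in> MFt" "tw C \<in> MFt" "mobj A" "mobj B" "mobj C"
    using assms by (simp_all add: MF_exact_def MF_phi_iff)
  have i: "i \<in> MF_hom c t A B" and p: "p \<in> MF_hom c t B C" using assms by (simp_all add: MF_exact_def)
  have ip: "i \<in> PX_hom (fst A) (fst B)" "p \<in> PX_hom (fst B) (fst C)" using i p by (simp_all add: MF_hom_def)
  obtain r s where "PX_comp c t (fst A) (fst B) (fst A) r i = PX_id (fst A)"
    "PX_comp c t (fst C) (fst B) (fst C) p s = PX_id (fst C)"
    using assms by (auto simp: MF_exact_def PX_split_exact_def)
  moreover have X: "set (fst A) \<subseteq> X" "set (fst B) \<subseteq> X" "set (fst C) \<subseteq> X"
    using ABC by (simp_all add: mobj_def)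
  ultimately show thesis
    using that[OF ABC _ _ twist_dhom twist_dhom, of r s] MF_hom_iff[OF ABC(4,5) ip(1)] MF_hom_iff[OF ABC(5,6) ip(2)] i p
    by (simp add: PX_comp_id_iff)
qed

lemma MF_exactI:
  assumes A: "A \<in> MFphi" and B: "B \<in> MFphi" and C: "C \<in> MFphi"
    and i: "i \<in> hom (fst A) (fst B)" and p: "p \<in> hom (fst B) (fst C)"
    and r: "r \<in> hom (fst B) (fst A)" and s: "s \<in> hom (fst C) (fst B)"
    and comm: "snd (tw B) * i = i * snd (tw A)" "snd (tw C) * p = p * snd (tw B)"
    and eq: "p * i = 0\<^sub>m (length (fst C)) (length (fst A))" "r * i = 1\<^sub>m (length (fst A))"
      "p * s = 1\<^sub>m (length (fst C))" "i * r + s * p = 1\<^sub>m (length (fst B))"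
  obtains i' p' where "MF_exact c t MFphi A B C i' p'" and "p' \<in> PX_hom (fst B) (fst C)"
    and "twist b t (fst B) (fst C) p' = p"
proof -
  have m: "mobj A" "mobj B" "mobj C" using A B C by (simp_all add: MF_phi_iff)
  then have X: "set (fst A) \<subseteq> X" "set (fst B) \<subseteq> X" "set (fst C) \<subseteq> X" by (simp_all add: mobj_def)
  obtain i' where i': "i' \<in> PX_hom (fst A) (fst B)" "twist b t (fst A) (fst B) i' = i" using twist_surj[OF i] by blast
  obtain p' where p': "p' \<in> PX_hom (fst B) (fst C)" "twist b t (fst B) (fst C) p' = p" using twist_surj[OF p] by blast
  obtain r' where r': "r' \<in> PX_hom (fst B) (fst A)" "twist b t (fst B) (fst A) r' = r" using twist_surj[OF r] by blast
  obtain s' where s': "s' \<in> PX_hom (fst C) (fst B)" "twist b t (fst C) (fst B) s' = s" using twist_surj[OF s] by blast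
  have "PX_comp c t (fst A) (fst B) (fst C) p' i' = PX_zero (fst A) (fst C)"
    using twist_inject[OF t_nonzero PX_comp_hom[of c t "fst A" "fst B" "fst C" p' i'] PX_zero_hom, of b] eq(1)
    by (simp add: twist_PX_comp X i' p' twist_zero)
  moreover have "PX_comp c t (fst B) (fst A) (fst B) i' r' + PX_comp c t (fst B) (fst C) (fst B) s' p' = PX_id (fst B)"
  proof -
    let ?u = "PX_comp c t (fst B) (fst A) (fst B) i' r'" and ?v = "PX_comp c t (fst B) (fst C) (fst B) s' p'"
    have "?u + ?v \<in> PX_hom (fst B) (fst B)" by (simp add: PX_hom_def PX_comp_def)
    moreover have "twist b t (fst B) (fst B) (?u + ?v) = twist b t (fst B) (fst B) (PX_id (fst B))"
      using eq(4) by (simp add: twist_add[OF PX_comp_hom PX_comp_hom] twist_PX_comp twist_PX_id X i' p' r' s')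
    ultimately show ?thesis using twist_inject[OF t_nonzero _ PX_id_hom] by blast
  qed
  moreover have "i' \<in> MF_hom c t A B" "p' \<in> MF_hom c t B C"
    using MF_hom_iff[OF m(1,2) i'(1)] MF_hom_iff[OF m(2,3) p'(1)] comm i'(2) p'(2) by simp_all
  ultimately have "MF_exact c t MFphi A B C i' p'"
    unfolding MF_exact_def PX_split_exact_def
    using A B C i' p' r' s' eq(2,3) X by (auto simp: PX_comp_id_iff)
  then show thesis using that p' by blast
qed

text \<open>The section \<open>s\<close> lifts \<open>H\<close> to \<open>s * H\<close>, which need
  not commute with the differentials. Only its column \<open>j\<close> is kept and extended to a
  morphism \<open>k\<close>; then \<open>P * k\<close> and \<open>H\<close> are morphisms with the
  same column \<open>j\<close>, hence equal.\<close>

lemma E_projective: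
  assumes xy: "x \<in> X" "y \<in> X" and E: "tE x y \<in> MFt" and j: "j < (2::nat)"
    and cond: "\<And>z. z \<in> X \<Longrightarrow> (if j = 0 then b y z + b x y \<le> e x z else b x z + (1 - b x y) \<le> e y z)"
  shows "MF_projective c t MFphi (E c t x y)"
  unfolding MF_projective_def
proof (intro conjI allI impI ballI)
  let ?E = "E c t x y" and ?T = "twist b t"
  have mE: "mobj ?E" and twE: "tw ?E = tE x y" and fE: "fst ?E = [x, y]"
    using mobj_E[OF xy] tw_E[OF xy] by (simp_all only: E_def fst_conv)
  show "?E \<in> MFphi" using E by (simp add: MF_phi_iff mE twE)
  fix A B C i p h
  assume ex: "MF_exact c t MFphi A B C i p" and h: "h \<in> MF_hom c t ?E C"
  obtain s where ABC: "tw A \<in> MFt" "tw B \<in> MFt" "tw C \<in> MFt" "mobj A" "mobj B" "mobj C"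
    and Np: "snd (tw C) * ?T (fst B) (fst C) p = ?T (fst B) (fst C) p * snd (tw B)"
    and s: "s \<in> hom (fst C) (fst B)"
    and ps: "?T (fst B) (fst C) p * s = 1\<^sub>m (length (fst C))"
    using MF_exactD[OF ex] by metis
  have X: "set (fst B) \<subseteq> X" "set (fst C) \<subseteq> X" "set [x, y] \<subseteq> X" using ABC xy by (simp_all add: mobj_def)
  have hP: "h \<in> PX_hom [x, y] (fst C)" using h by (simp add: MF_hom_def fE)
  define H P where "H = ?T [x, y] (fst C) h" and "P = ?T (fst B) (fst C) p"
  have NH: "snd (tw C) * H = H * snd (tE x y)"
    using MF_hom_iff[OF mE ABC(6), unfolded fE, OF hP] h by (simp add: twE H_def)
  have hH: "H \<in> hom [x, y] (fst C)" and hPp: "P \<in> hom (fst B) (fst C)" by (simp_all add: H_def P_def twist_dhom)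
  have hsH: "s * H \<in> hom [x, y] (fst B)" by (rule hom_mult[OF X(3,2,1) s hH])
  let ?B = "length (fst B)" and ?C = "length (fst C)"
  have cH: "H \<in> carrier_mat ?C 2" and cP: "P \<in> carrier_mat ?C ?B" and cs: "s \<in> carrier_mat ?B ?C"
    using dhomD(1)[OF hH] dhomD(1)[OF hPp] dhomD(1)[OF s] by (simp_all add: numeral_2_eq_2)
  have cN: "snd (tw B) \<in> carrier_mat ?B ?B" "snd (tw C) \<in> carrier_mat ?C ?C"
    using mobj_tw[OF ABC(5)] mobj_tw[OF ABC(6)] by (simp_all add: mobj_def)
  obtain k where k: "k \<in> hom [x, y] (fst B)" "snd (tw B) * k = k * snd (tE x y)"
    "\<And>l. l < ?B \<Longrightarrow> k $$ (l, j) = (s * H) $$ (l, j)"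
    using extend_from_column[OF xy ABC(2) _ j cond, of "s * H"] hsH by auto
  have ck: "k \<in> carrier_mat ?B 2" using dhomD(1)[OF k(1)] by (simp add: numeral_2_eq_2)
  have "P * k = H"
  proof (rule determined_by_column[OF cN(2) _ _ cH NH j])
    show "P * k \<in> carrier_mat ?C 2" using cP ck by simp
    show "snd (tw C) * (P * k) = P * k * snd (tE x y)"
      using commute_mult[OF snd_tE_carrier cN(1,2) ck k(2) cP] Np by (simp add: P_def)
    fix l assume l: "l < ?C"
    have "(P * k) $$ (l, j) = (P * (s * H)) $$ (l, j)"
      unfolding mat_mult_entry[OF cP ck l j] mat_mult_entry[OF cP mult_carrier_mat[OF cs cH] l j]
      using k(3) by (intro sum.cong) auto
    also have "P * (s * H) = H" using assoc_mult_mat[OF cP cs cH] ps cH by (simp add: P_def)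
    finally show "(P * k) $$ (l, j) = H $$ (l, j)" .
  qed
  moreover obtain k' where k': "k' \<in> PX_hom [x, y] (fst B)" "?T [x, y] (fst B) k' = k" using twist_surj[OF k(1)] by blast
  ultimately have "PX_comp c t (fst ?E) (fst B) (fst C) p k' = h"
    using twist_inject[OF t_nonzero PX_comp_hom hP, of b c t "fst B" p k'] X
    by (simp add: twist_PX_comp fE P_def H_def)
  moreover have "k' \<in> MF_hom c t ?E B"
    using MF_hom_iff[OF mE ABC(5), unfolded fE, OF k'(1)] k' k(2) by (simp add: twE)
  ultimately show "\<exists>k\<in>MF_hom c t ?E B. PX_comp c t (fst ?E) (fst B) (fst C) p k = h" by blast
qed

text \<open>Dually, row \<open>j\<close> of \<open>H * r\<close> is kept and extended to a morphism,
  where \<open>r\<close> is the retraction of the split sequence.\<close>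

lemma E_injective:
  assumes xy: "x \<in> X" "y \<in> X" and E: "tE x y \<in> MFt" and j: "j < (2::nat)"
    and cond: "\<And>z. z \<in> X \<Longrightarrow> (if j = 0 then b z y + (1 - b x y) \<le> e z x else b z x + b x y \<le> e z y)"
  shows "MF_injective c t MFphi (E c t x y)"
  unfolding MF_injective_def
proof (intro conjI allI impI ballI)
  let ?E = "E c t x y" and ?T = "twist b t"
  have mE: "mobj ?E" and twE: "tw ?E = tE x y" and fE: "fst ?E = [x, y]"
    using mobj_E[OF xy] tw_E[OF xy] by (simp_all only: E_def fst_conv)
  show "?E \<in> MFphi" using E by (simp add: MF_phi_iff mE twE)
  fix A B C i p h
  assume ex: "MF_exact c t MFphi A B C i p" and h: "h \<in> MF_hom c t A ?E"
  obtain r where ABC: "tw A \<in> MFt" "tw B \<in> MFt" "tw C \<in> MFt" "mobj A" "mobj B" "mobj C"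
    and Ni: "snd (tw B) * ?T (fst A) (fst B) i = ?T (fst A) (fst B) i * snd (tw A)"
    and r: "r \<in> hom (fst B) (fst A)"
    and ri: "r * ?T (fst A) (fst B) i = 1\<^sub>m (length (fst A))"
    using MF_exactD[OF ex] by metis
  have X: "set (fst A) \<subseteq> X" "set (fst B) \<subseteq> X" "set [x, y] \<subseteq> X" using ABC xy by (simp_all add: mobj_def)
  have hP: "h \<in> PX_hom (fst A) [x, y]" using h by (simp add: MF_hom_def fE)
  define H P where "H = ?T (fst A) [x, y] h" and "P = ?T (fst A) (fst B) i"
  have NH: "snd (tE x y) * H = H * snd (tw A)"
    using MF_hom_iff[OF ABC(4) mE, unfolded fE, OF hP] h by (simp add: twE H_def)
  have hH: "H \<in> hom (fst A) [x, y]" and hPp: "P \<in> hom (fst A) (fst B)" by (simp_all add: H_def P_def twist_dhom)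
  have hHr: "H * r \<in> hom (fst B) [x, y]" by (rule hom_mult[OF X(2,1,3) hH r])
  let ?A = "length (fst A)" and ?B = "length (fst B)"
  have cH: "H \<in> carrier_mat 2 ?A" and cP: "P \<in> carrier_mat ?B ?A" and cr: "r \<in> carrier_mat ?A ?B"
    using dhomD(1)[OF hH] dhomD(1)[OF hPp] dhomD(1)[OF r] by (simp_all add: numeral_2_eq_2)
  have cN: "snd (tw A) \<in> carrier_mat ?A ?A" "snd (tw B) \<in> carrier_mat ?B ?B"
    using mobj_tw[OF ABC(4)] mobj_tw[OF ABC(5)] by (simp_all add: mobj_def)
  obtain k where k: "k \<in> hom (fst B) [x, y]" "snd (tE x y) * k = k * snd (tw B)"
    "\<And>l. l < ?B \<Longrightarrow> k $$ (j, l) = (H * r) $$ (j, l)"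
    using extend_from_row[OF xy ABC(2) _ j cond, of "H * r"] hHr by auto
  have ck: "k \<in> carrier_mat 2 ?B" using dhomD(1)[OF k(1)] by (simp add: numeral_2_eq_2)
  have "k * P = H"
  proof (rule determined_by_row[OF cN(1) _ _ cH NH j])
    show "k * P \<in> carrier_mat 2 ?A" using cP ck by simp
    show "snd (tE x y) * (k * P) = k * P * snd (tw A)"
      using commute_mult[OF cN snd_tE_carrier cP _ ck k(2)] Ni by (simp add: P_def)
    fix l assume l: "l < ?A"
    have "(k * P) $$ (j, l) = (H * r * P) $$ (j, l)"
      unfolding mat_mult_entry[OF ck cP j l] mat_mult_entry[OF mult_carrier_mat[OF cH cr] cP j l]
      using k(3) by (intro sum.cong) auto
    also have "H * r * P = H" using assoc_mult_mat[OF cH cr cP] ri cH by (simp add: P_def)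
    finally show "(k * P) $$ (j, l) = H $$ (j, l)" .
  qed
  moreover obtain k' where k': "k' \<in> PX_hom (fst B) [x, y]" "?T (fst B) [x, y] k' = k" using twist_surj[OF k(1)] by blast
  ultimately have "PX_comp c t (fst A) (fst B) (fst ?E) k' i = h"
    using twist_inject[OF t_nonzero PX_comp_hom hP, of b c t "fst B" k' i] X
    by (simp add: twist_PX_comp fE P_def H_def)
  moreover have "k' \<in> MF_hom c t B ?E"
    using MF_hom_iff[OF ABC(5) mE, unfolded fE, OF k'(1)] k' k(2) by (simp add: twE)
  ultimately show "\<exists>k\<in>MF_hom c t B ?E. PX_comp c t (fst A) (fst B) (fst ?E) k i = h" by blast
qed

text \<open>With \<open>y\<close> equivalent to \<open>\<phi> x\<close>, the weight
  \<open>b x y\<close> is at most \<open>b x (\<phi> x)\<close> and \<open>y\<close> may take the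
  place of \<open>\<phi> x\<close>; the second inequality uses naturality as well. They are the
  conditions for extending from column 0 and from row 1.\<close>

lemma b_\<phi>_approx:
  assumes xy: "x \<in> X" "y \<in> X" and a: "b y (\<phi> x) = 0" "b (\<phi> x) y = 0" and z: "z \<in> X"
  shows "b y z + b x y \<le> e x z" and "b z x + b x y \<le> e z y"
proof -
  note \<phi> = \<phi>_closed[OF xy(1)] \<phi>_closed[OF z]
  show "b y z + b x y \<le> e x z"
    using b_triangle[OF xy(2) \<phi>(1) z] b_triangle[OF xy(1) \<phi>(1) xy(2)] a by (simp add: e_def)
  show "b z x + b x y \<le> e z y"
    using b_\<phi>[OF z xy(1)] b_triangle[OF \<phi>(2) xy(2) \<phi>(1)] b_triangle[OF xy(1) \<phi>(1) xy(2)] a by (simp add: e_def)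
qed

text \<open>The case of \<open>x\<close> equivalent to \<open>\<phi> y\<close> arises from the other
  one by exchanging \<open>x\<close> and \<open>y\<close>, provided that
  \<open>b y x = 1 - b x y\<close>. This can fail only for equivalent \<open>x\<close> and
  \<open>y\<close>, and then \<open>y\<close> is equivalent to \<open>\<phi> x\<close> too.\<close>

lemma E_projective_injective:
  assumes xy: "x \<in> X" "y \<in> X" and E: "tE x y \<in> MFt"
    and a: "approx c y (\<phi> x) \<or> approx c x (\<phi> y)"
  shows "MF_projective c t MFphi (E c t x y) \<and> MF_injective c t MFphi (E c t x y)"
proof -
  note \<phi> = \<phi>_closed[OF xy(1)] \<phi>_closed[OF xy(2)]
  consider "b y (\<phi> x) = 0" "b (\<phi> x) y = 0" | "b x (\<phi> y) = 0" "b (\<phi> y) x = 0" "b y x = 1 - b x y"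
  proof -
    have "b y (\<phi> x) = 0 \<and> b (\<phi> x) y = 0"
      if 0: "b x (\<phi> y) = 0" "b (\<phi> y) x = 0" and 1: "b y x \<noteq> 1 - b x y"
    proof -
      have 2: "b x y = 0" "b y x = 0"
        using 1 b_total[OF xy] b_le_1[OF xy] b_le_1[OF xy(2,1)] by linarith+
      have "b y (\<phi> y) = 0" "b (\<phi> y) y = 0"
        using b_triangle[OF xy(2,1) \<phi>(2)] b_triangle[OF \<phi>(2) xy] 0 2 by linarith+
      then have "b (\<phi> x) (\<phi> y) = 0" "b (\<phi> y) (\<phi> x) = 0"
        using b_\<phi>[OF xy] b_\<phi>[OF xy(2,1)] 2 by linarith+
      then show ?thesis
        using b_triangle[OF xy(2) \<phi>(2,1)] b_triangle[OF \<phi> xy(2)] \<open>b y (\<phi> y) = 0\<close> \<open>b (\<phi> y) y = 0\<close>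
        by linarith
    qed
    then show thesis
      using that a unfolding approx_iff[OF xy(2) \<phi>(1)] approx_iff[OF xy(1) \<phi>(2)] by metis
  qed
  then show ?thesis
  proof cases
    case 1
    then show ?thesis
      using E_projective[OF xy E, of 0] E_injective[OF xy E, of 1] b_\<phi>_approx[OF xy] by simp
  next
    case 2
    then show ?thesis
      using E_projective[OF xy E, of 1] E_injective[OF xy E, of 0] b_\<phi>_approx[OF xy(2,1)] by simp
  qed
qed

text \<open>
  The object \<open>P \<oplus> \<phi> P\<close> with the endomorphism \<open>[0, \<theta>; \<eta>, 0]\<close>, where \<open>\<theta>\<close> is \<open>t\<close> times the inverse
  of \<open>\<eta>\<close>, maps onto \<open>(P, d)\<close> by \<open>[1, g]\<close> when \<open>d = g \<eta>\<close>.
\<close>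

definition eta :: "'x list \<Rightarrow> 'r mat" where
  "eta xs = mat (length xs) (length xs) (\<lambda>(i, j). if i = j then t ^ b (xs ! i) (\<phi> (xs ! i)) else 0)"

definition theta :: "'x list \<Rightarrow> 'r mat" where
  "theta xs = mat (length xs) (length xs) (\<lambda>(i, j). if i = j then t ^ (1 - b (xs ! i) (\<phi> (xs ! i))) else 0)"

lemma eta_carrier [simp]: "eta xs \<in> carrier_mat (length xs) (length xs)"
  and theta_carrier [simp]: "theta xs \<in> carrier_mat (length xs) (length xs)"
  by (simp_all add: eta_def theta_def)

lemma mult_eta_entry:
  assumes "A \<in> carrier_mat m (length xs)" "i < m" "j < length xs"
  shows "(A * eta xs) $$ (i, j) = A $$ (i, j) * t ^ b (xs ! j) (\<phi> (xs ! j))"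
proof -
  have "(A * eta xs) $$ (i, j) = (\<Sum>k<length xs. if k = j then A $$ (i, j) * t ^ b (xs ! j) (\<phi> (xs ! j)) else 0)"
    unfolding mat_mult_entry[OF assms(1) eta_carrier assms(2,3)] using assms by (intro sum.cong) (auto simp: eta_def)
  then show ?thesis using assms by simp
qed

lemma mult_theta_entry:
  assumes "A \<in> carrier_mat m (length xs)" "i < m" "j < length xs"
  shows "(A * theta xs) $$ (i, j) = A $$ (i, j) * t ^ (1 - b (xs ! j) (\<phi> (xs ! j)))"
proof -
  have "(A * theta xs) $$ (i, j) = (\<Sum>k<length xs. if k = j then A $$ (i, j) * t ^ (1 - b (xs ! j) (\<phi> (xs ! j))) else 0)"
    unfolding mat_mult_entry[OF assms(1) theta_carrier assms(2,3)] using assms by (intro sum.cong) (auto simp: theta_def)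
  then show ?thesis using assms by simp
qed

lemma eta_theta:
  assumes "set xs \<subseteq> X"
  shows "eta xs * theta xs = t \<cdot>\<^sub>m 1\<^sub>m (length xs)" and "theta xs * eta xs = t \<cdot>\<^sub>m 1\<^sub>m (length xs)"
proof -
  have t: "t ^ b x (\<phi> x) * t ^ (1 - b x (\<phi> x)) = t" if "x \<in> X" for x
    using b_le_1[OF that \<phi>_closed[OF that]] by (simp add: power_add[symmetric])
  have xs: "xs ! i \<in> X" if "i < length xs" for i using assms that by (simp add: subset_iff)
  show "eta xs * theta xs = t \<cdot>\<^sub>m 1\<^sub>m (length xs)"
  proof (rule eq_matI)
    fix i j assume "i < dim_row (t \<cdot>\<^sub>m 1\<^sub>m (length xs))" "j < dim_col (t \<cdot>\<^sub>m 1\<^sub>m (length xs))"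
    then have ij: "i < length xs" "j < length xs" by simp_all
    show "(eta xs * theta xs) $$ (i, j) = (t \<cdot>\<^sub>m 1\<^sub>m (length xs)) $$ (i, j)"
      unfolding mult_theta_entry[OF eta_carrier ij] using ij t[OF xs[OF ij(2)]] by (auto simp: eta_def)
  qed (use carrier_matD[OF eta_carrier] carrier_matD[OF theta_carrier] in auto)
  show "theta xs * eta xs = t \<cdot>\<^sub>m 1\<^sub>m (length xs)"
  proof (rule eq_matI)
    fix i j assume "i < dim_row (t \<cdot>\<^sub>m 1\<^sub>m (length xs))" "j < dim_col (t \<cdot>\<^sub>m 1\<^sub>m (length xs))"
    then have ij: "i < length xs" "j < length xs" by simp_all
    show "(theta xs * eta xs) $$ (i, j) = (t \<cdot>\<^sub>m 1\<^sub>m (length xs)) $$ (i, j)"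
      unfolding mult_eta_entry[OF theta_carrier ij] using ij t[OF xs[OF ij(2)]] by (auto simp: theta_def mult.commute)
  qed (use carrier_matD[OF eta_carrier] carrier_matD[OF theta_carrier] in auto)
qed

lemma eta_dhom: "set xs \<subseteq> X \<Longrightarrow> eta xs \<in> dhom t e xs (map \<phi> xs)"
proof (rule dhomI)
  fix i j assume X: "set xs \<subseteq> X" and ij: "i < length (map \<phi> xs)" "j < length xs"
  show "t ^ e (xs ! j) (map \<phi> xs ! i) dvd eta xs $$ (i, j)"
    using ij b_refl[OF \<phi>_closed[OF subsetD[OF X nth_mem[OF ij(2)]]]] by (simp add: eta_def e_def)
qed simp

text \<open>Admissibility enters here: \<open>e (\<phi> x) x + b x (\<phi> x)\<close> equals
  \<open>b x (\<phi> (\<phi> x)) + b (\<phi> (\<phi> x)) x\<close>, and the weights between two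
  points add up to at most 1.\<close>

lemma theta_dhom: "set xs \<subseteq> X \<Longrightarrow> theta xs \<in> dhom t e (map \<phi> xs) xs"
proof (rule dhomI)
  fix i j assume X: "set xs \<subseteq> X" and ij: "i < length xs" "j < length (map \<phi> xs)"
  have x: "xs ! j \<in> X" using X ij by (simp add: subset_iff)
  have "e (\<phi> (xs ! j)) (xs ! j) \<le> 1 - b (xs ! j) (\<phi> (xs ! j))"
    using b_\<phi>_\<phi>[OF x] b_le_1[OF x \<phi>_closed[OF \<phi>_closed[OF x]]] b_total[OF x \<phi>_closed[OF \<phi>_closed[OF x]]]
      b_le_1[OF \<phi>_closed[OF \<phi>_closed[OF x]] x]
    unfolding e_def by linarith
  then show "t ^ e (map \<phi> xs ! j) (xs ! i) dvd theta xs $$ (i, j)"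
    using ij by (simp add: theta_def le_imp_power_dvd)
qed simp

lemma cover_exact:
  assumes C: "C \<in> MFphi"
  obtains A B i p g where "MF_exact c t MFphi A B C i p" and "B \<in> MFphi"
    and "p \<in> PX_hom (fst B) (fst C)" and "g \<in> hom (map \<phi> (fst C)) (fst C)" and "g * eta (fst C) = snd (tw C)"
    and "tw B = (fst C @ map \<phi> (fst C), four_block_mat (0\<^sub>m (length (fst C)) (length (fst C))) (theta (fst C))
      (eta (fst C)) (0\<^sub>m (length (fst C)) (length (fst C))))"
    and "twist b t (fst B) (fst C) p =
      four_block_mat (1\<^sub>m (length (fst C))) g (0\<^sub>m 0 (length (fst C))) (0\<^sub>m 0 (length (fst C)))"
proof -
  define xs N n where "xs = fst C" and "N = snd (tw C)" and "n = length xs"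
  let ?ys = "map \<phi> xs" and ?\<eta> = "eta xs" and ?\<theta> = "theta xs" and ?Z = "0\<^sub>m n n :: 'r mat"
  have twC: "tw C = (xs, N)" by (simp add: xs_def N_def prod_eq_iff)
  have X: "set xs \<subseteq> X" and Ne: "N \<in> dhom t e xs xs" and NN: "N * N = t \<cdot>\<^sub>m 1\<^sub>m n"
    using C by (auto simp: MF_phi_iff twC MFt_def n_def)
  have Y: "set ?ys \<subseteq> X" using X \<phi>_closed by auto
  have XY: "set (xs @ ?ys) \<subseteq> X" using X Y by simp
  have cN: "N \<in> carrier_mat n n" and c\<eta>: "?\<eta> \<in> carrier_mat n n" and c\<theta>: "?\<theta> \<in> carrier_mat n n"
    using dhomD(1)[OF Ne] by (simp_all add: n_def)
  have "\<exists>r. N $$ (i, j) = r * t ^ b (xs ! j) (\<phi> (xs ! j)) \<and> t ^ b (\<phi> (xs ! j)) (xs ! i) dvd r" if "i < n" "j < n" for i j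
  proof -
    have "t ^ b (\<phi> (xs ! j)) (xs ! i) * t ^ b (xs ! j) (\<phi> (xs ! j)) dvd N $$ (i, j)"
      using dhomD(2)[OF Ne, of i j] that by (simp add: n_def e_def power_add mult.commute)
    then obtain q where "N $$ (i, j) = t ^ b (\<phi> (xs ! j)) (xs ! i) * t ^ b (xs ! j) (\<phi> (xs ! j)) * q" by (rule dvdE)
    then show ?thesis by (intro exI[of _ "t ^ b (\<phi> (xs ! j)) (xs ! i) * q"]) (simp add: mult_ac)
  qed
  then obtain r where r: "\<And>i j. i < n \<Longrightarrow> j < n \<Longrightarrow> N $$ (i, j) = r i j * t ^ b (xs ! j) (\<phi> (xs ! j))"
    "\<And>i j. i < n \<Longrightarrow> j < n \<Longrightarrow> t ^ b (\<phi> (xs ! j)) (xs ! i) dvd r i j" by metis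
  define g where "g = mat n n (\<lambda>(i, j). r i j)"
  have cg: "g \<in> carrier_mat n n" by (simp add: g_def)
  have hg: "g \<in> hom ?ys xs" using r(2) by (intro dhomI) (auto simp: g_def n_def)
  have g\<eta>: "g * ?\<eta> = N"
  proof (rule eq_matI)
    fix i j assume "i < dim_row N" "j < dim_col N"
    then have ij: "i < n" "j < n" using cN by auto
    show "(g * ?\<eta>) $$ (i, j) = N $$ (i, j)"
      using mult_eta_entry[of g n xs i j] cg ij r(1)[OF ij] by (simp add: n_def g_def)
  qed (use cN c\<eta> cg in auto)
  have \<eta>\<theta>: "?\<eta> * ?\<theta> = t \<cdot>\<^sub>m 1\<^sub>m n" "?\<theta> * ?\<eta> = t \<cdot>\<^sub>m 1\<^sub>m n" using eta_theta[OF X] by (simp_all add: n_def)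
  \<comment> \<open>\<open>\<eta>\<close> need not be invertible, but it is diagonal with nonzero
    entries and can be cancelled on the right: \<open>N * g * \<eta>\<close> and
    \<open>\<theta> * \<eta>\<close> both equal \<open>t\<close> times the identity.\<close>
  have Ng: "N * g = ?\<theta>"
  proof (rule eq_matI)
    fix i j assume "i < dim_row ?\<theta>" "j < dim_col ?\<theta>"
    then have ij: "i < n" "j < n" using c\<theta> by auto
    have "N * g * ?\<eta> = ?\<theta> * ?\<eta>" using assoc_mult_mat[OF cN cg c\<eta>] g\<eta> NN \<eta>\<theta> by simp
    moreover have "N * g \<in> carrier_mat n (length xs)" "?\<theta> \<in> carrier_mat n (length xs)" "j < length xs"
      using cN cg c\<theta> ij by (simp_all add: n_def)
    ultimately have "(N * g) $$ (i, j) * t ^ b (xs ! j) (\<phi> (xs ! j)) = ?\<theta> $$ (i, j) * t ^ b (xs ! j) (\<phi> (xs ! j))"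
      using ij(1) by (metis mult_eta_entry)
    then show "(N * g) $$ (i, j) = ?\<theta> $$ (i, j)" using t_nonzero by simp
  qed (use cN c\<theta> cg in auto)
  \<comment> \<open>The kernel of \<open>[1, g]\<close> is embedded by the column of
    \<open>-g\<close> and \<open>1\<close>; the differential of the middle term maps it to the
    column of \<open>\<theta>\<close> and \<open>-\<eta> g\<close>, so the differential induced on
    the kernel is \<open>-\<eta> g\<close>.\<close>
  define M where "M = - (?\<eta> * g)"
  have c\<eta>g: "?\<eta> * g \<in> carrier_mat n n" and cM: "M \<in> carrier_mat n n" using c\<eta> cg by (auto simp: M_def)
  have \<eta>g: "g * (?\<eta> * g) = ?\<theta>" using assoc_mult_mat[OF cg c\<eta> cg] g\<eta> Ng by simp
  have "M * M = ?\<eta> * g * (?\<eta> * g)" using carrier_matD[OF c\<eta>g] by (simp only: M_def uminus_mult_left_mat uminus_mult_right_mat uminus_uminus_mat index_uminus_mat)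
  also have "\<dots> = t \<cdot>\<^sub>m 1\<^sub>m n" using assoc_mult_mat[OF c\<eta> cg c\<eta>g] \<eta>g \<eta>\<theta> by simp
  finally have MM: "M * M = t \<cdot>\<^sub>m 1\<^sub>m n" .
  have hM: "M \<in> dhom t e ?ys ?ys"
    unfolding M_def by (rule dhom_uminus, rule e_hom_mult[OF Y X Y eta_dhom[OF X] hg])
  have A': "(?ys, M) \<in> MFt" using Y hM MM by (simp add: MFt_def n_def)
  define D where "D = four_block_mat ?Z ?\<theta> ?\<eta> ?Z"
  have cZ: "?Z \<in> carrier_mat n n" by simp
  have "D * D = four_block_mat (t \<cdot>\<^sub>m 1\<^sub>m n) ?Z ?Z (t \<cdot>\<^sub>m 1\<^sub>m n)"
    unfolding D_def mult_four_block_mat[OF cZ c\<theta> c\<eta> cZ cZ c\<theta> c\<eta> cZ] using c\<theta> c\<eta> by (simp add: \<eta>\<theta>)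
  also have "\<dots> = t \<cdot>\<^sub>m 1\<^sub>m (n + n)" by (intro eq_matI) auto
  finally have DD: "D * D = t \<cdot>\<^sub>m 1\<^sub>m (n + n)" .
  have hD: "D \<in> dhom t e (xs @ ?ys) (xs @ ?ys)"
    unfolding D_def
    by (intro dhom_four_block theta_dhom[OF X] eta_dhom[OF X])
      (use dhom_zero[of xs xs t e] dhom_zero[of ?ys ?ys t e] in \<open>simp_all add: n_def\<close>)
  have B': "(xs @ ?ys, D) \<in> MFt" using XY hD DD by (simp add: MFt_def n_def)
  obtain A where A: "A \<in> MFphi" "tw A = (?ys, M)" using MFt_untwist[OF A'] by blast
  obtain B where B: "B \<in> MFphi" "tw B = (xs @ ?ys, D)" using MFt_untwist[OF B'] by blast
  have fA: "fst A = ?ys" and fB: "fst B = xs @ ?ys" using fst_tw[of A] fst_tw[of B] A B by simp_all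
  let ?i = "four_block_mat (- g) (0\<^sub>m n 0) (1\<^sub>m n) (0\<^sub>m n 0)"
  let ?p = "four_block_mat (1\<^sub>m n) g (0\<^sub>m 0 n) (0\<^sub>m 0 n)"
  let ?r = "four_block_mat ?Z (1\<^sub>m n) (0\<^sub>m 0 n) (0\<^sub>m 0 n)"
  let ?s = "four_block_mat (1\<^sub>m n) (0\<^sub>m n 0) ?Z (0\<^sub>m n 0)"
  have z: "?Z \<in> hom xs xs" "?Z \<in> hom xs ?ys" "1\<^sub>m n \<in> hom xs xs" "1\<^sub>m n \<in> hom ?ys ?ys"
    "(0\<^sub>m n 0 :: 'r mat) \<in> hom [] xs" "(0\<^sub>m n 0 :: 'r mat) \<in> hom [] ?ys"
    "(0\<^sub>m 0 n :: 'r mat) \<in> hom xs []" "(0\<^sub>m 0 n :: 'r mat) \<in> hom ?ys []"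
    using dhom_zero[of xs xs t b] dhom_zero[of ?ys xs t b] hom_one[OF X] hom_one[OF Y] dhom_zero[of xs "[]" t b]
      dhom_zero[of ?ys "[]" t b] dhom_zero[of "[]" xs t b] dhom_zero[of "[]" ?ys t b] by (simp_all add: n_def)
  have hi: "?i \<in> hom (?ys @ []) (xs @ ?ys)" by (intro dhom_four_block dhom_uminus hg z)
  have hp: "?p \<in> hom (xs @ ?ys) (xs @ [])" by (intro dhom_four_block hg z)
  have hr: "?r \<in> hom (xs @ ?ys) (?ys @ [])" by (intro dhom_four_block z)
  have hs: "?s \<in> hom (xs @ []) (xs @ ?ys)" by (intro dhom_four_block z)
  have c0: "(0\<^sub>m n 0 :: 'r mat) \<in> carrier_mat n 0" "(0\<^sub>m 0 n :: 'r mat) \<in> carrier_mat 0 n"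
    "(0\<^sub>m 0 0 :: 'r mat) \<in> carrier_mat 0 0" "(1\<^sub>m n :: 'r mat) \<in> carrier_mat n n" by simp_all
  have nz: "- ?Z = ?Z" by (intro eq_matI) auto
  note dims = carrier_matD[OF cg] carrier_matD[OF c\<eta>] carrier_matD[OF c\<eta>g]
  have cmg: "- g \<in> carrier_mat n n" using cg by simp
  have Di: "D * ?i = ?i * M"
  proof -
    have "D * ?i = four_block_mat ?\<theta> (0\<^sub>m n 0) M (0\<^sub>m n 0)"
      unfolding D_def mult_four_block_mat[OF cZ c\<theta> c\<eta> cZ cmg c0(1,4,1)] using c\<theta> c\<eta> cg c\<eta>g by (simp add: M_def nz)
    moreover have "?i * four_block_mat M (0\<^sub>m n 0) (0\<^sub>m 0 n) (0\<^sub>m 0 0) = four_block_mat ?\<theta> (0\<^sub>m n 0) M (0\<^sub>m n 0)"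
      unfolding mult_four_block_mat[OF cmg c0(1,4,1) cM c0(1,2,3)] using cg c\<eta>g cM c\<theta> \<eta>g
      by (simp add: M_def dims)
    ultimately show ?thesis unfolding four_block_pad[OF cM] by simp
  qed
  have Np: "N * ?p = ?p * D"
  proof -
    have "four_block_mat N (0\<^sub>m n 0) (0\<^sub>m 0 n) (0\<^sub>m 0 0) * ?p = four_block_mat N ?\<theta> (0\<^sub>m 0 n) (0\<^sub>m 0 n)"
      unfolding mult_four_block_mat[OF cN c0(1,2,3) c0(4) cg c0(2,2)] using cN cg c\<theta> Ng by simp
    moreover have "?p * D = four_block_mat N ?\<theta> (0\<^sub>m 0 n) (0\<^sub>m 0 n)"
      unfolding D_def mult_four_block_mat[OF c0(4) cg c0(2,2) cZ c\<theta> c\<eta> cZ] using cN cg c\<theta> c\<eta> g\<eta> by simp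
    ultimately show ?thesis unfolding four_block_pad[OF cN] by simp
  qed
  have pi: "?p * ?i = ?Z"
    unfolding mult_four_block_mat[OF c0(4) cg c0(2,2) cmg c0(1,4,1)] using cg
    by (intro eq_matI) auto
  have ri: "?r * ?i = 1\<^sub>m n"
    unfolding mult_four_block_mat[OF cZ c0(4,2,2) cmg c0(1,4,1)] using cg by (intro eq_matI) auto
  have ps: "?p * ?s = 1\<^sub>m n"
    unfolding mult_four_block_mat[OF c0(4) cg c0(2,2) c0(4,1) cZ c0(1)] using cg by (intro eq_matI) auto
  have sum: "?i * ?r + ?s * ?p = 1\<^sub>m (n + n)"
    unfolding mult_four_block_mat[OF cmg c0(1,4,1) cZ c0(4,2,2)] mult_four_block_mat[OF c0(4,1) cZ c0(1) c0(4) cg c0(2,2)]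
    using cg by (intro eq_matI) auto
  obtain i' p' where ip: "MF_exact c t MFphi A B C i' p'" "p' \<in> PX_hom (fst B) (fst C)"
    "twist b t (fst B) (fst C) p' = ?p"
    by (rule MF_exactI[OF A(1) B(1) C, of ?i ?p ?r ?s])
      (use hi hp hr hs Di Np pi ri ps sum in \<open>simp_all add: fA fB A B twC xs_def[symmetric] n_def[symmetric]\<close>)
  show thesis
    by (rule that[OF ip(1) B(1) ip(2)]) (use hg g\<eta> ip(3) B(2) in \<open>simp_all add: xs_def N_def n_def D_def\<close>)
qed

text \<open>Projectivity lifts the identity of \<open>E(x, y)\<close> to a section \<open>K\<close>
  of the canonical epimorphism. Two of its entries satisfy \<open>\<alpha> + \<delta> = 1\<close>,
  so one of them is a unit. Each carries, by commutation with the differentials, a power of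
  \<open>t\<close> that a unit can have only under one of the two equivalences.\<close>

lemma projective_imp_approx:
  assumes xy: "x \<in> X" "y \<in> X" and E: "tE x y \<in> MFt"
    and proj: "MF_projective c t MFphi (E c t x y)"
  shows "approx c y (\<phi> x) \<or> approx c x (\<phi> y)"
proof -
  let ?E = "E c t x y"
  have mE: "mobj ?E" and twE: "tw ?E = tE x y" using mobj_E[OF xy] tw_E[OF xy] by simp_all
  have fE: "fst ?E = [x, y]" by (simp add: E_def)
  have EP: "?E \<in> MFphi" using E by (simp add: MF_phi_iff mE twE)
  obtain A B i p g where ex: "MF_exact c t MFphi A B ?E i p" and B: "B \<in> MFphi"
    and p: "p \<in> PX_hom (fst B) [x, y]" and g: "g \<in> hom [\<phi> x, \<phi> y] [x, y]" and g\<eta>: "g * eta [x, y] = snd (tE x y)"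
    and twB: "tw B = ([x, y] @ [\<phi> x, \<phi> y], four_block_mat (0\<^sub>m 2 2) (theta [x, y]) (eta [x, y]) (0\<^sub>m 2 2))"
    and P: "twist b t (fst B) [x, y] p = four_block_mat (1\<^sub>m 2) g (0\<^sub>m 0 2) (0\<^sub>m 0 2)"
    using cover_exact[OF EP] by (simp add: fE twE numeral_2_eq_2) blast
  have mB: "mobj B" using B by (simp add: MF_phi_iff)
  have fB: "fst B = [x, y, \<phi> x, \<phi> y]" using fst_tw[of B] twB by simp
  have "PX_id [x, y] \<in> MF_hom c t ?E ?E"
    using MF_hom_iff[OF mE mE, unfolded fE, OF PX_id_hom] xy twE carrier_matD[OF snd_tE_carrier]
    by (simp add: twist_PX_id numeral_2_eq_2[symmetric])
  then obtain k where k: "k \<in> MF_hom c t ?E B" "PX_comp c t [x, y] (fst B) [x, y] p k = PX_id [x, y]"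
    using proj ex unfolding MF_projective_def fE[symmetric] by blast
  have kP: "k \<in> PX_hom [x, y] (fst B)" using k(1) by (simp add: MF_hom_def fE)
  define K where "K = twist b t [x, y] (fst B) k"
  have hK: "K \<in> hom [x, y] [x, y, \<phi> x, \<phi> y]" using twist_dhom[of b t "[x, y]" "fst B" k] by (simp add: K_def fB)
  have cK: "K \<in> carrier_mat 4 2" using dhomD(1)[OF hK] by (simp add: numeral_eq_Suc)
  have DK: "four_block_mat (0\<^sub>m 2 2) (theta [x, y]) (eta [x, y]) (0\<^sub>m 2 2) * K = K * snd (tE x y)"
    using MF_hom_iff[OF mE mB, unfolded fE, OF kP] k(1) by (simp add: twB twE K_def)
  have PK: "four_block_mat (1\<^sub>m 2) g (0\<^sub>m 0 2) (0\<^sub>m 0 2) * K = 1\<^sub>m 2"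
    using k(2) PX_comp_id_iff[of "[x, y]" "fst B" p k] mB xy by (simp add: P K_def mobj_def numeral_2_eq_2)
  have cg: "g \<in> carrier_mat 2 2" and c\<theta>: "theta [x, y] \<in> carrier_mat 2 2" and c\<eta>: "eta [x, y] \<in> carrier_mat 2 2"
    using dhomD(1)[OF g] theta_carrier[of "[x, y]"] eta_carrier[of "[x, y]"] by (simp_all add: numeral_2_eq_2)
  have cB: "four_block_mat (0\<^sub>m 2 2) (theta [x, y]) (eta [x, y]) (0\<^sub>m 2 2) \<in> carrier_mat 4 4"
    and cP: "four_block_mat (1\<^sub>m 2) g (0\<^sub>m 0 2) (0\<^sub>m 0 2) \<in> carrier_mat 2 4"
    using carrier_matD[OF cg] carrier_matD[OF c\<theta>] carrier_matD[OF c\<eta>] by (auto intro!: carrier_matI)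
  have four: "(\<Sum>l<4. f l) = f 0 + f 1 + f 2 + f 3" for f :: "nat \<Rightarrow> 'r"
    by (simp add: numeral_eq_Suc)
  define \<alpha> \<delta> where "\<alpha> = K $$ (0, 0)" and "\<delta> = K $$ (1, 1)"
  note [simp] = carrier_matD[OF cg] carrier_matD[OF c\<theta>] carrier_matD[OF c\<eta>]
  have ge: "g $$ (0, 0) * t ^ b x (\<phi> x) = 0" "g $$ (0, 1) * t ^ b y (\<phi> y) = t ^ (1 - b x y)"
    using mult_eta_entry[of g 2 "[x, y]" 0 0] mult_eta_entry[of g 2 "[x, y]" 0 1] cg
    unfolding g\<eta> by (simp_all add: numeral_2_eq_2)
  have D0: "t ^ (1 - b x (\<phi> x)) * K $$ (2, 1) = \<alpha> * t ^ (1 - b x y)"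
    using arg_cong[OF DK, of "\<lambda>M. M $$ (0, 1)"] mat_mult_entry[OF cB cK, of 0 1] mult_entry2[OF cK snd_tE_carrier, of 0 1]
    by (simp add: four theta_def \<alpha>_def del: index_mult_mat(1))
  have D1: "t ^ (1 - b y (\<phi> y)) * K $$ (3, 0) = \<delta> * t ^ b x y"
    using arg_cong[OF DK, of "\<lambda>M. M $$ (1, 0)"] mat_mult_entry[OF cB cK, of 1 0] mult_entry2[OF cK snd_tE_carrier, of 1 0]
    by (simp add: four theta_def \<delta>_def del: index_mult_mat(1))
  have D3: "t ^ b y (\<phi> y) * \<delta> = K $$ (3, 0) * t ^ (1 - b x y)"
    using arg_cong[OF DK, of "\<lambda>M. M $$ (3, 1)"] mat_mult_entry[OF cB cK, of 3 1] mult_entry2[OF cK snd_tE_carrier, of 3 1]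
    by (simp add: four eta_def \<delta>_def del: index_mult_mat(1))
  have "\<alpha> + g $$ (0, 1) * K $$ (3, 0) = 1"
    using arg_cong[OF PK, of "\<lambda>M. M $$ (0, 0)"] mat_mult_entry[OF cP cK, of 0 0] ge(1) t_nonzero
    by (simp add: four \<alpha>_def del: index_mult_mat(1))
  \<comment> \<open>After cancelling a power of \<open>t\<close>, \<open>D3\<close> identifies
    \<open>\<delta>\<close> with the term that completes \<open>\<alpha>\<close> to 1.\<close>
  moreover have "t ^ b y (\<phi> y) * \<delta> = t ^ b y (\<phi> y) * (g $$ (0, 1) * K $$ (3, 0))"
    unfolding D3 ge(2)[symmetric] by (simp add: mult_ac)
  ultimately have "\<alpha> + \<delta> = 1" using t_nonzero by simp
  then have "\<alpha> dvd 1 \<or> \<delta> dvd 1" using t_local[of \<alpha>] t_local[of \<delta>] t_nonunit by (metis dvd_add)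
  have cancel: "k \<le> l" if "u dvd 1" "t ^ k dvd u * t ^ l" for u k l
  proof -
    obtain v where "1 = u * v" using \<open>u dvd 1\<close> by (rule dvdE)
    then have "v * (u * t ^ l) = t ^ l" by (metis mult.assoc mult.commute mult_1)
    then have "t ^ k dvd t ^ l" using that(2) by (metis dvd_mult)
    then show ?thesis by (simp add: t_power_dvd_iff)
  qed
  note \<phi> = \<phi>_closed[OF xy(1)] \<phi>_closed[OF xy(2)]
  have hE: "snd (tE x y) \<in> dhom t e [x, y] [x, y]" using E by (auto simp: MFt_def tE_def)
  show ?thesis
    using \<open>\<alpha> dvd 1 \<or> \<delta> dvd 1\<close>
  proof
    assume "\<alpha> dvd 1"
    moreover have "t ^ ((1 - b x (\<phi> x)) + b y (\<phi> x)) dvd \<alpha> * t ^ (1 - b x y)"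
      unfolding D0[symmetric] power_add using dhomD(2)[OF hK, of 2 1] by (intro mult_dvd_mono) simp_all
    ultimately have "(1 - b x (\<phi> x)) + b y (\<phi> x) \<le> 1 - b x y" by (rule cancel)
    moreover have "e x y \<le> b x y" using dhomD(2)[OF hE, of 1 0] by (simp add: t_power_dvd_iff)
    \<comment> \<open>The first inequality bounds \<open>b y (\<phi> x)\<close> by
      \<open>b x (\<phi> x) - b x y\<close>, the second bounds \<open>b (\<phi> x) y\<close> by the
      negative of this difference.\<close>
    ultimately have "b y (\<phi> x) = 0 \<and> b (\<phi> x) y = 0"
      using b_le_1[OF xy(1) \<phi>(1)] b_le_1[OF xy] unfolding e_def by linarith
    then show ?thesis using approx_iff[OF xy(2) \<phi>(1)] by simp
  next
    assume "\<delta> dvd 1"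
    moreover have "t ^ ((1 - b y (\<phi> y)) + b x (\<phi> y)) dvd \<delta> * t ^ b x y"
      unfolding D1[symmetric] power_add using dhomD(2)[OF hK, of 3 0] by (intro mult_dvd_mono) simp_all
    ultimately have "(1 - b y (\<phi> y)) + b x (\<phi> y) \<le> b x y" by (rule cancel)
    moreover have "e y x \<le> 1 - b x y" using dhomD(2)[OF hE, of 0 1] by (simp add: t_power_dvd_iff)
    ultimately have "b x (\<phi> y) = 0 \<and> b (\<phi> y) x = 0"
      using b_le_1[OF xy(2) \<phi>(2)] b_le_1[OF xy] unfolding e_def by linarith
    then show ?thesis using approx_iff[OF xy(1) \<phi>(2)] by simp
  qed
qed

end

theorem theorem2p1p7:
  fixes X :: "'x set" and c :: "'x \<Rightarrow> 'x \<Rightarrow> 'x \<Rightarrow> nat"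
    and Xt :: "'y set" and leq :: "'y \<Rightarrow> 'y \<Rightarrow> bool" and \<pi> :: "'y \<Rightarrow> 'x" and \<sigma> :: "'y \<Rightarrow> 'y"
    and \<phi> :: "'x \<Rightarrow> 'x" and t :: "'r::idom"
  assumes "discrete_valuation_ring TYPE('r)" and "uniformizer t"
    and "cyclically_ordered X c Xt leq \<pi> \<sigma>"
    and "admissible X c Xt leq \<pi> \<sigma> \<phi>"
  shows
    "(\<forall>A\<in>MF_phi X c t \<phi>.
        \<exists>ps. (\<forall>(x, y)\<in>set ps. x \<in> X \<and> y \<in> X \<and>
                in_cyclic_order Xt leq \<pi> \<sigma> (\<phi> x) y (inv_into X \<phi> x)) \<and>
             MF_iso c t A (MF_sum (map (\<lambda>(x, y). E c t x y) ps))) \<and>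
     (\<forall>x\<in>X. \<forall>y\<in>X. in_cyclic_order Xt leq \<pi> \<sigma> (\<phi> x) y (inv_into X \<phi> x) \<longrightarrow>
        MF_indecomposable c t (MF_phi X c t \<phi>) (E c t x y)) \<and>
     (\<forall>A\<in>MF_phi X c t \<phi>. \<forall>Bs Cs.
        (\<forall>B\<in>set Bs. MF_indecomposable c t (MF_phi X c t \<phi>) B) \<longrightarrow>
        (\<forall>C\<in>set Cs. MF_indecomposable c t (MF_phi X c t \<phi>) C) \<longrightarrow>
        MF_iso c t A (MF_sum Bs) \<longrightarrow> MF_iso c t A (MF_sum Cs) \<longrightarrow>
        (\<exists>p. bij_betw p {..<length Bs} {..<length Cs} \<and>
             (\<forall>i<length Bs. MF_iso c t (Bs ! i) (Cs ! p i)))) \<and>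
     (\<forall>x\<in>X. \<forall>y\<in>X. in_cyclic_order Xt leq \<pi> \<sigma> (\<phi> x) y (inv_into X \<phi> x) \<longrightarrow>
        (MF_projective c t (MF_phi X c t \<phi>) (E c t x y) \<and>
         MF_injective c t (MF_phi X c t \<phi>) (E c t x y) \<longleftrightarrow>
         approx c y (\<phi> x) \<or> approx c x (\<phi> y)))"
proof -
  \<comment> \<open>For empty \<open>X\<close> the chosen point is arbitrary; the facts collected in
    \<open>W\<close> are applied to elements of \<open>X\<close> only.\<close>
  define b where "b = c (SOME w. w \<in> X)"
  have w: "(SOME w. w \<in> X) \<in> X" if "x \<in> X" for x using that by (rule someI)
  note W = cyclic_order_weights[OF assms(3,4) w b_def]
  have \<phi>X: "\<phi> x \<in> X" if "x \<in> X" for x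
    using assms(4) that by (auto simp: admissible_def cyclic_automorphism_def dest: bij_betwE)
  interpret cyclic_weights X c b \<phi> t
  proof
    show "c x y z + b x z = b x y + b y z" if "x \<in> X" "y \<in> X" "z \<in> X" for x y z
      by (rule W(1)[OF that(1) that])
    show "b x x = 0" if "x \<in> X" for x by (rule W(2)[OF that that])
    show "b x y = 0 \<or> b y x = 0" if "x \<in> X" "y \<in> X" for x y by (rule W(3)[OF that(1) that])
    show "b x y \<le> 1" if "x \<in> X" "y \<in> X" for x y by (rule W(4)[OF that(1) that])
    show "b (\<phi> x) (\<phi> y) + b x (\<phi> x) = b x y + b y (\<phi> y)" if "x \<in> X" "y \<in> X" for x y
      by (rule W(5)[OF that(1) that])
    show "b x (\<phi> (\<phi> x)) = b x (\<phi> x) + b (\<phi> x) (\<phi> (\<phi> x))" if "x \<in> X" for x by (rule W(6)[OF that that])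
  qed (use \<phi>X dvr_local[OF assms(1,2)] in auto)
  have cyc: "in_cyclic_order Xt leq \<pi> \<sigma> (\<phi> x) y (inv_into X \<phi> x) \<longleftrightarrow> tE x y \<in> MFt" if "x \<in> X" "y \<in> X" for x y
    unfolding W(7)[OF that(1) that] tE_MFt_iff[OF that] e_def ..
  have "\<exists>ps. (\<forall>(x, y)\<in>set ps. x \<in> X \<and> y \<in> X \<and> in_cyclic_order Xt leq \<pi> \<sigma> (\<phi> x) y (inv_into X \<phi> x)) \<and>
             MF_iso c t A (MF_sum (map (\<lambda>(x, y). E c t x y) ps))" if "A \<in> MF_phi X c t \<phi>" for A
  proof -
    have A: "mobj A" "tw A \<in> MFt" using that by (simp_all add: MF_phi_iff)
    obtain ps where ps: "\<forall>(x, y)\<in>set ps. x \<in> X \<and> y \<in> X \<and> tE x y \<in> MFt"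
      "tiso (tw A) (MF_sum (map (\<lambda>(x, y). tE x y) ps))" using decomposition[OF A(2)] by blast
    define Es where "Es = map (\<lambda>(x, y). E c t x y) ps"
    have m: "mobj B" if "B \<in> set Es" for B using that ps(1) mobj_E by (auto simp: Es_def)
    have "map tw Es = map (\<lambda>(x, y). tE x y) ps" using ps(1) by (auto simp: tw_E Es_def)
    moreover have "tw (MF_sum Es) = MF_sum (map tw Es)" by (rule tw_MF_sum[OF m])
    moreover have "mobj (MF_sum Es)" by (rule MF_sum_Cons(2)[OF mobj_zero m])
    ultimately have "MF_iso c t A (MF_sum (map (\<lambda>(x, y). E c t x y) ps))"
      using MF_iso_iff[OF A(1), of "MF_sum Es"] ps(2) unfolding Es_def[symmetric] by simp
    moreover have "\<forall>(x, y)\<in>set ps. x \<in> X \<and> y \<in> X \<and> in_cyclic_order Xt leq \<pi> \<sigma> (\<phi> x) y (inv_into X \<phi> x)"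
      using ps(1) cyc by auto
    ultimately show ?thesis by blast
  qed
  moreover have "\<exists>p. bij_betw p {..<length Bs} {..<length Cs} \<and> (\<forall>i<length Bs. MF_iso c t (Bs ! i) (Cs ! p i))"
    if "A \<in> MF_phi X c t \<phi>" "\<forall>B\<in>set Bs. MF_indecomposable c t (MF_phi X c t \<phi>) B"
      "\<forall>C\<in>set Cs. MF_indecomposable c t (MF_phi X c t \<phi>) C" "MF_iso c t A (MF_sum Bs)" "MF_iso c t A (MF_sum Cs)"
    for A Bs Cs
    by (rule Krull_Schmidt[of _ _ A]) (use that MF_phi_iff in auto)
  moreover have "MF_indecomposable c t (MF_phi X c t \<phi>) (E c t x y)"
    if "x \<in> X" "y \<in> X" "in_cyclic_order Xt leq \<pi> \<sigma> (\<phi> x) y (inv_into X \<phi> x)" for x y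
    using E_indecomposable cyc that by blast
  moreover have "MF_projective c t (MF_phi X c t \<phi>) (E c t x y) \<and> MF_injective c t (MF_phi X c t \<phi>) (E c t x y)
      \<longleftrightarrow> approx c y (\<phi> x) \<or> approx c x (\<phi> y)"
    if "x \<in> X" "y \<in> X" "in_cyclic_order Xt leq \<pi> \<sigma> (\<phi> x) y (inv_into X \<phi> x)" for x y
    using E_projective_injective projective_imp_approx cyc that by blast
  ultimately show ?thesis by (intro conjI ballI allI impI) blast+
qed

end
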